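(* The power series expansion of $\sigma(u)^2$ at $u=0$ belongs to $\mathbb{Z}[\mu_1,\mu_2,\mu_3,\mu_4,\mu_6]\langle\langle u\rangle\rangle$, and the power series expansion of $\sigma(u)$ at $u=0$ belongs to $\mathbb{Z}[\tfrac{\mu_1}{2},\mu_2,\mu_3,\mu_4,\mu_6]\langle\langle u\rangle\rangle$. The first several terms of the latter are $$\begin{aligned}\sigma(u)&=u+\Big(\big(\tfrac{\mu_1}{2}\big)^2+\mu_2\Big)\tfrac{u^3}{3!}+\Big(\big(\tfrac{\mu_1}{2}\big)^4+2\mu_2\big(\tfrac{\mu_1}{2}\big)^2+\mu_3\mu_1+\mu_2^2+2\mu_4\Big)\tfrac{u^5}{5!}\\&\quad+\Big(\big(\tfrac{\mu_1}{2}\big)^6+3\mu_2\big(\tfrac{\mu_1}{2}\big)^4+6\mu_3\big(\tfrac{\mu_1}{2}\big)^3+3\mu_2^2\big(\tfrac{\mu_1}{2}\big)^2+6\mu_4\big(\tfrac{\mu_1}{2}\big)^2+6\mu_3\mu_2\tfrac{\mu_1}{2}+\mu_2^3+6\mu_4\mu_2+6\mu_3^2+24\mu_6\Big)\tfrac{u^7}{7!}+\cdots .\end{aligned}$$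
   Context: Let $\mathscr{E}: y^2+(\mu_1x+\mu_3)y=x^3+\mu_2x^2+\mu_4x+\mu_6$ be a (nonsingular) elliptic curve over $\mathbb{C}$ with coefficients $\mu_1,\mu_2,\mu_3,\mu_4,\mu_6$. Put $\omega_1=\frac{dx}{2y+\mu_1x+\mu_3}$ and $\eta_1=\frac{-x\,dx}{2y+\mu_1x+\mu_3}$. Let $\alpha,\beta$ be closed paths generating the fundamental group of $\mathscr{E}$ with intersection number $\alpha\cdot\beta=-\beta\cdot\alpha=1$, and put $\omega'=\int_\alpha\omega_1$, $\omega''=\int_\beta\omega_1$, $\eta'=\int_\alpha\eta_1$, $\eta''=\int_\beta\eta_1$ (so $\omega''\eta'-\omega'\eta''=2\pi i$ and $\operatorname{Im}(\omega''/\omega')>0$). The sigma function is $$\sigma(u)=c\,\exp\!\big(\tfrac12u^2\eta'/\omega'\big)\,\vartheta(u/\omega'\mid\omega''/\omega'),\qquad \vartheta(z\mid\tau)=\sum_{n\in\mathbb{Z}}\exp\!\big(\pi i\tau(n+\tfrac12)^2+2\pi i(n+\tfrac12)(z+\tfrac12)\big),$$ where the nonzero constant $c$ is fixed by $\sigma(u)=u+O(u^2)$. The function $\sigma$ is entire and does not depend on the choice of $\alpha,\beta$. For an integral domain $A$ of characteristic $0$, $A\langle\langle u\rangle\rangle$ denotes the ring of series $\sum_{j\ge0}C_j\,u^j/j!$ with all $C_j\in A$ (series that are "Hurwitz integral" over $A$). The expansion of $\sigma$ (or $\sigma^2$) is regarded as a power series in $u$ with coefficients universal polynomials in the $\mu_j$,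 the $\mu_j$ being treated as indeterminates; "belongs to $A\langle\langle u\rangle\rangle$" means that for every $j$ the coefficient of $u^j/j!$ is such a polynomial lying in $A$. *)

theory Defs
  imports
    "HOL-Analysis.Analysis"
    "HOL-Library.Poly_Mapping"
    "HOL-Library.Landau_Symbols"
begin

section \<open>The complex projective plane\<close>

definition proj_rel :: "complex \<times> complex \<times> complex \<Rightarrow> complex \<times> complex \<times> complex \<Rightarrow> bool" where
  "proj_rel v w \<longleftrightarrow> v \<noteq> 0 \<and> w \<noteq> 0 \<and>
     (\<exists>c. c \<noteq> 0 \<and> w = (c * fst v, c * fst (snd v), c * snd (snd v)))"

lemma part_equivp_proj_rel: "part_equivp proj_rel"
proof (rule part_equivpI)
  have "proj_rel (1, 1, 1) (1, 1, 1)"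
    unfolding proj_rel_def by (intro conjI exI[of _ 1]) (simp_all add: zero_prod_def)
  then show "\<exists>v. proj_rel v v" ..
  show "symp proj_rel"
  proof (rule sympI)
    fix v w assume "proj_rel v w"
    then obtain c where c: "c \<noteq> 0" "v \<noteq> 0" "w \<noteq> 0"
      and w: "w = (c * fst v, c * fst (snd v), c * snd (snd v))"
      unfolding proj_rel_def by blast
    have "v = (inverse c * fst w, inverse c * fst (snd w), inverse c * snd (snd w))"
      unfolding w using c(1) by (simp add: prod_eq_iff)
    moreover have "inverse c \<noteq> 0"
      using c(1) by simp
    ultimately show "proj_rel w v"
      unfolding proj_rel_def using c(2,3) by iprover
  qed
  show "transp proj_rel"
  proof (rule transpI)
    fix u v w assume "proj_rel u v" "proj_rel v w"
    then obtain c d where cd: "c \<noteq> 0" "d \<noteq> 0" "u \<noteq> 0" "w \<noteq> 0"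
      and v: "v = (c * fst u, c * fst (snd u), c * snd (snd u))"
      and w: "w = (d * fst v, d * fst (snd v), d * snd (snd v))"
      unfolding proj_rel_def by blast
    have "w = (d * c * fst u, d * c * fst (snd u), d * c * snd (snd u))"
      unfolding w v by simp
    moreover have "d * c \<noteq> 0"
      using cd(1,2) by simp
    ultimately show "proj_rel u w"
      unfolding proj_rel_def using cd(3,4) by iprover
  qed
qed

quotient_type cproj2 = "complex \<times> complex \<times> complex" / partial: proj_rel
  by (rule part_equivp_proj_rel)

text \<open>The quotient topology from the nonzero vectors of \<open>\<complex>\<^sup>3\<close>.\<close>

instantiation cproj2 :: topological_space
begin

definition open_cproj2 :: "cproj2 set \<Rightarrow> bool" where
  "open_cproj2 U \<longleftrightarrow> open {v. v \<noteq> 0 \<and> abs_cproj2 v \<in> U}"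

instance
proof
  have "{v::complex \<times> complex \<times> complex. v \<noteq> 0 \<and> abs_cproj2 v \<in> UNIV} = - {0}"
    by blast
  moreover have "open (- {0 :: complex \<times> complex \<times> complex})"
    by (rule open_Compl[OF closed_singleton])
  ultimately show "open (UNIV :: cproj2 set)"
    unfolding open_cproj2_def by (simp only:)
next
  fix S T :: "cproj2 set" assume ST: "open S" "open T"
  have "{v. v \<noteq> 0 \<and> abs_cproj2 v \<in> S \<inter> T} =
    {v. v \<noteq> 0 \<and> abs_cproj2 v \<in> S} \<inter> {v. v \<noteq> 0 \<and> abs_cproj2 v \<in> T}"
    by blast
  with open_Int[OF ST[unfolded open_cproj2_def]] show "open (S \<inter> T)"
    unfolding open_cproj2_def by (simp only:)
next
  fix K :: "cproj2 set set" assume K: "\<forall>S\<in>K. open S"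
  have "{v. v \<noteq> 0 \<and> abs_cproj2 v \<in> \<Union> K} =
    (\<Union>S\<in>K. {v. v \<noteq> 0 \<and> abs_cproj2 v \<in> S})"
    by blast
  with open_UN[OF K[unfolded open_cproj2_def]] show "open (\<Union> K)"
    unfolding open_cproj2_def by (simp only:)
qed

end

section \<open>The curve\<close>

text \<open>
  The coefficients are a function \<open>\<mu> :: nat \<Rightarrow> complex\<close>, of which only the values at 1, 2, 3, 4, 6
  are used.
\<close>

definition affine_curve :: "(nat \<Rightarrow> complex) \<Rightarrow> (complex \<times> complex) set" where
  "affine_curve \<mu> = {(x, y). y\<^sup>2 + (\<mu> 1 * x + \<mu> 3) * y = x ^ 3 + \<mu> 2 * x\<^sup>2 + \<mu> 4 * x + \<mu> 6}"

definition proj_curve :: "(nat \<Rightarrow> complex) \<Rightarrow> cproj2 set" where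
  "proj_curve \<mu> = {abs_cproj2 (X, Y, Z) | X Y Z. (X, Y, Z) \<noteq> 0 \<and>
     Y\<^sup>2 * Z + (\<mu> 1 * X + \<mu> 3 * Z) * Y * Z
       = X ^ 3 + \<mu> 2 * X\<^sup>2 * Z + \<mu> 4 * X * Z\<^sup>2 + \<mu> 6 * Z ^ 3}"

definition affine_pt :: "complex \<times> complex \<Rightarrow> cproj2" where
  "affine_pt p = abs_cproj2 (fst p, snd p, 1)"

text \<open>
  No affine point annihilates both partial derivatives of the equation. The remaining point
  \<open>(0 : 1 : 0)\<close> is always smooth.
\<close>

definition nonsingular_curve :: "(nat \<Rightarrow> complex) \<Rightarrow> bool" where
  "nonsingular_curve \<mu> \<longleftrightarrow>
     (\<forall>(x, y) \<in> affine_curve \<mu>.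
        \<not> (2 * y + \<mu> 1 * x + \<mu> 3 = 0 \<and> \<mu> 1 * y = 3 * x\<^sup>2 + 2 * \<mu> 2 * x + \<mu> 4))"

section \<open>Differential forms and periods\<close>

text \<open>
  \<open>omega1 \<mu> p v\<close> is the value of \<open>dx / (2y + \<mu>\<^sub>1x + \<mu>\<^sub>3)\<close> on the tangent vector \<open>v\<close> of the curve at \<open>p\<close>.
  Where the denominator vanishes we use the other expression of the same form, obtained from
  \<open>(2y + \<mu>\<^sub>1x + \<mu>\<^sub>3) dy = (3x\<^sup>2 + 2\<mu>\<^sub>2x + \<mu>\<^sub>4 - \<mu>\<^sub>1y) dx\<close> on the curve.
\<close>

definition omega1 :: "(nat \<Rightarrow> complex) \<Rightarrow> complex \<times> complex \<Rightarrow> complex \<times> complex \<Rightarrow> complex" where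
  "omega1 \<mu> p v = (case p of (x, y) \<Rightarrow> case v of (dx, dy) \<Rightarrow>
     if 2 * y + \<mu> 1 * x + \<mu> 3 \<noteq> 0 then dx / (2 * y + \<mu> 1 * x + \<mu> 3)
     else dy / (3 * x\<^sup>2 + 2 * \<mu> 2 * x + \<mu> 4 - \<mu> 1 * y))"

definition eta1 :: "(nat \<Rightarrow> complex) \<Rightarrow> complex \<times> complex \<Rightarrow> complex \<times> complex \<Rightarrow> complex" where
  "eta1 \<mu> p v = - fst p * omega1 \<mu> p v"

definition form_integral ::
  "(complex \<times> complex \<Rightarrow> complex \<times> complex \<Rightarrow> complex) \<Rightarrow> (real \<Rightarrow> complex \<times> complex) \<Rightarrow> complex" where
  "form_integral \<theta> \<gamma> = integral {0..1} (\<lambda>t. \<theta> (\<gamma> t) (vector_derivative \<gamma> (at t within {0..1})))"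

section \<open>Generators of the fundamental group and intersection numbers\<close>

inductive loop_word :: "(real \<Rightarrow> 'a::topological_space) \<Rightarrow> (real \<Rightarrow> 'a) \<Rightarrow> (real \<Rightarrow> 'a) \<Rightarrow> bool"
  for a b where
  "loop_word a b (\<lambda>_. pathstart a)"
| "loop_word a b g \<Longrightarrow> loop_word a b (g +++ a)"
| "loop_word a b g \<Longrightarrow> loop_word a b (g +++ reversepath a)"
| "loop_word a b g \<Longrightarrow> loop_word a b (g +++ b)"
| "loop_word a b g \<Longrightarrow> loop_word a b (g +++ reversepath b)"

definition loop_at :: "'a::topological_space set \<Rightarrow> 'a \<Rightarrow> (real \<Rightarrow> 'a) \<Rightarrow> bool" where
  "loop_at S p g \<longleftrightarrow> path g \<and> path_image g \<subseteq> S \<and> pathstart g = p \<and> pathfinish g = p"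

definition generate_fundamental_group ::
  "'a::topological_space set \<Rightarrow> (real \<Rightarrow> 'a) \<Rightarrow> (real \<Rightarrow> 'a) \<Rightarrow> bool" where
  "generate_fundamental_group S a b \<longleftrightarrow>
     loop_at S (pathstart a) a \<and> loop_at S (pathstart a) b \<and>
     (\<forall>g. loop_at S (pathstart a) g \<longrightarrow> (\<exists>w. loop_word a b w \<and> homotopic_paths S g w))"

definition C1_loop :: "(nat \<Rightarrow> complex) \<Rightarrow> (real \<Rightarrow> complex \<times> complex) \<Rightarrow> bool" where
  "C1_loop \<mu> a \<longleftrightarrow>
     a C1_differentiable_on UNIV \<and> (\<forall>t. a (t + 1) = a t) \<and> range a \<subseteq> affine_curve \<mu>"

definition crossings :: "(real \<Rightarrow> complex \<times> complex) \<Rightarrow> (real \<Rightarrow> complex \<times> complex) \<Rightarrow> (real \<times> real) set" where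
  "crossings a b = {(s, t). s \<in> {0..<1} \<and> t \<in> {0..<1} \<and> a s = b t}"

text \<open>
  The holomorphic form \<open>omega1\<close> has no zeros, so it identifies each tangent line of the curve with
  \<open>\<complex>\<close> compatibly with the complex orientation. For \<open>z, w\<close> in \<open>\<complex>\<close>, the pair \<open>(z, w)\<close> is an oriented
  real basis iff \<open>Im (cnj z * w) > 0\<close>.
\<close>

definition crossing_sign ::
  "(nat \<Rightarrow> complex) \<Rightarrow> (real \<Rightarrow> complex \<times> complex) \<Rightarrow> (real \<Rightarrow> complex \<times> complex) \<Rightarrow> real \<times> real \<Rightarrow> real" where
  "crossing_sign \<mu> a b st = (case st of (s, t) \<Rightarrow>
     sgn (Im (cnj (omega1 \<mu> (a s) (vector_derivative a (at s))) *
              omega1 \<mu> (b t) (vector_derivative b (at t)))))"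

definition transversal :: "(nat \<Rightarrow> complex) \<Rightarrow> (real \<Rightarrow> complex \<times> complex) \<Rightarrow> (real \<Rightarrow> complex \<times> complex) \<Rightarrow> bool" where
  "transversal \<mu> a b \<longleftrightarrow>
     finite (crossings a b) \<and> (\<forall>st \<in> crossings a b. crossing_sign \<mu> a b st \<noteq> 0)"

text \<open>
  The intersection number of two closed paths is the signed count of crossings of any transversal
  representatives of their free homotopy classes in the projective curve. It is given as a relation
  because the count does not depend on the representatives only by a theorem. The representatives
  may be taken in the affine part, since loops on a surface can be moved off a point.
\<close>

definition has_intersection_number ::
  "(nat \<Rightarrow> complex) \<Rightarrow> (real \<Rightarrow> complex \<times> complex) \<Rightarrow> (real \<Rightarrow> complex \<times> complex) \<Rightarrow> int \<Rightarrow> bool" where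
  "has_intersection_number \<mu> \<alpha> \<beta> k \<longleftrightarrow>
     (\<exists>a b. C1_loop \<mu> a \<and> C1_loop \<mu> b \<and>
        homotopic_loops (proj_curve \<mu>) (affine_pt \<circ> \<alpha>) (affine_pt \<circ> a) \<and>
        homotopic_loops (proj_curve \<mu>) (affine_pt \<circ> \<beta>) (affine_pt \<circ> b) \<and>
        transversal \<mu> a b \<and> (\<Sum>st \<in> crossings a b. crossing_sign \<mu> a b st) = of_int k)"

text \<open>
  The paths avoid the point at infinity, where \<open>eta1\<close> has a pole; they generate the fundamental
  group of the whole projective curve.
\<close>

definition symplectic_generators ::
  "(nat \<Rightarrow> complex) \<Rightarrow> (real \<Rightarrow> complex \<times> complex) \<Rightarrow> (real \<Rightarrow> complex \<times> complex) \<Rightarrow> bool" where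
  "symplectic_generators \<mu> \<alpha> \<beta> \<longleftrightarrow>
     valid_path \<alpha> \<and> path_image \<alpha> \<subseteq> affine_curve \<mu> \<and>
     valid_path \<beta> \<and> path_image \<beta> \<subseteq> affine_curve \<mu> \<and>
     pathfinish \<alpha> = pathstart \<alpha> \<and> pathstart \<beta> = pathstart \<alpha> \<and> pathfinish \<beta> = pathstart \<alpha> \<and>
     generate_fundamental_group (proj_curve \<mu>) (affine_pt \<circ> \<alpha>) (affine_pt \<circ> \<beta>) \<and>
     has_intersection_number \<mu> \<alpha> \<beta> 1"

section \<open>The sigma function\<close>

definition vartheta :: "complex \<Rightarrow> complex \<Rightarrow> complex" where
  "vartheta z \<tau> = (\<Sum>\<^sub>\<infinity>n::int. exp (of_real pi * \<i> * \<tau> * (of_int n + 1 / 2)\<^sup>2 +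
     2 * of_real pi * \<i> * (of_int n + 1 / 2) * (z + 1 / 2)))"

definition sigma ::
  "(nat \<Rightarrow> complex) \<Rightarrow> (real \<Rightarrow> complex \<times> complex) \<Rightarrow> (real \<Rightarrow> complex \<times> complex) \<Rightarrow> complex \<Rightarrow> complex" where
  "sigma \<mu> \<alpha> \<beta> =
    (let \<omega>' = form_integral (omega1 \<mu>) \<alpha>;
         \<omega>'' = form_integral (omega1 \<mu>) \<beta>;
         \<eta>' = form_integral (eta1 \<mu>) \<alpha>;
         g = (\<lambda>u. exp (1 / 2 * u\<^sup>2 * \<eta>' / \<omega>') * vartheta (u / \<omega>') (\<omega>'' / \<omega>'));
         c = (THE c. c \<noteq> 0 \<and> (\<lambda>u. c * g u - u) \<in> O[at 0](\<lambda>u. u\<^sup>2))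
     in (\<lambda>u. c * g u))"

section \<open>Universal expansions and Hurwitz integrality\<close>

text \<open>
  Polynomials over \<open>\<rat>\<close> in indeterminates indexed by \<open>nat\<close>: finitely supported functions from
  monomials (exponent vectors) to coefficients.
\<close>

type_synonym qpoly = "(nat \<Rightarrow>\<^sub>0 nat) \<Rightarrow>\<^sub>0 rat"

definition Mu :: "nat \<Rightarrow> qpoly" where
  "Mu i = Poly_Mapping.single (Poly_Mapping.single i 1) 1"

definition half_Mu1 :: qpoly where
  "half_Mu1 = Poly_Mapping.single (Poly_Mapping.single 1 1) (1 / 2)"

definition qpoly_eval :: "(nat \<Rightarrow> complex) \<Rightarrow> qpoly \<Rightarrow> complex" where
  "qpoly_eval \<mu> p = (\<Sum>m \<in> Poly_Mapping.keys p.
     of_rat (Poly_Mapping.lookup p m) * (\<Prod>i \<in> Poly_Mapping.keys m. \<mu> i ^ Poly_Mapping.lookup m i))"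

text \<open>The subring generated by \<open>S\<close>.\<close>

inductive_set int_adjoin :: "'a::comm_ring_1 set \<Rightarrow> 'a set" for S where
  "s \<in> S \<Longrightarrow> s \<in> int_adjoin S"
| "1 \<in> int_adjoin S"
| "p \<in> int_adjoin S \<Longrightarrow> - p \<in> int_adjoin S"
| "p \<in> int_adjoin S \<Longrightarrow> q \<in> int_adjoin S \<Longrightarrow> p + q \<in> int_adjoin S"
| "p \<in> int_adjoin S \<Longrightarrow> q \<in> int_adjoin S \<Longrightarrow> p * q \<in> int_adjoin S"

definition hurwitz_coeff :: "'a::comm_ring_1 fps \<Rightarrow> nat \<Rightarrow> 'a" where
  "hurwitz_coeff F j = of_nat (fact j) * fps_nth F j"

definition hurwitz_integral :: "'a::comm_ring_1 set \<Rightarrow> 'a fps set" where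
  "hurwitz_integral A = {F. \<forall>j. hurwitz_coeff F j \<in> A}"

text \<open>
  \<open>F\<close> is the power series at 0, over the polynomial ring, whose specialisation at the coefficients
  of any nonsingular curve is the expansion of \<open>f\<close> for that curve, for any choice of the paths. It
  is unique among series in the indeterminates \<open>Mu 1, Mu 2, Mu 3, Mu 4, Mu 6\<close>, since nonsingular
  curves are Zariski dense in the parameter space.
\<close>

definition is_universal_expansion ::
  "((nat \<Rightarrow> complex) \<Rightarrow> (real \<Rightarrow> complex \<times> complex) \<Rightarrow> (real \<Rightarrow> complex \<times> complex) \<Rightarrow> complex \<Rightarrow> complex)
     \<Rightarrow> qpoly fps \<Rightarrow> bool" where
  "is_universal_expansion f F \<longleftrightarrow>
     (\<forall>\<mu> \<alpha> \<beta>. nonsingular_curve \<mu> \<and> symplectic_generators \<mu> \<alpha> \<beta> \<longrightarrow>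
        f \<mu> \<alpha> \<beta> has_fps_expansion Abs_fps (\<lambda>j. qpoly_eval \<mu> (fps_nth F j)))"

end

theory Submission
  imports Defs "HOL-Complex_Analysis.Complex_Analysis"
begin

text \<open>
  In the coordinates \<open>t = -x/y\<close> and \<open>v = -1/(y t\<^sup>3)\<close> near the origin, translation along the invariant
  differential is a polynomial vector field, and \<open>\<sigma> = t e\<close> where the logarithmic derivative of \<open>e\<close>
  satisfies a polynomial equation too. The only coefficient outside \<open>\<int>[\<mu>]\<close> is \<open>\<mu>\<^sub>1/2\<close>, which drops out for
  \<open>\<sigma>\<^sup>2\<close>; a polynomial system \<open>F' = P(F)\<close> with coefficients in \<open>A\<close> has Hurwitz integral solutions over \<open>A\<close>.

  To identify this formal series with the theta expression, one first shows that it is entire, since it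
  satisfies a duplication formula, and that its zeros are exactly the quasi-periods, since near any point the
  equation \<open>(x')\<^sup>2 = 4 x\<^sup>3 + b\<^sub>2 x\<^sup>2 + 2 b\<^sub>4 x + b\<^sub>6\<close> for \<open>x = - (log \<sigma>)''\<close> determines \<open>\<sigma>\<close> up to a factor
  \<open>c exp (a u)\<close>. So \<open>x\<close> and \<open>y\<close> define a covering \<open>\<complex> \<rightarrow> E\<close>, along which loops lift; integrating the forms
  over a loop gives a quasi-period. Counting the jumps of the winding integral of \<open>\<sigma>'/\<sigma>\<close> along lifted loops
  gives the Legendre relation in terms of the intersection number. Finally the relation determines the
  Fourier series of \<open>exp (- \<eta>' \<omega>' z\<^sup>2 / 2) \<sigma>(\<omega>' z)\<close> up to a constant, because this function is odd.
\<close>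

text \<open>The definition of \<open>sigma\<close> shows nothing arithmetic, since periods of
  arbitrary loops enter; integrality has to come from a series that is built without the loops, and
  all the analysis serves to identify the two. The lattice appears as the zero set of the series,
  and its properties come from uniqueness of solutions of
  \<open>x'' = 6 x\<^sup>2 + b2 x + b4\<close> instead of lattice sums. Poles are avoided throughout
  by clearing denominators: x and x' are represented by \<open>X = x \<sigma>\<^sup>2\<close> and
  \<open>W = x' \<sigma>\<^sup>3\<close>, and \<open>- (log F)''\<close> by the bilinear expression
  \<open>hirota F\<close>. Thus the same identities serve for formal series and for entire
  functions. Since the coefficients are universal polynomials, the system is solved over a
  commutative ring in which the positive integers are invertible and is specialised to complex
  numbers afterwards. The topology is reached through lifts A and B of two smooth loops: their
  crossings are the zeros of \<open>\<sigma> (B t - A s)\<close> in the unit square, and each one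
  contributes a jump of 2 pi i, up to sign, to an integral over t as s varies.\<close>

unbundle no vec_syntax

section \<open>Differential systems of power series\<close>

text \<open>Causality makes a system \<open>F' = \<Psi> F\<close> solvable degree by degree: degree
  n of the right-hand side fixes degree n + 1 of the unknowns. It is checked structurally for
  polynomial right-hand sides.\<close>

definition causal :: "(('i \<Rightarrow> 'a::comm_ring_1 fps) \<Rightarrow> 'a fps) \<Rightarrow> bool" where
  "causal \<Psi> \<longleftrightarrow> (\<forall>n f g. (\<forall>j. \<forall>k\<le>n. f j $ k = g j $ k) \<longrightarrow> \<Psi> f $ n = \<Psi> g $ n)"

lemma causalD: "causal \<Psi> \<Longrightarrow> (\<And>j k. k \<le> n \<Longrightarrow> f j $ k = g j $ k) \<Longrightarrow> \<Psi> f $ n = \<Psi> g $ n"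
  unfolding causal_def by blast

lemma causal_const: "causal (\<lambda>f. c)"
  and causal_proj: "causal (\<lambda>f. f i)"
  unfolding causal_def by auto

lemma causal_add:
  assumes "causal \<Phi>" "causal \<Psi>"
  shows "causal (\<lambda>f. \<Phi> f + \<Psi> f)"
  unfolding causal_def fps_add_nth
  by (intro allI impI arg_cong2[where f = "(+)"] causalD[OF assms(1)] causalD[OF assms(2)]) auto

lemma causal_uminus: "causal \<Phi> \<Longrightarrow> causal (\<lambda>f. - \<Phi> f)"
  unfolding causal_def fps_neg_nth neg_equal_iff_equal .

lemma causal_diff: "causal \<Phi> \<Longrightarrow> causal \<Psi> \<Longrightarrow> causal (\<lambda>f. \<Phi> f - \<Psi> f)"
  using causal_add[OF _ causal_uminus] by fastforce

lemma causal_mult: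
  fixes \<Phi> \<Psi> :: "('i \<Rightarrow> 'a::comm_ring_1 fps) \<Rightarrow> 'a fps"
  assumes "causal \<Phi>" "causal \<Psi>"
  shows "causal (\<lambda>f. \<Phi> f * \<Psi> f)"
  unfolding causal_def fps_mult_nth
proof (intro allI impI sum.cong refl)
  fix n i and f g :: "'i \<Rightarrow> 'a fps"
  assume *: "\<forall>j. \<forall>k\<le>n. f j $ k = g j $ k" and i: "i \<in> {0..n}"
  have "\<Phi> f $ i = \<Phi> g $ i"
    by (rule causalD[OF assms(1)]) (use * i in auto)
  moreover have "\<Psi> f $ (n - i) = \<Psi> g $ (n - i)"
    by (rule causalD[OF assms(2)]) (use * i in auto)
  ultimately show "\<Phi> f $ i * \<Psi> f $ (n - i) = \<Phi> g $ i * \<Psi> g $ (n - i)"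
    by simp
qed

lemma causal_power: "causal \<Phi> \<Longrightarrow> causal (\<lambda>f. \<Phi> f ^ k)"
  by (induction k) (auto intro: causal_mult causal_const)

lemmas causal_intros = causal_const causal_proj causal_add causal_diff causal_uminus
  causal_mult causal_power

text \<open>Picard iteration: the k-th iterate is already stable up to degree k, so the solution is
  the diagonal. The inverses of the integers n + 1 are passed as a function \<open>r\<close> because
  the lemma is applied to a polynomial ring, which is not a field.\<close>

lemma fps_ode_exists:
  fixes \<Phi> :: "'i \<Rightarrow> ('i \<Rightarrow> 'a::comm_ring_1 fps) \<Rightarrow> 'a fps"
  assumes inv: "\<And>n. of_nat (Suc n) * r n = (1::'a)" and causal: "\<And>i. causal (\<Phi> i)"
  obtains f where "\<And>i. fps_deriv (f i) = \<Phi> i f" "\<And>i. f i $ 0 = a i"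
proof -
  define it :: "nat \<Rightarrow> 'i \<Rightarrow> 'a fps" where
    "it = rec_nat (\<lambda>i. fps_const (a i))
       (\<lambda>k g i. Abs_fps (\<lambda>n. case n of 0 \<Rightarrow> a i | Suc m \<Rightarrow> r m * \<Phi> i g $ m))"
  have it0: "it k i $ 0 = a i" for k i
    by (cases k) (auto simp: it_def)
  have itSuc: "it (Suc k) i $ Suc m = r m * \<Phi> i (it k) $ m" for k i m
    by (simp add: it_def)
  have step: "n \<le> k \<Longrightarrow> it (Suc k) i $ n = it k i $ n" for n k i
  proof (induction k arbitrary: n i)
    case 0
    then show ?case by (simp add: it0)
  next
    case (Suc k)
    show ?case
    proof (cases n)
      case (Suc m)
      have "\<Phi> i (it (Suc k)) $ m = \<Phi> i (it k) $ m"
        by (rule causalD[OF causal]) (use Suc Suc.prems Suc.IH in auto)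
      then show ?thesis by (simp add: Suc itSuc)
    qed (simp add: it0)
  qed
  have stab: "it (n + d) i $ n = it n i $ n" for n d i
    by (induction d) (auto simp: step)
  define f where "f i = Abs_fps (\<lambda>n. it n i $ n)" for i
  have "of_nat (Suc m) * f i $ Suc m = \<Phi> i f $ m" for i m
  proof -
    have "\<Phi> i (it m) $ m = \<Phi> i f $ m"
    proof (rule causalD[OF causal])
      fix j k assume "k \<le> m"
      then show "it m j $ k = f j $ k"
        using stab[of k "m - k" j] by (simp add: f_def)
    qed
    moreover have "f i $ Suc m = r m * \<Phi> i (it m) $ m"
      by (simp add: f_def itSuc)
    ultimately show ?thesis
      by (metis inv mult.assoc mult_1)
  qed
  then have "fps_deriv (f i) = \<Phi> i f" for i
    by (intro fps_ext) (simp add: mult.commute)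
  moreover have "f i $ 0 = a i" for i
    by (simp add: f_def it0)
  ultimately show ?thesis using that by blast
qed

text \<open>Degree m of the right-hand side fixes coefficient m + 2, since (m + 2)(m + 1) can be
  cancelled. The index type \<open>unit\<close> fits a single unknown into the format of
  \<open>causal\<close>.\<close>

lemma fps_ode2_unique:
  fixes F G :: "'a::{idom,ring_char_0} fps"
  assumes causal: "causal \<Psi>"
    and F: "fps_deriv (fps_deriv F) = \<Psi> (\<lambda>_::unit. F)"
    and G: "fps_deriv (fps_deriv G) = \<Psi> (\<lambda>_. G)"
    and init: "F $ 0 = G $ 0" "F $ 1 = G $ 1"
  shows "F = G"
proof (rule fps_ext)
  fix n show "F $ n = G $ n"
  proof (induction n rule: less_induct)
    case (less n)
    show ?case
    proof (cases "n < 2")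
      case True
      then have "n = 0 \<or> n = 1" by auto
      then show ?thesis using init by auto
    next
      case False
      then obtain m where n: "n = Suc (Suc m)"
        by (metis add_2_eq_Suc le_Suc_ex not_less)
      have "\<Psi> (\<lambda>_. F) $ m = \<Psi> (\<lambda>_. G) $ m"
        by (rule causalD[OF causal]) (use less n in auto)
      then have "fps_deriv (fps_deriv F) $ m = fps_deriv (fps_deriv G) $ m"
        using F G by simp
      then have "of_nat (Suc (Suc m) * Suc m) * F $ n = of_nat (Suc (Suc m) * Suc m) * G $ n"
        unfolding fps_deriv_nth n of_nat_mult by (simp add: algebra_simps)
      then show ?thesis
        by (metis mult_cancel_left nat.distinct(1) of_nat_eq_0_iff mult_is_0)
    qed
  qed
qed

text \<open>Convergence is obtained from the majorant \<open>\<Sum> K\<^sup>n u\<^sup>n / (n + 1)\<^sup>2\<close>, which is stable under products.\<close>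

definition majorized :: "real \<Rightarrow> nat \<Rightarrow> real \<Rightarrow> complex fps \<Rightarrow> bool" where
  "majorized K N c F \<longleftrightarrow> (\<forall>n\<le>N. norm (F $ n) \<le> c * K ^ n / (real n + 1)\<^sup>2)"

lemma sum_inverse_squares_le: "(\<Sum>i\<le>n. 1 / (real i + 1)\<^sup>2) \<le> 2 - 1 / (real n + 1)"
proof (induction n)
  case (Suc n)
  have "1 / (real (Suc n) + 1)\<^sup>2 \<le> 1 / (real n + 1) - 1 / (real (Suc n) + 1)"
    by (simp add: divide_simps power2_eq_square)
  then show ?case using Suc by simp
qed simp

text \<open>For a = i + 1 and b = n - i + 1 one has \<open>(n + 1)\<^sup>2 \<le> (a + b)\<^sup>2
  \<le> 2 (a\<^sup>2 + b\<^sup>2)\<close>, which turns the product of inverse squares into a sum.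
  The 8 is 2 from this estimate, 2 for the two symmetric sums, and 2 as bound for the sum of inverse
  squares.\<close>

lemma convolution_inverse_squares_le:
  "(\<Sum>i\<le>n. 1 / (real i + 1)\<^sup>2 * (1 / (real (n - i) + 1)\<^sup>2)) \<le> 8 / (real n + 1)\<^sup>2"
proof -
  have summand: "1 / (real i + 1)\<^sup>2 * (1 / (real (n - i) + 1)\<^sup>2)
      \<le> 2 / (real n + 1)\<^sup>2 * (1 / (real i + 1)\<^sup>2 + 1 / (real (n - i) + 1)\<^sup>2)" if "i \<le> n" for i
  proof -
    define a b where "a = real i + 1" and "b = real (n - i) + 1"
    have ab: "a > 0" "b > 0" "a + b = real n + 2"
      using that by (auto simp: a_def b_def)
    have "(real n + 1)\<^sup>2 \<le> (a + b)\<^sup>2"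
      using ab by (intro power_mono) auto
    also have "\<dots> \<le> 2 * (a\<^sup>2 + b\<^sup>2)"
      using sum_squares_ge_zero[of "a - b" 0] by (simp add: power2_eq_square algebra_simps)
    finally have "(real n + 1)\<^sup>2 / (a\<^sup>2 * b\<^sup>2) \<le> 2 * (a\<^sup>2 + b\<^sup>2) / (a\<^sup>2 * b\<^sup>2)"
      using ab by (intro divide_right_mono) auto
    also have "\<dots> = 2 * (1 / a\<^sup>2 + 1 / b\<^sup>2)"
      using ab by (simp add: divide_simps)
    finally have "(real n + 1)\<^sup>2 * (1 / a\<^sup>2 * (1 / b\<^sup>2)) \<le> 2 * (1 / a\<^sup>2 + 1 / b\<^sup>2)"
      by simp
    then have "1 / a\<^sup>2 * (1 / b\<^sup>2) \<le> 2 * (1 / a\<^sup>2 + 1 / b\<^sup>2) / (real n + 1)\<^sup>2"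
      by (subst pos_le_divide_eq) (auto simp: mult.commute)
    then show ?thesis by (simp add: a_def b_def)
  qed
  have refl: "(\<Sum>i\<le>n. 1 / (real (n - i) + 1)\<^sup>2) = (\<Sum>i\<le>n. 1 / (real i + 1)\<^sup>2)"
    using sum.nat_diff_reindex[of "\<lambda>i. 1 / (real i + 1)\<^sup>2" "Suc n"] by (simp add: lessThan_Suc_atMost)
  have "(\<Sum>i\<le>n. 1 / (real i + 1)\<^sup>2 * (1 / (real (n - i) + 1)\<^sup>2))
      \<le> (\<Sum>i\<le>n. 2 / (real n + 1)\<^sup>2 * (1 / (real i + 1)\<^sup>2 + 1 / (real (n - i) + 1)\<^sup>2))"
    by (intro sum_mono summand) auto
  also have "\<dots> = 2 / (real n + 1)\<^sup>2 * (2 * (\<Sum>i\<le>n. 1 / (real i + 1)\<^sup>2))"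
    by (simp only: sum_distrib_left[symmetric] sum.distrib refl mult_2)
  also have "\<dots> \<le> 2 / (real n + 1)\<^sup>2 * (2 * 2)"
    using sum_inverse_squares_le[of n]
    by (intro mult_left_mono) (auto intro: order_trans)
  finally show ?thesis by simp
qed

lemma majorized_mult:
  assumes F: "majorized K N c F" and G: "majorized K N d G" and K: "K \<ge> 0"
  shows "majorized K N (8 * c * d) (F * G)"
  unfolding majorized_def
proof (intro allI impI)
  fix n assume n: "n \<le> N"
  have "norm (F $ 0) \<le> c" "norm (G $ 0) \<le> d"
    using F G unfolding majorized_def by (auto dest: spec[of _ 0])
  then have pos: "c \<ge> 0" "d \<ge> 0"
    by (auto intro: order_trans[OF norm_ge_zero])
  have "norm ((F * G) $ n) \<le> (\<Sum>i\<le>n. norm (F $ i) * norm (G $ (n - i)))"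
    unfolding fps_mult_nth atLeast0AtMost by (rule sum_norm_le) (simp add: norm_mult)
  also have "\<dots> \<le> (\<Sum>i\<le>n. (c * K ^ i / (real i + 1)\<^sup>2) * (d * K ^ (n - i) / (real (n - i) + 1)\<^sup>2))"
    using F G n K pos unfolding majorized_def
    by (intro sum_mono mult_mono) (auto simp del: of_nat_diff)
  also have "\<dots> = (\<Sum>i\<le>n. (c * d * K ^ n) * (1 / (real i + 1)\<^sup>2 * (1 / (real (n - i) + 1)\<^sup>2)))"
    by (intro sum.cong refl) (simp add: power_add[symmetric])
  also have "\<dots> \<le> (c * d * K ^ n) * (8 / (real n + 1)\<^sup>2)"
    unfolding sum_distrib_left[symmetric] using pos K
    by (intro mult_left_mono convolution_inverse_squares_le) auto
  finally show "norm ((F * G) $ n) \<le> 8 * c * d * K ^ n / (real n + 1)\<^sup>2"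
    by (simp add: field_simps)
qed

text \<open>The order of quantifiers matters: the bound M for F is uniform in the growth rate K and
  the truncation degree N, so K may be chosen after M.\<close>

definition tame :: "real \<Rightarrow> 'i set \<Rightarrow> ('i \<Rightarrow> complex fps) \<Rightarrow> complex fps \<Rightarrow> bool" where
  "tame c I f F \<longleftrightarrow> (\<exists>M>0. \<forall>K\<ge>1. \<forall>N. (\<forall>i\<in>I. majorized K N c (f i)) \<longrightarrow> majorized K N M F)"

lemma tame_const: "tame c I f (fps_const a)"
proof -
  have "norm (fps_const a $ n) \<le> (norm a + 1) * K ^ n / (real n + 1)\<^sup>2" if "K \<ge> 1" for n K
    using that by (cases n) (auto intro!: add_nonneg_pos divide_nonneg_nonneg mult_nonneg_nonneg)
  then show ?thesis
    unfolding tame_def majorized_def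
    by (intro exI[of _ "norm a + 1"]) (auto simp: add_nonneg_pos)
qed

lemma tame_proj: "i \<in> I \<Longrightarrow> tame c I f (f i)"
  unfolding tame_def
proof (intro exI[of _ "\<bar>c\<bar> + 1"] conjI allI impI)
  fix K N assume "i \<in> I" "\<forall>i\<in>I. majorized K N c (f i)" "(1::real) \<le> K"
  then have "majorized K N c (f i)" by blast
  moreover have "c * K ^ n / (real n + 1)\<^sup>2 \<le> (\<bar>c\<bar> + 1) * K ^ n / (real n + 1)\<^sup>2" for n
    using \<open>1 \<le> K\<close> by (intro divide_right_mono mult_right_mono) auto
  ultimately show "majorized K N (\<bar>c\<bar> + 1) (f i)"
    unfolding majorized_def using order_trans by blast
qed auto

lemma tame_add:
  assumes "tame c I f F" "tame c I f G"
  shows "tame c I f (F + G)"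
proof -
  from assms obtain M M' where M: "M > 0" "M' > 0"
    "\<And>K N. K \<ge> 1 \<Longrightarrow> (\<forall>i\<in>I. majorized K N c (f i)) \<Longrightarrow> majorized K N M F"
    "\<And>K N. K \<ge> 1 \<Longrightarrow> (\<forall>i\<in>I. majorized K N c (f i)) \<Longrightarrow> majorized K N M' G"
    unfolding tame_def by metis
  have "majorized K N (M + M') (F + G)" if "K \<ge> 1" "\<forall>i\<in>I. majorized K N c (f i)" for K N
    using M(3,4)[OF that] norm_triangle_ineq unfolding majorized_def
    by (force simp: distrib_right add_divide_distrib intro: order_trans[OF norm_triangle_ineq] add_mono)
  then show ?thesis unfolding tame_def using M(1,2) by (intro exI[of _ "M + M'"]) auto
qed

lemma tame_mult:
  assumes "tame c I f F" "tame c I f G"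
  shows "tame c I f (F * G)"
proof -
  from assms obtain M M' where M: "M > 0" "M' > 0"
    "\<And>K N. K \<ge> 1 \<Longrightarrow> (\<forall>i\<in>I. majorized K N c (f i)) \<Longrightarrow> majorized K N M F"
    "\<And>K N. K \<ge> 1 \<Longrightarrow> (\<forall>i\<in>I. majorized K N c (f i)) \<Longrightarrow> majorized K N M' G"
    unfolding tame_def by metis
  have "majorized K N (8 * M * M') (F * G)" if "K \<ge> 1" "\<forall>i\<in>I. majorized K N c (f i)" for K N
    using M(3,4)[OF that] that(1) by (intro majorized_mult) auto
  then show ?thesis unfolding tame_def using M(1,2) by (intro exI[of _ "8 * M * M'"]) auto
qed

lemma tame_uminus: "tame c I f F \<Longrightarrow> tame c I f (- F)"
  unfolding tame_def majorized_def by simp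

lemma tame_diff: "tame c I f F \<Longrightarrow> tame c I f G \<Longrightarrow> tame c I f (F - G)"
  using tame_add[OF _ tame_uminus] by fastforce

lemma tame_power: "tame c I f F \<Longrightarrow> tame c I f (F ^ k)"
  using tame_const[of c I f 1] by (induction k) (auto intro: tame_mult)

lemma tame_1: "tame c I f 1"
  using tame_const[of c I f 1] by simp

lemma tame_numeral: "tame c I f (numeral k)"
  using tame_const[of c I f "numeral k"] by (simp add: numeral_fps_const)

lemmas tame_intros = tame_const tame_add tame_diff tame_uminus tame_mult tame_power
  tame_1 tame_numeral

text \<open>The majorant is propagated one degree at a time: a bound for all unknowns up to N bounds
  their derivatives with the constants \<open>M i\<close>, and integration returns the original
  bound in degree N + 1 once K is large compared with \<open>M i / c\<close>.\<close>

lemma fps_ode_converges: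
  assumes fin: "finite I" and init: "\<And>i. i \<in> I \<Longrightarrow> norm (f i $ 0) \<le> c"
    and c: "c > 0" and tame: "\<And>i. i \<in> I \<Longrightarrow> tame c I f (fps_deriv (f i))" and i: "i \<in> I"
  shows "fps_conv_radius (f i) > 0"
proof -
  from tame have "\<exists>M. \<forall>i\<in>I. M i > 0 \<and>
      (\<forall>K\<ge>1. \<forall>N. (\<forall>i\<in>I. majorized K N c (f i)) \<longrightarrow> majorized K N (M i) (fps_deriv (f i)))"
    unfolding tame_def by (intro bchoice) blast
  then obtain M where M: "\<And>i. i \<in> I \<Longrightarrow> M i > 0" "\<And>i K N. i \<in> I \<Longrightarrow> K \<ge> 1 \<Longrightarrow>
      (\<forall>i\<in>I. majorized K N c (f i)) \<Longrightarrow> majorized K N (M i) (fps_deriv (f i))"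
    by blast
  \<comment> \<open>The 4 pays for replacing \<open>(N + 1)\<^sup>2\<close> by
    \<open>(N + 2)\<^sup>2\<close> in the denominator of the majorant; the sum dominates every
    single \<open>M i\<close>.\<close>
  define K where "K = max 1 (4 * (\<Sum>i\<in>I. M i) / c)"
  have K: "K \<ge> 1" "4 * M i \<le> c * K" if "i \<in> I" for i
  proof -
    have "M i \<le> (\<Sum>i\<in>I. M i)"
      using M(1) fin that by (intro member_le_sum) (auto intro: less_imp_le)
    then show "4 * M i \<le> c * K"
      using c by (auto simp: K_def max_def field_simps)
  qed (simp add: K_def)
  have "\<forall>i\<in>I. majorized K N c (f i)" for N
  proof (induction N)
    case 0
    then show ?case using init by (simp add: majorized_def)
  next
    case (Suc N)
    show ?case
    proof
      fix i assume i: "i \<in> I"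
      have "norm (fps_deriv (f i) $ N) \<le> M i * K ^ N / (real N + 1)\<^sup>2"
        using M(2)[OF i K(1)[OF i] Suc] unfolding majorized_def by blast
      moreover have "norm (fps_deriv (f i) $ N) = (real N + 1) * norm (f i $ Suc N)"
        unfolding fps_deriv_nth norm_mult Suc_eq_plus1[symmetric] norm_of_nat by simp
      ultimately have "norm (f i $ Suc N) * (real N + 1) \<le> M i * K ^ N / (real N + 1)\<^sup>2"
        by (simp only: mult.commute)
      then have "norm (f i $ Suc N) \<le> M i * K ^ N / (real N + 1)\<^sup>2 / (real N + 1)"
        by (subst pos_le_divide_eq) auto
      also have "\<dots> \<le> M i * K ^ N / (real N + 1)\<^sup>2 / 1"
        using M(1)[OF i] K(1)[OF i] by (intro divide_left_mono) auto
      also have "\<dots> \<le> M i * K ^ N * (4 / (real (Suc N) + 1)\<^sup>2)"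
      proof -
        have "(real (Suc N) + 1)\<^sup>2 \<le> (2 * (real N + 1))\<^sup>2"
          by (intro power_mono) auto
        then have "1 / (real N + 1)\<^sup>2 \<le> 4 / (real (Suc N) + 1)\<^sup>2"
          unfolding power_mult_distrib by (simp add: divide_simps)
        then have "M i * K ^ N * (1 / (real N + 1)\<^sup>2) \<le> M i * K ^ N * (4 / (real (Suc N) + 1)\<^sup>2)"
          using M(1)[OF i] K(1)[OF i] by (intro mult_left_mono) auto
        then show ?thesis by simp
      qed
      also have "\<dots> = 4 * M i * K ^ N / (real (Suc N) + 1)\<^sup>2" by simp
      also have "\<dots> \<le> c * K * K ^ N / (real (Suc N) + 1)\<^sup>2"
        using K[OF i] by (intro divide_right_mono mult_right_mono) auto
      finally have "norm (f i $ Suc N) \<le> c * K ^ Suc N / (real (Suc N) + 1)\<^sup>2"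
        by (simp add: mult.assoc)
      then show "majorized K (Suc N) c (f i)"
        using Suc i unfolding majorized_def le_Suc_eq by blast
    qed
  qed
  then have bound: "norm (f i $ n) \<le> c * K ^ n / (real n + 1)\<^sup>2" for n
    using i unfolding majorized_def by blast
  have bound': "norm (f i $ n) \<le> c * K ^ n" for n
  proof -
    have "c * K ^ n / (real n + 1)\<^sup>2 \<le> c * K ^ n / 1"
      using c K(1)[OF i] by (intro divide_left_mono) auto
    then show ?thesis using bound[of n] by simp
  qed
  have "summable (\<lambda>n. f i $ n * of_real (1 / (2 * K)) ^ n)"
  proof (rule summable_comparison_test)
    show "\<exists>N. \<forall>n\<ge>N. norm (f i $ n * of_real (1 / (2 * K)) ^ n) \<le> c * (1 / 2) ^ n"
    proof (intro exI allI impI)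
      fix n :: nat
      have "norm (f i $ n * of_real (1 / (2 * K)) ^ n) = norm (f i $ n) * (1 / (2 * K)) ^ n"
        using K(1)[OF i] by (simp add: norm_mult norm_power norm_divide)
      also have "\<dots> \<le> c * K ^ n * (1 / (2 * K)) ^ n"
        using bound' K(1)[OF i] by (intro mult_right_mono) auto
      also have "\<dots> = c * (1 / 2) ^ n"
        using K(1)[OF i] by (simp add: power_mult_distrib power_divide)
      finally show "norm (f i $ n * of_real (1 / (2 * K)) ^ n) \<le> c * (1 / 2) ^ n" .
    qed
  qed (auto intro: summable_mult summable_geometric)
  then have "ereal (norm (of_real (1 / (2 * K)) :: complex)) \<le> fps_conv_radius (f i)"
    unfolding fps_conv_radius_def by (rule conv_radius_geI)
  moreover have "0 < ereal (norm (of_real (1 / (2 * K)) :: complex))"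
    using K(1)[OF i] by simp
  ultimately show ?thesis by (rule less_le_trans[rotated])
qed

section \<open>The formal sigma series\<close>

text \<open>
  With \<open>t = -x/y\<close> and \<open>v = -1/(y t\<^sup>3)\<close>, i.e. \<open>x = 1/(t\<^sup>2 v)\<close>, translation along \<open>u\<close> becomes a polynomial
  vector field without denominators, and \<open>\<sigma> = t e\<close> where \<open>e'/e\<close> has no pole at the origin.
\<close>

lemma fps_deriv_power': "fps_deriv (F ^ n) = of_nat n * fps_deriv F * F ^ (n - 1)"
  for F :: "'a::comm_ring_1 fps"
  by (simp add: fps_deriv_power fps_of_nat)

text \<open>Differentiating t = -x/y along dx/du = 2 y + m 1 x + m 3 and eliminating 1/v by the
  curve equation gives t' = 1 - t A with this A. In the same way \<open>flow_v\<close> is v',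
  computed from \<open>x = 1/(t\<^sup>2 v)\<close>.\<close>

definition flow_A :: "(nat \<Rightarrow> 'a::comm_ring_1) \<Rightarrow> 'a fps \<Rightarrow> 'a fps \<Rightarrow> 'a fps" where
  "flow_A m t v = fps_const (m 1) + fps_const (m 2) * t + 2 * fps_const (m 3) * t\<^sup>2 * v
     + 2 * fps_const (m 4) * t ^ 3 * v + 3 * fps_const (m 6) * t ^ 5 * v\<^sup>2"

definition flow_v :: "(nat \<Rightarrow> 'a::comm_ring_1) \<Rightarrow> 'a fps \<Rightarrow> 'a fps \<Rightarrow> 'a fps" where
  "flow_v m t v = fps_const (m 1) * v + 2 * fps_const (m 2) * t * v + 3 * fps_const (m 3) * t\<^sup>2 * v\<^sup>2
     + 4 * fps_const (m 4) * t ^ 3 * v\<^sup>2 + 6 * fps_const (m 6) * t ^ 5 * v ^ 3"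

definition flow_k :: "(nat \<Rightarrow> 'a::comm_ring_1) \<Rightarrow> 'a fps \<Rightarrow> 'a fps \<Rightarrow> 'a fps" where
  "flow_k m t v = - (t * v * (fps_const (m 3) + fps_const (m 4) * t + 2 * fps_const (m 6) * t ^ 3 * v))"

text \<open>Here k stands for \<sigma>'/\<sigma> - 1/t + h. Its derivative -x - (1/t)' has no
  denominator, and it is the polynomial \<open>flow_k\<close>; consequently e'/e =
  \<sigma>'/\<sigma> - t'/t = A - h + k. The value h = m 1 / 2 is the one that makes \<sigma>
  odd.\<close>

locale sigma_flow =
  fixes m :: "nat \<Rightarrow> 'a::comm_ring_1" and h :: 'a and t v k e :: "'a fps"
  assumes h: "2 * h = m 1"
    and t': "fps_deriv t = 1 - t * flow_A m t v" and t0: "t $ 0 = 0"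
    and v': "fps_deriv v = flow_v m t v" and v0: "v $ 0 = 1"
    and k': "fps_deriv k = flow_k m t v" and k0: "k $ 0 = 0"
    and e': "fps_deriv e = (flow_A m t v - fps_const h + k) * e" and e0: "e $ 0 = 1"

definition sigma_fps :: "'a::comm_ring_1 fps \<Rightarrow> 'a fps \<Rightarrow> 'a fps" where
  "sigma_fps t e = t * e"

lemma sigma_flow_exists:
  fixes m :: "nat \<Rightarrow> 'a::comm_ring_1"
  assumes h: "2 * h = m 1" and inv: "\<And>n. of_nat (Suc n) * r n = (1::'a)"
  obtains t v k e where "sigma_flow m h t v k e"
proof -
  \<comment> \<open>The unknowns 0, 1, 2, 3 are t, v, k, e; their initial values 0, 1, 0, 1 are
    written \<open>of_bool (odd i)\<close> below.\<close>
  define \<Phi> :: "nat \<Rightarrow> (nat \<Rightarrow> 'a fps) \<Rightarrow> 'a fps" where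
    "\<Phi> i = (if i = 0 then (\<lambda>f. 1 - f 0 * flow_A m (f 0) (f 1))
           else if i = 1 then (\<lambda>f. flow_v m (f 0) (f 1))
           else if i = 2 then (\<lambda>f. flow_k m (f 0) (f 1))
           else (\<lambda>f. (flow_A m (f 0) (f 1) - fps_const h + f 2) * f 3))" for i
  have "causal (\<Phi> i)" for i
    unfolding \<Phi>_def flow_A_def flow_v_def flow_k_def by (auto intro!: causal_intros)
  then obtain f where f: "\<And>i. fps_deriv (f i) = \<Phi> i f" "\<And>i. f i $ 0 = of_bool (odd i)"
    using fps_ode_exists[OF inv, of \<Phi> "\<lambda>i. of_bool (odd i)"] by blast
  have "sigma_flow m h (f 0) (f 1) (f 2) (f 3)"
    by unfold_locales (simp_all add: f h, simp_all add: \<Phi>_def)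
  then show ?thesis by (rule that)
qed

context sigma_flow
begin

abbreviation "S \<equiv> sigma_fps t e"
abbreviation "A \<equiv> flow_A m t v"

text \<open>The Weierstrass equation with \<open>x = 1/(t\<^sup>2 v)\<close> and
  \<open>y = - 1/(t\<^sup>3 v)\<close>, multiplied by \<open>t\<^sup>6 v\<^sup>2\<close> and solved
  for 1/v.\<close>

definition recip_v :: "'a fps" where
  "recip_v = 1 - fps_const (m 1) * t - fps_const (m 2) * t\<^sup>2 - fps_const (m 3) * t ^ 3 * v
     - fps_const (m 4) * t ^ 4 * v - fps_const (m 6) * t ^ 6 * v\<^sup>2"

text \<open>\<open>p = 1/x\<close> and \<open>X = x \<sigma>\<^sup>2\<close>.\<close>

definition "p = t\<^sup>2 * v"
definition "X = e\<^sup>2 * recip_v"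

definition "b2 = (m 1)\<^sup>2 + 4 * m 2"
definition "b4 = 2 * m 4 + m 1 * m 3"
definition "b6 = (m 3)\<^sup>2 + 4 * m 6"

definition "c1 = fps_const (m 1)"
definition "c2 = fps_const (m 2)"
definition "c3 = fps_const (m 3)"
definition "c4 = fps_const (m 4)"
definition "c6 = fps_const (m 6)"

lemmas fold_c = c1_def[symmetric] c2_def[symmetric] c3_def[symmetric] c4_def[symmetric] c6_def[symmetric]

lemma deriv_c [simp]: "fps_deriv c1 = 0" "fps_deriv c2 = 0" "fps_deriv c3 = 0" "fps_deriv c4 = 0" "fps_deriv c6 = 0"
  by (simp_all add: c1_def c2_def c3_def c4_def c6_def)

lemma c1_eq: "c1 = 2 * fps_const h"
  unfolding c1_def h[symmetric] by (metis fps_const_mult numeral_fps_const)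

lemmas flows = flow_A_def[of m, unfolded fold_c] flow_v_def[of m, unfolded fold_c]
  flow_k_def[of m, unfolded fold_c]

lemma m1: "m (Suc 0) = 2 * h"
  using h by simp

lemma deriv_S: "fps_deriv S = (1 - fps_const h * t + t * k) * e"
  unfolding sigma_fps_def fps_deriv_mult t' e' by (simp add: algebra_simps)

lemma S_nth: "S $ 0 = 0" "S $ 1 = 1"
proof -
  have "fps_deriv S $ 0 = 1" unfolding deriv_S by (simp add: t0 k0 e0)
  then show "S $ 1 = 1" by simp
qed (simp add: sigma_fps_def t0)

end

lemma fps_deriv_eq_0_const:
  fixes F :: "'a::{idom,ring_char_0} fps"
  assumes "fps_deriv F = 0" shows "F = fps_const (F $ 0)"
  using assms by (simp add: fps_deriv_eq_0_iff)

locale sigma_flow_idom = sigma_flow m h t v k e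
  for m :: "nat \<Rightarrow> 'a::{idom,ring_char_0}" and h t v k e
begin

lemma recip_v_eq: "recip_v = 1 - c1 * t - c2 * t\<^sup>2 - c3 * t ^ 3 * v - c4 * t ^ 4 * v - c6 * t ^ 6 * v\<^sup>2"
  unfolding recip_v_def fold_c ..

text \<open>This is the curve equation in the coordinates t and v. It is a first integral of the
  flow: the derivative of the product vanishes identically, and the initial values lie on the
  curve.\<close>

lemma v_recip_v: "v * recip_v = 1"
proof -
  have "fps_deriv (v * recip_v) = 0"
    unfolding recip_v_eq by (simp add: fps_deriv_power' t' v', simp add: flows algebra_simps power_numeral_reduce)
  then have "v * recip_v = fps_const ((v * recip_v) $ 0)"
    by (rule fps_deriv_eq_0_const)
  also have "(v * recip_v) $ 0 = 1"
    by (simp add: recip_v_def v0 t0 fps_nth_power_0)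
  finally show ?thesis by simp
qed

text \<open>Twice this coefficient is m 1 - 2 h; here the choice of h enters.\<close>

lemma S2_nth: "S $ 2 = 0"
proof -
  have "fps_deriv (fps_deriv S) $ 0 = 0"
    unfolding deriv_S by (simp add: t' e' t0 k0 e0 v0 flow_A_def k' flow_k_def fps_nth_power_0 m1)
  then show ?thesis by (simp add: numeral_2_eq_2)
qed

lemma pX: "p * X = S\<^sup>2"
proof -
  have "p * X = S\<^sup>2 * (v * recip_v)"
    unfolding p_def X_def sigma_fps_def by (simp add: power_mult_distrib)
  then show ?thesis by (simp add: v_recip_v)
qed

text \<open>The equation x = - (log \<sigma>)'' multiplied by \<open>\<sigma>\<^sup>2\<close>. With
  1/v replaced by \<open>recip_v\<close> both sides are \<open>e\<^sup>2\<close> times polynomials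
  in t, v, k, and the polynomials agree.\<close>

lemma X_eq: "X = (fps_deriv S)\<^sup>2 - S * fps_deriv (fps_deriv S)"
proof -
  define H where "H = fps_const h"
  have 1: "fps_deriv (fps_deriv S) = (- H * fps_deriv t + fps_deriv t * k + t * fps_deriv k) * e
      + (1 - H * t + t * k) * fps_deriv e"
    unfolding deriv_S H_def by (simp del: fps_const_neg)
  show ?thesis
    unfolding X_def 1 unfolding deriv_S H_def[symmetric] unfolding sigma_fps_def t' e' k' recip_v_eq flows c1_eq H_def[symmetric]
    by algebra
qed

lemma p_nth: "p $ 0 = 0" "p $ 1 = 0"
  by (simp_all add: p_def fps_mult_nth power2_eq_square t0)

text \<open>As p = 1/x, this is \<open>- p\<^sup>2 (2 y + m 1 x + m 3)\<close> written in t and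
  v.\<close>

lemma deriv_p: "fps_deriv p = t * v * (2 - c1 * t - c3 * t ^ 3 * v)"
  unfolding p_def by (simp add: t' v' fps_deriv_power') (unfold flows, algebra)

lemma const_b: "fps_const b2 = c1\<^sup>2 + 4 * c2"
   "fps_const b4 = 2 * c4 + c1 * c3" "fps_const b6 = c3\<^sup>2 + 4 * c6"
  unfolding b2_def b4_def b6_def c1_def c2_def c3_def c4_def c6_def
  by (simp_all add: numeral_fps_const flip: fps_const_add fps_const_mult fps_const_power)

text \<open>The completed square \<open>(2 y + m 1 x + m 3)\<^sup>2 = 4 x\<^sup>3 + b2 x\<^sup>2 + 2
  b4 x + b6\<close> divided by \<open>x\<^sup>4\<close>. The two sides differ by a multiple of the
  curve equation \<open>v_recip_v\<close>.\<close>

lemma deriv_p_sq: "(fps_deriv p)\<^sup>2 = 4 * p + fps_const b2 * p\<^sup>2 + 2 * fps_const b4 * p ^ 3 + fps_const b6 * p ^ 4"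
proof -
  have "(fps_deriv p)\<^sup>2 - (4 * p + fps_const b2 * p\<^sup>2 + 2 * fps_const b4 * p ^ 3 + fps_const b6 * p ^ 4)
      = 4 * p * (v * recip_v - 1)"
    unfolding deriv_p const_b unfolding p_def recip_v_eq by algebra
  then show ?thesis by (simp add: v_recip_v)
qed

lemma deriv_p_neq_0: "fps_deriv p \<noteq> 0"
proof -
  have "fps_deriv t $ 0 = 1" unfolding t' by (simp add: t0)
  then have "fps_deriv p $ 1 = 2"
    by (simp add: deriv_p fps_mult_nth t0 v0 fps_nth_power_0)
  then show ?thesis by (metis fps_zero_nth zero_neq_numeral)
qed

lemma deriv2_p: "fps_deriv (fps_deriv p) = 2 + fps_const b2 * p + 3 * fps_const b4 * p\<^sup>2 + 2 * fps_const b6 * p ^ 3"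
proof -
  have "2 * fps_deriv p * fps_deriv (fps_deriv p) = fps_deriv ((fps_deriv p)\<^sup>2)"
    by (simp add: fps_deriv_power')
  also have "\<dots> = 2 * fps_deriv p * (2 + fps_const b2 * p + 3 * fps_const b4 * p\<^sup>2 + 2 * fps_const b6 * p ^ 3)"
    unfolding deriv_p_sq by (simp add: fps_deriv_power' algebra_simps)
  finally show ?thesis using deriv_p_neq_0 by simp
qed

text \<open>W is x' times \<open>\<sigma>\<^sup>3\<close>, so \<open>W_sq\<close> and
  \<open>deriv_W\<close> below are the equations for \<open>x'\<^sup>2\<close> and x'' without
  denominators.\<close>

definition "W = fps_deriv X * S - 2 * X * fps_deriv S"

lemma S_neq_0: "S \<noteq> 0"
  using S_nth by auto

lemma SW: "S * W = - (X\<^sup>2 * fps_deriv p)"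
proof -
  have "fps_deriv p * X + p * fps_deriv X = 2 * S * fps_deriv S"
    using arg_cong[OF pX, of fps_deriv] by (simp add: fps_deriv_power' algebra_simps)
  moreover have "S * W = S\<^sup>2 * fps_deriv X - X * (2 * S * fps_deriv S)"
    unfolding W_def by algebra
  ultimately have "S * W = p * X * fps_deriv X - X * (fps_deriv p * X + p * fps_deriv X)"
    by (simp add: pX)
  then show ?thesis by algebra
qed

lemma W_sq: "W\<^sup>2 = 4 * X ^ 3 + fps_const b2 * X\<^sup>2 * S\<^sup>2 + 2 * fps_const b4 * X * S ^ 4 + fps_const b6 * S ^ 6"
proof -
  have "S\<^sup>2 * W\<^sup>2 = X ^ 4 * (fps_deriv p)\<^sup>2"
    using arg_cong[OF SW, of "\<lambda>x. x\<^sup>2"] by (simp add: power_mult_distrib flip: power_mult)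
  also have "\<dots> = S\<^sup>2 * (4 * X ^ 3 + fps_const b2 * X\<^sup>2 * S\<^sup>2 + 2 * fps_const b4 * X * (S\<^sup>2)\<^sup>2 + fps_const b6 * (S\<^sup>2) ^ 3)"
    unfolding deriv_p_sq pX[symmetric] by algebra
  finally show ?thesis using S_neq_0 by (simp flip: power_mult)
qed

lemma X_nth_0: "X $ 0 = 1"
  unfolding X_def recip_v_def by (simp add: e0 t0 fps_nth_power_0)

lemma W_nth_0: "W $ 0 = - 2"
  using S_nth by (simp add: W_def X_nth_0)

text \<open>\<open>W_sq\<close> is differentiated and multiplied by S; then 2 W is cancelled, which
  is possible because W has constant term -2.\<close>

lemma deriv_W: "fps_deriv W * S - 3 * W * fps_deriv S = 6 * X\<^sup>2 + fps_const b2 * X * S\<^sup>2 + fps_const b4 * S ^ 4"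
proof -
  have XS: "fps_deriv X * S = W + 2 * X * fps_deriv S"
    by (simp add: W_def)
  have "2 * W * fps_deriv W = fps_deriv (W\<^sup>2)"
    by (simp add: fps_deriv_power')
  also have "\<dots> = (12 * X\<^sup>2 + 2 * fps_const b2 * X * S\<^sup>2 + 2 * fps_const b4 * S ^ 4) * fps_deriv X
     + (2 * fps_const b2 * X\<^sup>2 * S + 8 * fps_const b4 * X * S ^ 3 + 6 * fps_const b6 * S ^ 5) * fps_deriv S"
    unfolding W_sq by (simp add: fps_deriv_power' algebra_simps)
  finally have "2 * W * fps_deriv W * S = (12 * X\<^sup>2 + 2 * fps_const b2 * X * S\<^sup>2 + 2 * fps_const b4 * S ^ 4) * (fps_deriv X * S)
     + (2 * fps_const b2 * X\<^sup>2 * S + 8 * fps_const b4 * X * S ^ 3 + 6 * fps_const b6 * S ^ 5) * fps_deriv S * S"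
    by algebra
  also have "\<dots> = 2 * W * (6 * X\<^sup>2 + fps_const b2 * X * S\<^sup>2 + fps_const b4 * S ^ 4) + 6 * W\<^sup>2 * fps_deriv S"
    unfolding XS W_sq by algebra
  finally have "2 * W * (fps_deriv W * S - 3 * W * fps_deriv S) = 2 * W * (6 * X\<^sup>2 + fps_const b2 * X * S\<^sup>2 + fps_const b4 * S ^ 4)"
    by algebra
  moreover have "W \<noteq> 0" using W_nth_0 by auto
  ultimately show ?thesis by (simp only: mult_cancel_left) simp
qed

end

section \<open>The bilinear operator \<open>hirota\<close> and the duplication polynomial\<close>

text \<open>\<open>hirota F\<close> is \<open>- F\<^sup>2 (log F)''\<close>. The product rule below
  is additivity of the second logarithmic derivative, and exponentials of linear functions are
  annihilated.\<close>

definition hirota :: "'a::comm_ring_1 fps \<Rightarrow> 'a fps" where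
  "hirota F = (fps_deriv F)\<^sup>2 - F * fps_deriv (fps_deriv F)"

lemma hirota_mult: "hirota (F * G) = F\<^sup>2 * hirota G + G\<^sup>2 * hirota F"
  unfolding hirota_def by (simp add: algebra_simps power2_eq_square)

lemma hirota_power2: "hirota (F\<^sup>2) = 2 * F\<^sup>2 * hirota F"
  unfolding power2_eq_square[of F] hirota_mult by (simp add: algebra_simps power2_eq_square)

context sigma_flow_idom
begin

lemma hirota_S: "hirota S = X"
  by (simp add: hirota_def X_eq)

lemma hirota_p: "hirota p = 2 * p - fps_const b4 * p ^ 3 - fps_const b6 * p ^ 4"
  unfolding hirota_def deriv_p_sq deriv2_p by algebra

text \<open>Additivity applied to \<open>p X = S\<^sup>2\<close>: the values on p and S are known,
  and \<open>p\<^sup>2\<close> can be cancelled.\<close>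

lemma hirota_X: "hirota X = X\<^sup>2 * (fps_const b4 * p + fps_const b6 * p\<^sup>2)"
proof -
  have "hirota (p * X) = 2 * (p * X) * X"
    unfolding pX hirota_power2 hirota_S ..
  then have "p\<^sup>2 * hirota X = p\<^sup>2 * (X\<^sup>2 * (fps_const b4 * p + fps_const b6 * p\<^sup>2))"
    unfolding hirota_mult hirota_p by algebra
  moreover have "p \<noteq> 0" using deriv_p_neq_0 by auto
  ultimately show ?thesis by simp
qed

text \<open>The right-hand side of the duplication formula
  \<open>\<sigma>(2u) = - x'(u) \<sigma>(u)\<^sup>4\<close>, written as a polynomial in S and its
  derivatives so that it converges wherever S does.\<close>

definition "Q = S ^ 3 * fps_deriv (fps_deriv (fps_deriv S)) - 3 * S\<^sup>2 * fps_deriv S * fps_deriv (fps_deriv S)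
  + 2 * S * fps_deriv S ^ 3"

lemma Q_eq: "Q = X\<^sup>2 * fps_deriv p"
proof -
  have "Q = - (S * W)"
    unfolding Q_def W_def X_eq by (simp add: fps_deriv_power') algebra
  then show ?thesis by (simp add: SW)
qed

text \<open>This is 4 b8 in the usual notation for Weierstrass equations.\<close>

definition "b8_4 = b2 * b6 - b4\<^sup>2"

text \<open>The last factor comes from the numerator in \<open>x(2u) = (x\<^sup>4 - b4 x\<^sup>2 - 2
  b6 x - b8) / (4 x\<^sup>3 + b2 x\<^sup>2 + 2 b4 x + b6)\<close>, multiplied by
  \<open>4 p\<^sup>4\<close>. So - (log Q)'' is 4 x(2u), as it should be for \<sigma>(2u).\<close>

lemma hirota_Q: "hirota Q = X ^ 4 * (4 - 4 * fps_const b4 * p\<^sup>2 - 8 * fps_const b6 * p ^ 3 - fps_const b8_4 * p ^ 4)"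
proof -
  have *: "fps_const b8_4 = fps_const b2 * fps_const b6 - (fps_const b4)\<^sup>2"
    by (simp add: b8_4_def)
  have "fps_deriv (fps_deriv (fps_deriv p)) = (fps_const b2 + 6 * fps_const b4 * p + 6 * fps_const b6 * p\<^sup>2) * fps_deriv p"
    unfolding deriv2_p by (simp add: fps_deriv_power' algebra_simps)
  then have "hirota (fps_deriv p) = (2 + fps_const b2 * p + 3 * fps_const b4 * p\<^sup>2 + 2 * fps_const b6 * p ^ 3)\<^sup>2
     - (fps_const b2 + 6 * fps_const b4 * p + 6 * fps_const b6 * p\<^sup>2) * (fps_deriv p)\<^sup>2"
    unfolding hirota_def deriv2_p by (simp add: power2_eq_square)
  then show ?thesis
    unfolding Q_eq hirota_mult hirota_power2 hirota_X deriv_p_sq * by algebra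
qed

lemma p_nth_2: "p $ 2 = 1"
proof -
  have "fps_deriv (fps_deriv p) $ 0 = 2"
    unfolding deriv2_p by (simp add: p_nth fps_nth_power_0)
  then have "2 * p $ 2 = 2 * 1" by (simp add: numeral_2_eq_2)
  then show ?thesis by (simp only: mult_cancel_left) simp
qed

lemma p_nth_3: "p $ 3 = 0"
proof -
  have "fps_deriv (fps_deriv (fps_deriv p)) $ 0 = 0"
    unfolding deriv2_p by (simp add: fps_deriv_power' p_nth[simplified])
  then show ?thesis by (simp add: numeral_3_eq_3)
qed

lemma Q_nth: "Q $ 0 = 0" "Q $ 1 = 2" "Q $ 2 = 0"
proof -
  have X1: "X $ 1 = 0"
    using S_nth S2_nth unfolding X_eq by (simp add: fps_mult_nth power2_eq_square numeral_2_eq_2)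
  show "Q $ 0 = 0" "Q $ 1 = 2" "Q $ 2 = 0"
    using X_nth_0 X1 p_nth p_nth_2 p_nth_3 unfolding Q_eq
    by (simp_all add: fps_mult_nth power2_eq_square numeral_2_eq_2 numeral_3_eq_3)
qed

end

section \<open>Integrality and low-order terms\<close>

lemma fps_nth_deriv2: "fps_deriv (fps_deriv F) $ n = of_nat ((n + 2) * (n + 1)) * F $ (n + 2)"
  by (simp add: algebra_simps)

context sigma_flow_idom
begin

text \<open>The recursion is read off from \<open>deriv2_p\<close>. The results stay free of
  division because the coefficient ring is only a domain of characteristic 0.\<close>

lemma p_nth_low:
  "12 * p $ 4 = b2" "p $ 5 = 0" "30 * p $ 6 = b2 * p $ 4 + 3 * b4" "p $ 7 = 0"
  "56 * p $ 8 = b2 * p $ 6 + 6 * b4 * p $ 4 + 2 * b6"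
proof -
  have *: "of_nat ((n + 2) * (n + 1)) * p $ (n + 2)
      = (if n = 0 then 2 else 0) + b2 * p $ n + 3 * b4 * p\<^sup>2 $ n + 2 * b6 * p ^ 3 $ n" for n
    unfolding fps_nth_deriv2[symmetric] deriv2_p by (simp add: mult.assoc fps_numeral_nth)
  note nths = p_nth p_nth_2 p_nth_3
  have sq: "p\<^sup>2 $ 2 = 0" "p\<^sup>2 $ 3 = 0" "p\<^sup>2 $ 4 = 1" "p\<^sup>2 $ 5 = 0" "p\<^sup>2 $ 6 = 2 * p $ 4"
    using nths by (simp_all add: power2_eq_square fps_mult_nth eval_nat_numeral)
  have cb: "p ^ 3 $ 2 = 0" "p ^ 3 $ 3 = 0" "p ^ 3 $ 4 = 0" "p ^ 3 $ 5 = 0" "p ^ 3 $ 6 = 1"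
    using nths by (simp_all add: power3_eq_cube fps_mult_nth eval_nat_numeral)
  show "12 * p $ 4 = b2"
    using *[of 2] sq cb nths by simp
  show 5: "p $ 5 = 0"
    using *[of 3] sq cb nths by simp
  show "30 * p $ 6 = b2 * p $ 4 + 3 * b4"
    using *[of 4] sq cb nths by simp
  show "p $ 7 = 0"
    using *[of 5] sq cb 5 by simp
  show "56 * p $ 8 = b2 * p $ 6 + 6 * b4 * p $ 4 + 2 * b6"
    using *[of 6] sq cb nths by simp
qed

text \<open>Degrees 4 to 8 of \<open>p X = S\<^sup>2\<close>, with X quadratic in S, express the
  coefficients of S successively through those of p. The abbreviation \<open>a\<close> is b2/4.
  Auxiliary integer factors such as 9 and 30 are introduced to stay in the domain and are cancelled
  at the end.\<close>

lemma S_nth_low: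
  "6 * S $ 3 = h\<^sup>2 + m 2" "S $ 4 = 0" "120 * S $ 5 = (h\<^sup>2 + m 2)\<^sup>2 + b4" "S $ 6 = 0"
  "5040 * S $ 7 = (h\<^sup>2 + m 2) ^ 3 + 3 * (h\<^sup>2 + m 2) * b4 + 6 * b6"
proof -
  define a where "a = h\<^sup>2 + m 2"
  have b2: "b2 = 4 * a"
    by (simp add: b2_def a_def m1 power_mult_distrib)
  have S: "S $ 0 = 0" "S $ 1 = 1" "S $ 2 = 0"
    using S_nth S2_nth by auto
  have X: "X $ n = (\<Sum>i=0..n. of_nat (Suc i * Suc (n - i)) * S $ Suc i * S $ Suc (n - i))
      - (\<Sum>i=0..n. of_nat (Suc (n - i) * Suc (Suc (n - i))) * S $ i * S $ Suc (Suc (n - i)))" for n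
    unfolding X_eq by (simp only: fps_sub_nth power2_eq_square fps_mult_nth fps_deriv_nth Suc_eq_plus1 of_nat_mult mult_ac)
  have pX': "(\<Sum>i=0..n. p $ i * X $ (n - i)) = (\<Sum>i=0..n. S $ i * S $ (n - i))" for n
    using arg_cong[OF pX, of "\<lambda>F. F $ n"] by (simp add: power2_eq_square fps_mult_nth)
  note p = p_nth p_nth_2 p_nth_3 p_nth_low(2,4)
  have X0: "X $ 0 = 1" "X $ 1 = 0" "X $ 2 = 0"
    using S by (simp_all add: X eval_nat_numeral algebra_simps)
  have X3: "X $ 3 = - (4 * S $ 4)"
    using S by (simp add: X eval_nat_numeral algebra_simps)
  have "2 * S $ 3 = p $ 4"
    using pX'[of 4] S p X0 X3 by (simp add: eval_nat_numeral)
  then have p4: "3 * p $ 4 = a" and S3: "6 * S $ 3 = a"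
  proof -
    assume *: "2 * S $ 3 = p $ 4"
    have "4 * (3 * p $ 4) = 4 * a" using p_nth_low(1) by (simp add: b2)
    then show "3 * p $ 4 = a" by (simp only: mult_cancel_left) simp
    then show "6 * S $ 3 = a" by (simp flip: *)
  qed
  have "2 * S $ 4 = - (4 * S $ 4)"
    using pX'[of 5] S p X0 X3 by (simp add: eval_nat_numeral)
  then have "6 * S $ 4 = 0" by algebra
  then show S4: "S $ 4 = 0" by simp
  have X4: "X $ 4 = 3 * (S $ 3)\<^sup>2 - 10 * S $ 5"
    using S by (simp add: X eval_nat_numeral algebra_simps)
  have X5: "X $ 5 = - (18 * S $ 6)"
    using S S4 by (simp add: X eval_nat_numeral algebra_simps)
  have X6: "X $ 6 = 4 * S $ 3 * S $ 5 - 28 * S $ 7"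
    using S S4 by (simp add: X eval_nat_numeral algebra_simps)
  have "p $ 6 + X $ 4 = 2 * S $ 5 + (S $ 3)\<^sup>2"
    using pX'[of 6] S p X0 X3 S4 by (simp add: eval_nat_numeral algebra_simps)
  then have "12 * S $ 5 = 2 * (S $ 3)\<^sup>2 + p $ 6"
    unfolding X4 by algebra
  then have "9 * (120 * S $ 5) = 90 * (2 * (S $ 3)\<^sup>2 + p $ 6)"
    by algebra
  also have "\<dots> = 5 * (6 * S $ 3)\<^sup>2 + 3 * (30 * p $ 6)"
    by algebra
  also have p6: "3 * (30 * p $ 6) = 4 * a\<^sup>2 + 9 * b4"
    unfolding p_nth_low(3) b2 p4[symmetric] by algebra
  finally have "9 * (120 * S $ 5) = 9 * (a\<^sup>2 + b4)"
    unfolding S3 by simp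
  then have S5: "120 * S $ 5 = a\<^sup>2 + b4"
    by (simp only: mult_cancel_left) simp
  have "2 * S $ 6 = - (18 * S $ 6)"
    using pX'[of 7] S p X0 X3 X4 X5 S4 by (simp add: eval_nat_numeral algebra_simps)
  then have "20 * S $ 6 = 0" by algebra
  then show S6: "S $ 6 = 0" by simp
  have "30 * S $ 7 = 2 * S $ 3 * S $ 5 + p $ 4 * (3 * (S $ 3)\<^sup>2 - 10 * S $ 5) + p $ 8"
  proof -
    have "X $ 6 + p $ 4 * X $ 4 + p $ 8 = 2 * S $ 7 + 2 * S $ 3 * S $ 5"
      using pX'[of 8] S p X0 X3 X5 S4 S6 by (simp add: eval_nat_numeral algebra_simps)
    then show ?thesis unfolding X4 X6 by algebra
  qed
  then have "30 * (5040 * S $ 7) = 14 * (6 * S $ 3) * (120 * S $ 5)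
      + 140 * (3 * p $ 4) * ((6 * S $ 3)\<^sup>2 - 120 * S $ 5) + 90 * (56 * p $ 8)"
    by algebra
  also have "90 * (56 * p $ 8) = 4 * a * (3 * (30 * p $ 6)) + 180 * b4 * (3 * p $ 4) + 180 * b6"
    unfolding p_nth_low(5) b2 by algebra
  finally have "30 * (5040 * S $ 7) = 30 * (a ^ 3 + 3 * a * b4 + 6 * b6)"
    unfolding S3 S5 p4 p6 by algebra
  then have S7: "5040 * S $ 7 = a ^ 3 + 3 * a * b4 + 6 * b6"
    by (simp only: mult_cancel_left) simp
  show "6 * S $ 3 = h\<^sup>2 + m 2" "120 * S $ 5 = (h\<^sup>2 + m 2)\<^sup>2 + b4"
    "5040 * S $ 7 = (h\<^sup>2 + m 2) ^ 3 + 3 * (h\<^sup>2 + m 2) * b4 + 6 * b6"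
    using S3 S5 S7 by (simp_all add: a_def)
qed

end

section \<open>Closure properties of Hurwitz integral series\<close>

lemma int_adjoin_0: "0 \<in> int_adjoin S"
  using int_adjoin.intros(4)[OF int_adjoin.intros(2) int_adjoin.intros(3)[OF int_adjoin.intros(2)]] by simp

lemma int_adjoin_diff: "p \<in> int_adjoin S \<Longrightarrow> q \<in> int_adjoin S \<Longrightarrow> p - q \<in> int_adjoin S"
  using int_adjoin.intros(4)[OF _ int_adjoin.intros(3)] by fastforce

lemma int_adjoin_of_nat: "of_nat n \<in> int_adjoin S"
  by (induction n) (auto intro: int_adjoin.intros int_adjoin_0)

lemma int_adjoin_sum: "(\<And>i. i \<in> I \<Longrightarrow> f i \<in> int_adjoin S) \<Longrightarrow> sum f I \<in> int_adjoin S"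
  by (induction I rule: infinite_finite_induct) (auto intro: int_adjoin.intros int_adjoin_0)

text \<open>The truncation carries the induction: integrality of the unknowns up to N gives
  integrality of the right-hand side up to N, hence of the unknowns up to N + 1.\<close>

definition integral_upto :: "nat \<Rightarrow> 'a::comm_ring_1 set \<Rightarrow> 'a fps \<Rightarrow> bool" where
  "integral_upto N T F \<longleftrightarrow> (\<forall>j\<le>N. hurwitz_coeff F j \<in> int_adjoin T)"

lemma hurwitz_integral_iff: "F \<in> hurwitz_integral (int_adjoin T) \<longleftrightarrow> (\<forall>N. integral_upto N T F)"
  unfolding hurwitz_integral_def integral_upto_def by auto

text \<open>The binomial coefficients are integers, so Hurwitz integrality is preserved by products,
  although 1/j! is in general not in A. Differentiation is a mere shift of the index.\<close>

lemma hurwitz_coeff_mult: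
  "hurwitz_coeff (F * G) n = (\<Sum>i=0..n. of_nat (n choose i) * (hurwitz_coeff F i * hurwitz_coeff G (n - i)))"
  unfolding hurwitz_coeff_def fps_mult_nth sum_distrib_left
proof (rule sum.cong[OF refl])
  fix i assume "i \<in> {0..n}"
  then have "fact n = fact i * fact (n - i) * (n choose i)"
    by (simp add: binomial_fact_lemma)
  then have "(of_nat (fact n) :: 'a) = of_nat (fact i) * of_nat (fact (n - i)) * of_nat (n choose i)"
    by (metis of_nat_mult)
  then show "of_nat (fact n) * (F $ i * G $ (n - i)) = of_nat (n choose i) *
      (of_nat (fact i) * F $ i * (of_nat (fact (n - i)) * G $ (n - i)))"
    by (simp only: mult_ac)
qed

lemma hurwitz_coeff_deriv: "hurwitz_coeff (fps_deriv F) n = hurwitz_coeff F (Suc n)"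
  unfolding hurwitz_coeff_def by (simp add: algebra_simps)

lemma integral_upto_mult:
  "integral_upto N T F \<Longrightarrow> integral_upto N T G \<Longrightarrow> integral_upto N T (F * G)"
  unfolding integral_upto_def hurwitz_coeff_mult
  by (intro allI impI int_adjoin_sum int_adjoin.intros(5) int_adjoin_of_nat) auto

lemma integral_upto_add:
  "integral_upto N T F \<Longrightarrow> integral_upto N T G \<Longrightarrow> integral_upto N T (F + G)"
  and integral_upto_diff:
  "integral_upto N T F \<Longrightarrow> integral_upto N T G \<Longrightarrow> integral_upto N T (F - G)"
  and integral_upto_uminus: "integral_upto N T F \<Longrightarrow> integral_upto N T (- F)"
  unfolding integral_upto_def hurwitz_coeff_def
  by (auto simp: ring_distribs right_diff_distrib intro: int_adjoin.intros int_adjoin_diff)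

lemma integral_upto_const: "a \<in> int_adjoin T \<Longrightarrow> integral_upto N T (fps_const a)"
  unfolding integral_upto_def hurwitz_coeff_def by (auto simp: int_adjoin_0)

lemma integral_upto_1: "integral_upto N T 1"
  using integral_upto_const[of 1 T N] by (simp add: int_adjoin.intros)

lemma integral_upto_numeral: "integral_upto N T (numeral n)"
  using integral_upto_const[of "numeral n" T N] int_adjoin_of_nat[of "numeral n" T]
  by (simp add: numeral_fps_const)

lemma integral_upto_power: "integral_upto N T F \<Longrightarrow> integral_upto N T (F ^ n)"
  by (induction n) (auto intro: integral_upto_1 integral_upto_mult)

lemmas integral_upto_intros = integral_upto_add integral_upto_diff integral_upto_uminus integral_upto_mult
  integral_upto_const integral_upto_1 integral_upto_numeral integral_upto_power

lemma integral_upto_0: "integral_upto 0 T F \<longleftrightarrow> F $ 0 \<in> int_adjoin T"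
  by (simp add: integral_upto_def hurwitz_coeff_def)

lemma integral_upto_Suc:
  "integral_upto (Suc N) T F \<longleftrightarrow> F $ 0 \<in> int_adjoin T \<and> integral_upto N T (fps_deriv F)"
  unfolding integral_upto_def hurwitz_coeff_deriv less_Suc_eq_le[symmetric] All_less_Suc2
  by (simp add: hurwitz_coeff_def)

context sigma_flow
begin

lemma integral_t_v_k:
  assumes m: "m 1 \<in> int_adjoin T" "m 2 \<in> int_adjoin T" "m 3 \<in> int_adjoin T" "m 4 \<in> int_adjoin T" "m 6 \<in> int_adjoin T"
  shows "integral_upto N T t \<and> integral_upto N T v \<and> integral_upto N T k"
proof (induction N)
  case 0
  then show ?case by (simp add: integral_upto_0 t0 v0 k0 int_adjoin_0 int_adjoin.intros)
next
  case (Suc N)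
  then have "integral_upto N T (1 - t * A) \<and> integral_upto N T (flow_v m t v) \<and> integral_upto N T (flow_k m t v)"
    using m unfolding flow_A_def flow_v_def flow_k_def by (intro conjI) (auto intro!: integral_upto_intros)
  then show ?case
    by (simp add: integral_upto_Suc t' v' k' t0 v0 k0 int_adjoin_0 int_adjoin.intros)
qed

lemma integral_A:
  assumes m: "m 1 \<in> int_adjoin T" "m 2 \<in> int_adjoin T" "m 3 \<in> int_adjoin T" "m 4 \<in> int_adjoin T" "m 6 \<in> int_adjoin T"
  shows "integral_upto N T A"
  using integral_t_v_k[OF m, of N] m unfolding flow_A_def by (auto intro!: integral_upto_intros)

lemma sigma_integral:
  assumes m: "h \<in> int_adjoin T" "m 2 \<in> int_adjoin T" "m 3 \<in> int_adjoin T" "m 4 \<in> int_adjoin T" "m 6 \<in> int_adjoin T"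
  shows "S \<in> hurwitz_integral (int_adjoin T)"
proof -
  have m1: "m 1 \<in> int_adjoin T"
    unfolding h[symmetric] mult_2 by (intro int_adjoin.intros m)
  have "integral_upto N T e" for N
  proof (induction N)
    case (Suc N)
    have "integral_upto N T (fps_deriv e)"
      unfolding e' using Suc integral_A[OF m1 m(2-)] integral_t_v_k[OF m1 m(2-)] m
      by (auto intro!: integral_upto_intros)
    then show ?case by (simp add: integral_upto_Suc e0 int_adjoin.intros)
  qed (simp add: integral_upto_0 e0 int_adjoin.intros)
  then show ?thesis
    unfolding hurwitz_integral_iff sigma_fps_def using integral_t_v_k[OF m1 m(2-)]
    by (auto intro!: integral_upto_intros)
qed

text \<open>Squaring e doubles its logarithmic derivative, in which -2 h = - m 1 no longer involves
  the half.\<close>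

lemma sigma_square_integral:
  assumes m: "m 1 \<in> int_adjoin T" "m 2 \<in> int_adjoin T" "m 3 \<in> int_adjoin T" "m 4 \<in> int_adjoin T" "m 6 \<in> int_adjoin T"
  shows "S\<^sup>2 \<in> hurwitz_integral (int_adjoin T)"
proof -
  have e2': "fps_deriv (e\<^sup>2) = (2 * A - fps_const (m 1) + 2 * k) * e\<^sup>2"
    unfolding fold_c c1_eq by (simp add: fps_deriv_power' e' power2_eq_square algebra_simps)
  have "integral_upto N T (e\<^sup>2)" for N
  proof (induction N)
    case (Suc N)
    have "integral_upto N T (2 * A - fps_const (m 1) + 2 * k)"
      using integral_A[OF m] integral_t_v_k[OF m] m by (intro integral_upto_intros) auto
    then have "integral_upto N T (fps_deriv (e\<^sup>2))"
      unfolding e2' using Suc by (rule integral_upto_mult)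
    then show ?case by (simp add: integral_upto_Suc e0 int_adjoin.intros fps_nth_power_0)
  qed (simp add: integral_upto_0 e0 int_adjoin.intros fps_nth_power_0)
  then have "integral_upto N T (t\<^sup>2 * e\<^sup>2)" for N
    using integral_t_v_k[OF m] by (intro integral_upto_mult[OF integral_upto_power]) auto
  then show ?thesis
    unfolding hurwitz_integral_iff sigma_fps_def by (simp add: power_mult_distrib)
qed

end

section \<open>Specialisation\<close>

definition monom_val :: "(nat \<Rightarrow> complex) \<Rightarrow> (nat \<Rightarrow>\<^sub>0 nat) \<Rightarrow> complex" where
  "monom_val \<mu> a = (\<Prod>i \<in> Poly_Mapping.keys a. \<mu> i ^ Poly_Mapping.lookup a i)"

lemma monom_val_superset:
  assumes "finite I" "Poly_Mapping.keys a \<subseteq> I"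
  shows "monom_val \<mu> a = (\<Prod>i\<in>I. \<mu> i ^ Poly_Mapping.lookup a i)"
  unfolding monom_val_def using assms by (intro prod.mono_neutral_left) (auto simp: in_keys_iff)

lemma monom_val_add: "monom_val \<mu> (a + b) = monom_val \<mu> a * monom_val \<mu> b"
proof -
  let ?I = "Poly_Mapping.keys a \<union> Poly_Mapping.keys b"
  have "Poly_Mapping.keys (a + b) \<subseteq> ?I" by (rule keys_add)
  then show ?thesis
    by (subst (1 2 3) monom_val_superset[of ?I]) (auto simp: lookup_add power_add prod.distrib)
qed

lemma qpoly_eval_superset:
  assumes "finite I" "Poly_Mapping.keys p \<subseteq> I"
  shows "qpoly_eval \<mu> p = (\<Sum>a\<in>I. of_rat (Poly_Mapping.lookup p a) * monom_val \<mu> a)"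
  unfolding qpoly_eval_def monom_val_def[symmetric]
  using assms by (intro sum.mono_neutral_left) (auto simp: in_keys_iff)

lemma qpoly_eval_add: "qpoly_eval \<mu> (p + q) = qpoly_eval \<mu> p + qpoly_eval \<mu> q"
proof -
  let ?I = "Poly_Mapping.keys p \<union> Poly_Mapping.keys q"
  have "Poly_Mapping.keys (p + q) \<subseteq> ?I" by (rule keys_add)
  then show ?thesis
    by (subst (1 2 3) qpoly_eval_superset[of ?I])
      (auto simp: lookup_add of_rat_add distrib_right sum.distrib)
qed

lemma qpoly_eval_single: "qpoly_eval \<mu> (Poly_Mapping.single a c) = of_rat c * monom_val \<mu> a"
  by (cases "c = 0") (auto simp: qpoly_eval_def monom_val_def)

lemma qpoly_eval_0 [simp]: "qpoly_eval \<mu> 0 = 0"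
  by (simp add: qpoly_eval_def)

lemma qpoly_eval_sum: "qpoly_eval \<mu> (sum f I) = (\<Sum>i\<in>I. qpoly_eval \<mu> (f i))"
  by (induction I rule: infinite_finite_induct) (auto simp: qpoly_eval_add)

lemma qpoly_eval_mult: "qpoly_eval \<mu> (p * q) = qpoly_eval \<mu> p * qpoly_eval \<mu> q"
proof -
  have expand: "p = (\<Sum>a\<in>Poly_Mapping.keys p. Poly_Mapping.single a (Poly_Mapping.lookup p a))" for p :: qpoly
    by (rule poly_mapping_eqI) (auto simp: lookup_sum lookup_single when_def sum.delta in_keys_iff)
  have "qpoly_eval \<mu> (p * q) = (\<Sum>a\<in>Poly_Mapping.keys p. \<Sum>b\<in>Poly_Mapping.keys q.
      qpoly_eval \<mu> (Poly_Mapping.single a (Poly_Mapping.lookup p a) * Poly_Mapping.single b (Poly_Mapping.lookup q b)))"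
    by (subst expand[of p], subst expand[of q]) (simp only: sum_product qpoly_eval_sum)
  also have "\<dots> = qpoly_eval \<mu> p * qpoly_eval \<mu> q"
    unfolding mult_single qpoly_eval_single
    unfolding qpoly_eval_def sum_product monom_val_def[symmetric]
    by (simp add: monom_val_add of_rat_mult mult_ac)
  finally show ?thesis .
qed

lemma qpoly_eval_1 [simp]: "qpoly_eval \<mu> 1 = 1"
  using qpoly_eval_single[of \<mu> 0 1] by (simp add: monom_val_def)

lemma qpoly_eval_numeral [simp]: "qpoly_eval \<mu> (numeral n) = numeral n"
  using qpoly_eval_single[of \<mu> 0 "numeral n"] by (simp add: monom_val_def)

lemma qpoly_eval_uminus: "qpoly_eval \<mu> (- p) = - qpoly_eval \<mu> p"
  using qpoly_eval_add[of \<mu> p "- p"] by (simp add: eq_neg_iff_add_eq_0 add.commute)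

lemma qpoly_eval_of_nat [simp]: "qpoly_eval \<mu> (of_nat n) = of_nat n"
  by (induction n) (auto simp: qpoly_eval_add)

lemma qpoly_eval_Mu [simp]: "qpoly_eval \<mu> (Mu i) = \<mu> i"
  by (simp add: Mu_def qpoly_eval_single monom_val_def)

lemma qpoly_eval_half_Mu1 [simp]: "qpoly_eval \<mu> half_Mu1 = \<mu> 1 / 2"
  by (simp add: half_Mu1_def qpoly_eval_single monom_val_def of_rat_divide)

lemma half_Mu1: "2 * half_Mu1 = Mu 1"
  unfolding half_Mu1_def Mu_def single_numeral[symmetric] mult_single by simp

definition fps_spec :: "(nat \<Rightarrow> complex) \<Rightarrow> qpoly fps \<Rightarrow> complex fps" where
  "fps_spec \<mu> F = Abs_fps (\<lambda>j. qpoly_eval \<mu> (F $ j))"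

lemma fps_spec_nth [simp]: "fps_spec \<mu> F $ n = qpoly_eval \<mu> (F $ n)"
  by (simp add: fps_spec_def)

lemma fps_spec_add: "fps_spec \<mu> (F + G) = fps_spec \<mu> F + fps_spec \<mu> G"
  and fps_spec_uminus: "fps_spec \<mu> (- F) = - fps_spec \<mu> F"
  and fps_spec_mult: "fps_spec \<mu> (F * G) = fps_spec \<mu> F * fps_spec \<mu> G"
  and fps_spec_const: "fps_spec \<mu> (fps_const a) = fps_const (qpoly_eval \<mu> a)"
  and fps_spec_deriv: "fps_spec \<mu> (fps_deriv F) = fps_deriv (fps_spec \<mu> F)"
  by (rule fps_ext; simp add: fps_mult_nth qpoly_eval_sum qpoly_eval_add qpoly_eval_mult qpoly_eval_uminus)+

lemma fps_spec_1: "fps_spec \<mu> 1 = 1"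
  using fps_spec_const[of \<mu> 1] by simp

lemma fps_spec_numeral: "fps_spec \<mu> (numeral n) = numeral n"
  using fps_spec_const[of \<mu> "numeral n"] by (simp add: numeral_fps_const)

lemma fps_spec_diff: "fps_spec \<mu> (F - G) = fps_spec \<mu> F - fps_spec \<mu> G"
  unfolding diff_conv_add_uminus fps_spec_add fps_spec_uminus ..

lemma fps_spec_power: "fps_spec \<mu> (F ^ n) = fps_spec \<mu> F ^ n"
  by (induction n) (auto simp: fps_spec_mult fps_spec_1)

lemmas fps_spec_simps = fps_spec_add fps_spec_uminus fps_spec_mult fps_spec_const fps_spec_1
  fps_spec_numeral fps_spec_diff fps_spec_power

text \<open>The system is written with ring operations and the derivation only, and specialisation
  commutes with all of these. The universal solution therefore specialises to the solution for each
  complex curve.\<close>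

lemma sigma_flow_spec:
  assumes "sigma_flow Mu half_Mu1 t v k e"
  shows "sigma_flow \<mu> (\<mu> 1 / 2) (fps_spec \<mu> t) (fps_spec \<mu> v) (fps_spec \<mu> k) (fps_spec \<mu> e)"
proof -
  interpret sigma_flow Mu half_Mu1 t v k e by fact
  show ?thesis
    by unfold_locales (simp_all add: fps_spec_deriv[symmetric] t' v' k' e' t0 v0 k0 e0,
        simp_all add: flow_A_def flow_v_def flow_k_def fps_spec_simps)
qed

lemma universal_sigma_flow:
  obtains t v k e where "sigma_flow Mu half_Mu1 t v k e"
proof (rule sigma_flow_exists[of half_Mu1 Mu])
  show "2 * half_Mu1 = Mu 1" by (rule half_Mu1)
  \<comment> \<open>The inverse of n + 1 is a constant polynomial; the rational coefficients of
    \<open>qpoly\<close> provide it.\<close>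
  show "of_nat (Suc n) * Poly_Mapping.single 0 (1 / of_nat (Suc n)) = (1::qpoly)" for n
    unfolding single_of_nat[symmetric] mult_single by (simp del: of_nat_Suc)
qed (rule that)

section \<open>The sigma series is entire\<close>

text \<open>
  By the duplication formula \<open>\<sigma>(2u) = Q(u)\<close> the radius of convergence \<open>R\<close> satisfies \<open>R \<le> R/2\<close>.
\<close>

definition fps_scale :: "complex \<Rightarrow> complex fps \<Rightarrow> complex fps" where
  "fps_scale a F = F oo (fps_const a * fps_X)"

abbreviation "fps_double \<equiv> fps_scale 2"

lemma fps_scale_nth: "fps_scale a F $ n = a ^ n * F $ n"
  by (simp add: fps_scale_def fps_compose_linear)

lemma fps_scale_mult: "fps_scale a (F * G) = fps_scale a F * fps_scale a G"
  and fps_scale_add: "fps_scale a (F + G) = fps_scale a F + fps_scale a G"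
  and fps_scale_diff: "fps_scale a (F - G) = fps_scale a F - fps_scale a G"
  and fps_scale_const: "fps_scale a (fps_const c) = fps_const c"
  and fps_scale_numeral: "fps_scale a (numeral n) = numeral n"
  and fps_scale_deriv: "fps_deriv (fps_scale a F) = fps_const a * fps_scale a (fps_deriv F)"
  unfolding fps_scale_def
  by (simp_all add: fps_compose_mult_distrib fps_compose_add_distrib fps_compose_sub_distrib
      fps_compose_deriv numeral_fps_const mult.commute)

lemma fps_scale_power: "fps_scale a (F ^ n) = fps_scale a F ^ n"
  by (induction n) (simp_all add: fps_scale_mult fps_scale_const[of _ 1, simplified])

lemmas fps_scale_simps = fps_scale_mult fps_scale_add fps_scale_diff fps_scale_const
  fps_scale_numeral fps_scale_power

lemma hirota_scale: "hirota (fps_scale a F) = fps_const (a\<^sup>2) * fps_scale a (hirota F)"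
  by (simp add: hirota_def fps_scale_deriv fps_scale_simps power2_eq_square algebra_simps flip: fps_const_mult)

lemma fps_double_deriv: "fps_deriv (fps_double F) = 2 * fps_double (fps_deriv F)"
  by (simp add: fps_scale_deriv numeral_fps_const)

lemma fps_conv_radius_double:
  assumes "fps_conv_radius F \<le> fps_conv_radius (fps_double F)" "fps_conv_radius F > 0"
  shows "fps_conv_radius F = \<infinity>"
proof -
  have "fps_conv_radius (fps_double F) = fps_conv_radius F / 2"
    unfolding fps_conv_radius_def fps_scale_nth
    using conv_radius_mult_power[of "2 :: complex" "fps_nth F"] by simp
  then show ?thesis
    using assms by (cases "fps_conv_radius F") auto
qed

text \<open>Equality of - (log F)'' and - (log G)'' makes log r linear: g = r'/r exists because r is
  a unit, its derivative vanishes, and r' = g r with constant g has exponential solutions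
  only.\<close>

lemma hirota_eq_imp_exp:
  fixes F G r :: "complex fps"
  assumes eq: "hirota F * G\<^sup>2 = hirota G * F\<^sup>2" and F: "F = r * G" and G: "G \<noteq> 0" and r0: "r $ 0 \<noteq> 0"
  shows "r = fps_const (r $ 0) * fps_exp (r $ 1 / r $ 0)"
proof -
  have "G\<^sup>2 * G\<^sup>2 * hirota r = hirota F * G\<^sup>2 - hirota G * F\<^sup>2"
    unfolding F hirota_mult by (simp add: algebra_simps power2_eq_square)
  then have hr: "hirota r = 0" using eq G by simp
  have inv: "inverse r * r = 1" by (rule inverse_mult_eq_1[OF r0])
  have r_nz: "r \<noteq> 0" using r0 by auto
  define g where "g = fps_deriv r * inverse r"
  have gr: "fps_deriv r = g * r"
    unfolding g_def by (simp add: mult.assoc inv)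
  have r'': "fps_deriv (fps_deriv r) = g * fps_deriv r + fps_deriv g * r"
    using arg_cong[OF gr, of fps_deriv] by (simp only: fps_deriv_mult)
  have "hirota r = - fps_deriv g * r\<^sup>2"
    unfolding hirota_def r'' unfolding gr by (simp add: algebra_simps power2_eq_square)
  then have "fps_deriv g = 0" using hr r_nz by simp
  then have "g = fps_const (g $ 0)" by (rule fps_deriv_eq_0_const)
  also have "g $ 0 = r $ 1 / r $ 0"
    by (simp add: g_def divide_inverse)
  finally show ?thesis
    using gr fps_exp_unique_ODE by metis
qed

text \<open>Both series have a simple zero, so their quotient r is a unit. The agreement of the
  first coefficients gives r = 1 + 0 u + ..., and the exponential factor becomes trivial.\<close>

lemma hirota_eq_imp_eq:
  fixes F G :: "complex fps"
  assumes eq: "hirota F * G\<^sup>2 = hirota G * F\<^sup>2"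
    and F: "F $ 0 = 0" "F $ 1 = G $ 1" "F $ 2 = G $ 2" and G: "G $ 0 = 0" "G $ 1 \<noteq> 0"
  shows "F = G"
proof -
  define F1 G1 where "F1 = fps_shift 1 F" and "G1 = fps_shift 1 G"
  have FG: "F = fps_X * F1" "G = fps_X * G1"
    unfolding F1_def G1_def by (rule fps_ext, simp add: F(1) G(1) split: nat.split)+
  define r where "r = F1 * inverse G1"
  have G1: "G1 $ 0 \<noteq> 0" using G by (simp add: G1_def)
  have r: "F1 = r * G1"
    unfolding r_def by (simp add: mult.assoc inverse_mult_eq_1[OF G1])
  have n: "F1 $ 0 = G1 $ 0" "F1 $ 1 = G1 $ 1"
    using F by (auto simp: F1_def G1_def numeral_2_eq_2)
  then have "r $ 0 * G1 $ 0 = G1 $ 0" unfolding r by (simp add: fps_mult_nth)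
  then have r0: "r $ 0 = 1" using G1 by simp
  have "r $ 0 * G1 $ 1 + r $ 1 * G1 $ 0 = G1 $ 1"
    using n(2) unfolding r by (simp add: fps_mult_nth)
  then have r1: "r $ 1 = 0" using r0 G1 by simp
  have Fr: "F = r * G" by (simp add: FG r mult_ac)
  have "r = fps_const (r $ 0) * fps_exp (r $ 1 / r $ 0)"
    by (rule hirota_eq_imp_exp[OF eq Fr]) (use G r0 in auto)
  then show ?thesis using r0 r1 by (simp add: Fr)
qed

locale sigma_flow_complex = sigma_flow_idom m h t v k e
  for m :: "nat \<Rightarrow> complex" and h t v k e
begin

lemma fps_conv_radius_S_pos: "fps_conv_radius S > 0"
proof -
  define f where "f = (\<lambda>i::nat. if i = 0 then t else if i = 1 then v else if i = 2 then k else e)"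
  have f: "f 0 = t" "f (Suc 0) = v" "f 2 = k" "f 3 = e" by (simp_all add: f_def)
  let ?I = "{0,Suc 0,2,3::nat}"
  note proj = tame_proj[of 0 ?I 1 f] tame_proj[of "Suc 0" ?I 1 f] tame_proj[of 2 ?I 1 f] tame_proj[of 3 ?I 1 f]
  have tv: "tame 1 ?I f t" "tame 1 ?I f v" "tame 1 ?I f k" "tame 1 ?I f e"
    using proj by (simp_all add: f)
  have A: "tame 1 ?I f A" unfolding flow_A_def by (intro tame_intros tv)
  have "fps_conv_radius (f i) > 0" if "i \<in> ?I" for i
  proof (rule fps_ode_converges[of ?I f 1 i])
    fix i assume i: "i \<in> ?I"
    show "norm (f i $ 0) \<le> 1"
      using i by (auto simp: f t0 v0 k0 e0)
    have "tame 1 ?I f (1 - t * A)" "tame 1 ?I f (flow_v m t v)" "tame 1 ?I f (flow_k m t v)"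
      "tame 1 ?I f ((A - fps_const h + k) * e)"
      unfolding flow_v_def flow_k_def by (intro tame_intros tv A)+
    then show "tame 1 ?I f (fps_deriv (f i))"
      using i by (auto simp: f t' v' k' e')
  qed (use that in auto)
  from this[of 0] this[of 3] have "fps_conv_radius t > 0" "fps_conv_radius e > 0"
    by (simp_all add: f)
  then show ?thesis
    unfolding sigma_fps_def using fps_conv_radius_mult[of t e] by (simp add: min_def split: if_splits)
qed

text \<open>Duplication formula for \<open>1/x\<close>: both sides solve the same second-order differential equation.\<close>

lemma double_p:
  "fps_double p * (4 - 4 * fps_const b4 * p\<^sup>2 - 8 * fps_const b6 * p ^ 3 - fps_const b8_4 * p ^ 4)
     = 4 * (fps_deriv p)\<^sup>2"
proof -
  define B2 B4 B6 where "B2 = fps_const b2" and "B4 = fps_const b4" and "B6 = fps_const b6"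
  define M where "M = 4 + B2 * p + 2 * B4 * p\<^sup>2 + B6 * p ^ 3"
  define D where "D = 4 - 4 * B4 * p\<^sup>2 - 8 * B6 * p ^ 3 - fps_const b8_4 * p ^ 4"
  have b8: "fps_const b8_4 = B2 * B6 - B4\<^sup>2"
    by (simp add: b8_4_def B2_def B4_def B6_def)
  have D0: "D $ 0 \<noteq> 0" by (simp add: D_def p_nth fps_nth_power_0 fps_numeral_nth)
  have Dinv: "inverse D * D = 1" by (rule inverse_mult_eq_1[OF D0])
  \<comment> \<open>As \<open>p M = p'\<^sup>2\<close>, this is the candidate for p(2u). The factor
    4 in its equation \<open>q_sq\<close> is the square of the 2 from the chain rule for
    p(2u).\<close>
  define q where "q = 4 * p * M * inverse D"
  have qD: "q * D = 4 * p * M" unfolding q_def by (simp add: mult.assoc Dinv)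
  have pM: "(fps_deriv p)\<^sup>2 = p * M"
    unfolding deriv_p_sq M_def B2_def B4_def B6_def by algebra
  have dconst: "fps_deriv B2 = 0" "fps_deriv B4 = 0" "fps_deriv B6 = 0"
    by (simp_all add: B2_def B4_def B6_def)
  define M' where "M' = B2 + 4 * B4 * p + 3 * B6 * p\<^sup>2"
  define D' where "D' = - 8 * B4 * p - 24 * B6 * p\<^sup>2 - 4 * (B2 * B6 - B4\<^sup>2) * p ^ 3"
  have M': "fps_deriv M = M' * fps_deriv p" and D': "fps_deriv D = D' * fps_deriv p"
    unfolding M_def D_def M'_def D'_def b8
    by (simp_all add: fps_deriv_power' dconst algebra_simps)
  have Dnz: "D \<noteq> 0" using D0 by auto
  have "fps_deriv q * D + q * fps_deriv D = fps_deriv (4 * p * M)"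
    unfolding qD[symmetric] by simp
  then have "fps_deriv q * D * D = (4 * p * M' * D + 4 * M * D - 4 * p * M * D') * fps_deriv p"
    using qD unfolding D' M' fps_deriv_mult by (simp add: M' ) algebra
  then have "(fps_deriv q)\<^sup>2 * D ^ 4 = (4 * p * M' * D + 4 * M * D - 4 * p * M * D')\<^sup>2 * (p * M)"
    unfolding pM[symmetric] by algebra
  also have "\<dots> = 4 * (4 * (4 * p * M) * D ^ 3 + B2 * (4 * p * M)\<^sup>2 * D\<^sup>2
      + 2 * B4 * (4 * p * M) ^ 3 * D + B6 * (4 * p * M) ^ 4)"
    unfolding M_def M'_def D_def D'_def b8 by algebra
  also have "\<dots> = 4 * (4 * q + B2 * q\<^sup>2 + 2 * B4 * q ^ 3 + B6 * q ^ 4) * D ^ 4"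
    unfolding qD[symmetric] by algebra
  finally have q_sq: "(fps_deriv q)\<^sup>2 = 4 * (4 * q + B2 * q\<^sup>2 + 2 * B4 * q ^ 3 + B6 * q ^ 4)"
    using Dnz by simp
  have q0: "q $ 0 = 0" "q $ 1 = 0"
    by (simp_all add: q_def fps_mult_nth p_nth[simplified])
  have q2: "q $ 2 = 4"
  proof -
    have "(q * D) $ 2 = (4 * p * M) $ 2" by (simp add: qD)
    then show ?thesis
      using q0 p_nth p_nth_2 by (simp add: fps_mult_nth eval_nat_numeral D_def M_def)
  qed
  have q'nz: "fps_deriv q \<noteq> 0"
  proof -
    have "fps_deriv q $ 1 = 8" using q2 by (simp add: numeral_2_eq_2)
    then show ?thesis by (metis fps_zero_nth zero_neq_numeral)
  qed
  have "2 * fps_deriv q * fps_deriv (fps_deriv q) = fps_deriv ((fps_deriv q)\<^sup>2)"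
    by (simp add: fps_deriv_power')
  also have "\<dots> = 2 * fps_deriv q * (4 * (2 + B2 * q + 3 * B4 * q\<^sup>2 + 2 * B6 * q ^ 3))"
    unfolding q_sq by (simp add: fps_deriv_power' dconst algebra_simps)
  finally have q'': "fps_deriv (fps_deriv q) = 4 * (2 + B2 * q + 3 * B4 * q\<^sup>2 + 2 * B6 * q ^ 3)"
    using q'nz by simp
  have P'': "fps_deriv (fps_deriv (fps_double p)) = 4 * (2 + B2 * fps_double p
      + 3 * B4 * (fps_double p)\<^sup>2 + 2 * B6 * fps_double p ^ 3)"
    by (simp add: fps_double_deriv deriv2_p fps_scale_simps B2_def B4_def B6_def)
  have "fps_double p = q"
  proof (rule fps_ode2_unique)
    show "causal (\<lambda>f. 4 * (2 + B2 * f () + 3 * B4 * (f ())\<^sup>2 + 2 * B6 * f () ^ 3))"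
      by (intro causal_intros)
  qed (use q0 P'' q'' p_nth in \<open>simp_all add: fps_scale_nth\<close>)
  then show ?thesis
    using qD pM by (simp add: D_def B4_def B6_def)
qed

text \<open>Both sides have second logarithmic derivative -4 x(2u), and both start with 2 u and no
  quadratic term.\<close>

lemma double_S: "fps_double S = Q"
proof (rule hirota_eq_imp_eq)
  define P where "P = fps_double p"
  define f where "f = fps_double S"
  have "hirota f = 4 * fps_double (hirota S)"
    by (simp add: f_def hirota_scale numeral_fps_const)
  then have f: "P * hirota f = 4 * f\<^sup>2"
    unfolding hirota_S P_def f_def
    by (simp add: fps_scale_mult[symmetric] fps_scale_power[symmetric] pX mult.left_commute[of "fps_double p"])
  have "P * hirota Q = 4 * Q\<^sup>2"
    unfolding hirota_Q unfolding P_def Q_eq using double_p by (simp add: power_mult_distrib mult.left_commute flip: power_mult)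
  then have "P * (hirota f * Q\<^sup>2) = P * (hirota Q * f\<^sup>2)"
    using f by algebra
  moreover have "P \<noteq> 0"
  proof -
    have "P $ 2 = 4" by (simp add: P_def fps_scale_nth p_nth_2)
    then show ?thesis by (metis fps_zero_nth zero_neq_numeral)
  qed
  ultimately show "hirota (fps_double S) * Q\<^sup>2 = hirota Q * (fps_double S)\<^sup>2"
    by (simp add: f_def)
qed (use Q_nth S_nth S2_nth in \<open>simp_all add: fps_scale_nth\<close>)

text \<open>The equation for p'' is invariant under u -> -u, so p is even by uniqueness. Then S(-u)
  and S(u) have the same second logarithmic derivative, and the leading coefficients fix the
  sign.\<close>

lemma S_odd: "fps_scale (-1) S = - S"
proof -
  have "fps_scale (-1) p = p"
  proof (rule fps_ode2_unique)
    show "causal (\<lambda>f. 2 + fps_const b2 * f () + 3 * fps_const b4 * (f ())\<^sup>2 + 2 * fps_const b6 * f () ^ 3)"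
      by (intro causal_intros)
  qed (use p_nth in \<open>simp_all add: fps_scale_nth fps_scale_deriv deriv2_p fps_scale_simps flip: mult.assoc\<close>)
  then have p: "p * fps_scale (-1) X = (fps_scale (-1) S)\<^sup>2"
    using arg_cong[OF pX, of "fps_scale (-1)"] by (simp add: fps_scale_simps)
  have neg: "hirota (- F) = hirota F" for F :: "complex fps"
    by (simp add: hirota_def)
  have "S = - fps_scale (-1) S"
  proof (rule hirota_eq_imp_eq)
    have "p * (hirota S * (fps_scale (-1) S)\<^sup>2) = p * (hirota (fps_scale (-1) S) * S\<^sup>2)"
      unfolding hirota_scale hirota_S p[symmetric] pX[symmetric] by simp
    moreover have "p \<noteq> 0" using deriv_p_neq_0 by auto
    ultimately show "hirota S * (- fps_scale (-1) S)\<^sup>2 = hirota (- fps_scale (-1) S) * S\<^sup>2"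
      by (simp add: neg)
  qed (use S_nth S2_nth in \<open>simp_all add: fps_scale_nth\<close>)
  then show ?thesis by (metis minus_minus)
qed

lemma fps_conv_radius_S: "fps_conv_radius S = \<infinity>"
proof (rule fps_conv_radius_double[OF _ fps_conv_radius_S_pos])
  have d: "fps_conv_radius (fps_deriv F) \<ge> fps_conv_radius S" if "fps_conv_radius F \<ge> fps_conv_radius S" for F :: "complex fps"
    using that fps_conv_radius_deriv[of F] by simp
  have mult: "fps_conv_radius (F * G) \<ge> fps_conv_radius S"
    if "fps_conv_radius F \<ge> fps_conv_radius S" "fps_conv_radius G \<ge> fps_conv_radius S" for F G :: "complex fps"
    using that fps_conv_radius_mult[of F G] by (meson min.boundedI order_trans)
  have add: "fps_conv_radius (F + G) \<ge> fps_conv_radius S" "fps_conv_radius (F - G) \<ge> fps_conv_radius S"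
    if "fps_conv_radius F \<ge> fps_conv_radius S" "fps_conv_radius G \<ge> fps_conv_radius S" for F G :: "complex fps"
    using that fps_conv_radius_add[of F G] fps_conv_radius_diff[of F G] by (meson min.boundedI order_trans)+
  have pow: "fps_conv_radius (F ^ n) \<ge> fps_conv_radius S" if "fps_conv_radius F \<ge> fps_conv_radius S" for F :: "complex fps" and n
    using that fps_conv_radius_power order_trans by blast
  show "fps_conv_radius S \<le> fps_conv_radius (fps_double S)"
    unfolding double_S Q_def by (intro add mult pow d order_refl) simp_all
qed

end

section \<open>Series satisfying the sigma equation\<close>

text \<open>\<open>W_fps F = F\<^sup>3 x'\<close> for \<open>x = hirota F / F\<^sup>2\<close>.\<close>

definition W_fps :: "complex fps \<Rightarrow> complex fps" where
  "W_fps F = fps_deriv (hirota F) * F - 2 * hirota F * fps_deriv F"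

definition sigma_eq1 :: "complex \<Rightarrow> complex \<Rightarrow> complex \<Rightarrow> complex fps \<Rightarrow> bool" where
  "sigma_eq1 b2 b4 b6 F \<longleftrightarrow> (W_fps F)\<^sup>2 = 4 * hirota F ^ 3 + fps_const b2 * (hirota F)\<^sup>2 * F\<^sup>2
     + 2 * fps_const b4 * hirota F * F ^ 4 + fps_const b6 * F ^ 6"

definition sigma_eq2 :: "complex \<Rightarrow> complex \<Rightarrow> complex fps \<Rightarrow> bool" where
  "sigma_eq2 b2 b4 F \<longleftrightarrow> fps_deriv (W_fps F) * F - 3 * W_fps F * fps_deriv F
     = 6 * (hirota F)\<^sup>2 + fps_const b2 * hirota F * F\<^sup>2 + fps_const b4 * F ^ 4"

lemma fps_X_deriv_power: "fps_X * fps_deriv (fps_X ^ n) = of_nat n * (fps_X ^ n :: 'a::comm_ring_1 fps)"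
  by (induction n) (simp_all add: algebra_simps)

lemma hirota_fps_X_power: "fps_X\<^sup>2 * hirota (fps_X ^ n) = of_nat n * ((fps_X ^ n)\<^sup>2 :: 'a::comm_ring_1 fps)"
proof (induction n)
  case (Suc n)
  have "hirota fps_X = (1 :: 'a fps)" by (simp add: hirota_def)
  then have "fps_X\<^sup>2 * hirota (fps_X ^ Suc n) = (fps_X * fps_X ^ n)\<^sup>2 + fps_X\<^sup>2 * (fps_X\<^sup>2 * hirota (fps_X ^ n :: 'a fps))"
    by (simp add: hirota_mult power2_eq_square algebra_simps)
  then show ?case
    unfolding Suc by (simp add: power2_eq_square algebra_simps)
qed (simp add: hirota_def)

text \<open>At a zero of order n > 0 the function x behaves like \<open>n / u\<^sup>2\<close>. The
  leading terms of \<open>x'\<^sup>2 = 4 x\<^sup>3 + ...\<close> then give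
  \<open>4 n\<^sup>2 = 4 n\<^sup>3\<close>.\<close>

lemma sigma_eq1_subdegree:
  assumes eq: "sigma_eq1 b2 b4 b6 F" and F: "F \<noteq> 0"
  shows "subdegree F \<le> 1"
proof -
  define n where "n = subdegree F"
  define g where "g = fps_shift n F"
  define P q :: "complex fps" where "P = fps_X" and "q = P ^ n"
  have Fg: "F = q * g"
    using subdegree_decompose[of F] by (simp add: n_def g_def q_def P_def mult.commute)
  have g0: "g $ 0 \<noteq> 0"
    using F by (simp add: g_def n_def)
  have P0: "P $ 0 = 0" and P': "fps_deriv P = 1" by (simp_all add: P_def)
  have q': "P * fps_deriv q = of_nat n * q"
    unfolding q_def P_def by (rule fps_X_deriv_power)
  have qnz: "q \<noteq> 0" by (simp add: q_def P_def)
  \<comment> \<open>With \<open>F = u\<^sup>n g\<close>, the cofactors Y here and V below satisfy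
    \<open>x = Y / (u\<^sup>2 g\<^sup>2)\<close> and \<open>x' = V / (u\<^sup>3 g\<^sup>3)\<close>,
    so the leading terms are the constant terms of Y and V.\<close>
  define Y where "Y = of_nat n * g\<^sup>2 + P\<^sup>2 * hirota g"
  have X: "P\<^sup>2 * hirota F = q\<^sup>2 * Y"
  proof -
    have "P\<^sup>2 * hirota F = q\<^sup>2 * P\<^sup>2 * hirota g + g\<^sup>2 * (P\<^sup>2 * hirota q)"
      unfolding Fg hirota_mult by (simp add: algebra_simps)
    also have "P\<^sup>2 * hirota q = of_nat n * q\<^sup>2"
      unfolding q_def P_def by (rule hirota_fps_X_power)
    finally show ?thesis by (simp add: Y_def algebra_simps)
  qed
  have F': "P * fps_deriv F = q * (of_nat n * g + P * fps_deriv g)"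
  proof -
    have "P * fps_deriv F = q * P * fps_deriv g + (P * fps_deriv q) * g"
      unfolding Fg by (simp add: algebra_simps)
    then show ?thesis unfolding q' by (simp add: algebra_simps)
  qed
  have X': "P ^ 3 * fps_deriv (hirota F) = q\<^sup>2 * (2 * of_nat n * Y + P * fps_deriv Y - 2 * Y)"
  proof -
    have "P * fps_deriv (P\<^sup>2 * hirota F) = P * fps_deriv (q\<^sup>2 * Y)"
      by (simp add: X)
    then have "P * (P\<^sup>2 * fps_deriv (hirota F) + 2 * P * hirota F) = q\<^sup>2 * (P * fps_deriv Y) + 2 * q * (P * fps_deriv q) * Y"
      by (simp add: fps_deriv_power' P' algebra_simps)
    then have "P ^ 3 * fps_deriv (hirota F) + 2 * (P\<^sup>2 * hirota F) = q\<^sup>2 * (P * fps_deriv Y) + 2 * q * (of_nat n * q) * Y"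
      unfolding q' by (simp add: power3_eq_cube power2_eq_square algebra_simps)
    then have "P ^ 3 * fps_deriv (hirota F) = q\<^sup>2 * (P * fps_deriv Y) + 2 * q * (of_nat n * q) * Y - 2 * (q\<^sup>2 * Y)"
      unfolding X by (simp add: eq_diff_eq)
    then show ?thesis by (simp add: power2_eq_square algebra_simps)
  qed
  define V where "V = - 2 * Y * g + P * (g * fps_deriv Y - 2 * Y * fps_deriv g)"
  have W: "P ^ 3 * W_fps F = q ^ 3 * V"
  proof -
    have "P ^ 3 * W_fps F = (P ^ 3 * fps_deriv (hirota F)) * F - 2 * (P\<^sup>2 * hirota F) * (P * fps_deriv F)"
      unfolding W_fps_def by (simp add: power3_eq_cube power2_eq_square algebra_simps)
    then show ?thesis
      unfolding X' X F' by (simp add: Fg V_def power3_eq_cube power2_eq_square algebra_simps)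
  qed
  define Z where "Z = fps_const b2 * Y\<^sup>2 * g\<^sup>2 + 2 * fps_const b4 * P\<^sup>2 * Y * g ^ 4 + fps_const b6 * P ^ 4 * g ^ 6"
  have "q ^ 6 * V\<^sup>2 = (P ^ 3 * W_fps F)\<^sup>2"
    unfolding W by algebra
  also have "\<dots> = P ^ 6 * (4 * hirota F ^ 3 + fps_const b2 * (hirota F)\<^sup>2 * F\<^sup>2
     + 2 * fps_const b4 * hirota F * F ^ 4 + fps_const b6 * F ^ 6)"
    using eq unfolding sigma_eq1_def by (simp add: power_mult_distrib flip: power_mult)
  also have "\<dots> = 4 * (P\<^sup>2 * hirota F) ^ 3 + fps_const b2 * (P\<^sup>2 * hirota F)\<^sup>2 * F\<^sup>2 * P\<^sup>2
     + 2 * fps_const b4 * (P\<^sup>2 * hirota F) * F ^ 4 * P ^ 4 + fps_const b6 * F ^ 6 * P ^ 6"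
    by algebra
  also have "\<dots> = q ^ 6 * (4 * Y ^ 3 + P\<^sup>2 * Z)"
    unfolding X unfolding Z_def Fg by algebra
  finally have "q ^ 6 * V\<^sup>2 = q ^ 6 * (4 * Y ^ 3 + P\<^sup>2 * Z)" .
  then have "V\<^sup>2 = 4 * Y ^ 3 + P\<^sup>2 * Z"
    using qnz by simp
  then have "V\<^sup>2 $ 0 = (4 * Y ^ 3 + P\<^sup>2 * Z) $ 0" by simp
  then have "(V $ 0)\<^sup>2 = 4 * (Y $ 0) ^ 3"
    by (simp add: fps_nth_power_0 P0)
  moreover have "Y $ 0 = of_nat n * (g $ 0)\<^sup>2"
    by (simp add: Y_def fps_nth_power_0 P0 fps_of_nat[symmetric])
  moreover have "V $ 0 = - 2 * Y $ 0 * g $ 0"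
    by (simp add: V_def P0)
  ultimately have "of_nat n ^ 2 * (4 * (g $ 0) ^ 6) = of_nat n ^ 3 * (4 * (g $ 0) ^ 6)"
    by (simp add: power_mult_distrib flip: power_mult power_add power_Suc)
  then have "(of_nat (n ^ 2) :: complex) = of_nat (n ^ 3)"
    using g0 by simp
  then have "n ^ 2 = n ^ 3" using of_nat_eq_iff by blast
  then have "n \<le> 1" by (cases "n = 0") (auto simp: power2_eq_square power3_eq_cube)
  then show ?thesis by (simp add: n_def)
qed

text \<open>For \<open>p = F\<^sup>2 / hirota F\<close>, that is 1/x, the equation becomes a regular
  one of second order with initial values p(0) = p'(0) = 0. Hence x is the same for all such
  F.\<close>

lemma sigma_eq1_zero_unique:
  assumes F: "sigma_eq1 b2 b4 b6 F" "F $ 0 = 0" "F $ 1 \<noteq> 0"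
    and G: "sigma_eq1 b2 b4 b6 G" "G $ 0 = 0" "G $ 1 \<noteq> 0"
  shows "hirota F * G\<^sup>2 = hirota G * F\<^sup>2"
proof -
  have ode: "\<exists>p. p * hirota F = F\<^sup>2 \<and> p $ 0 = 0 \<and> p $ 1 = 0 \<and>
      fps_deriv (fps_deriv p) = 2 + fps_const b2 * p + 3 * fps_const b4 * p\<^sup>2 + 2 * fps_const b6 * p ^ 3"
    if F: "sigma_eq1 b2 b4 b6 F" "F $ 0 = 0" "F $ 1 \<noteq> 0" for F
  proof -
    have X0: "hirota F $ 0 = (F $ 1)\<^sup>2"
      using F by (simp add: hirota_def fps_nth_power_0)
    then have X0nz: "hirota F $ 0 \<noteq> 0" using F by simp
    define p where "p = F\<^sup>2 * inverse (hirota F)"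
    have pX: "p * hirota F = F\<^sup>2"
      unfolding p_def by (simp add: mult.assoc inverse_mult_eq_1[OF X0nz])
    have Fnz: "F \<noteq> 0" and Xnz: "hirota F \<noteq> 0"
      using F X0nz by auto
    have p0: "p $ 0 = 0" "p $ 1 = 0"
      using F by (simp_all add: p_def fps_mult_nth power2_eq_square)
    have p2: "p $ 2 = 1"
    proof -
      have "(p * hirota F) $ 2 = (F\<^sup>2) $ 2" by (simp add: pX)
      then show ?thesis using p0 F X0 by (simp add: fps_mult_nth eval_nat_numeral)
    qed
    have p': "fps_deriv p \<noteq> 0"
    proof -
      have "fps_deriv p $ 1 = 2" using p2 by (simp add: numeral_2_eq_2)
      then show ?thesis by (metis fps_zero_nth zero_neq_numeral)
    qed
    have SW: "F * W_fps F = - ((hirota F)\<^sup>2 * fps_deriv p)"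
    proof -
      have "fps_deriv p * hirota F + p * fps_deriv (hirota F) = 2 * F * fps_deriv F"
        using arg_cong[OF pX, of fps_deriv] by (simp add: fps_deriv_power' algebra_simps)
      moreover have "F * W_fps F = F\<^sup>2 * fps_deriv (hirota F) - hirota F * (2 * F * fps_deriv F)"
        unfolding W_fps_def by algebra
      ultimately have "F * W_fps F = p * hirota F * fps_deriv (hirota F)
          - hirota F * (fps_deriv p * hirota F + p * fps_deriv (hirota F))"
        by (simp add: pX)
      then show ?thesis by (simp add: power2_eq_square algebra_simps)
    qed
    have "hirota F ^ 4 * (fps_deriv p)\<^sup>2 = (F * W_fps F)\<^sup>2"
      unfolding SW by algebra
    also have "\<dots> = F\<^sup>2 * (4 * hirota F ^ 3 + fps_const b2 * (hirota F)\<^sup>2 * F\<^sup>2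
       + 2 * fps_const b4 * hirota F * (F\<^sup>2)\<^sup>2 + fps_const b6 * (F\<^sup>2) ^ 3)"
      using F(1) by (simp add: sigma_eq1_def power_mult_distrib flip: power_mult)
    also have "\<dots> = hirota F ^ 4 * (4 * p + fps_const b2 * p\<^sup>2 + 2 * fps_const b4 * p ^ 3 + fps_const b6 * p ^ 4)"
      unfolding pX[symmetric] by algebra
    finally have p'_sq: "(fps_deriv p)\<^sup>2 = 4 * p + fps_const b2 * p\<^sup>2 + 2 * fps_const b4 * p ^ 3 + fps_const b6 * p ^ 4"
      using Xnz by simp
    have "2 * fps_deriv p * fps_deriv (fps_deriv p) = fps_deriv ((fps_deriv p)\<^sup>2)"
      by (simp add: fps_deriv_power')
    also have "\<dots> = 2 * fps_deriv p * (2 + fps_const b2 * p + 3 * fps_const b4 * p\<^sup>2 + 2 * fps_const b6 * p ^ 3)"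
      unfolding p'_sq by (simp add: fps_deriv_power' algebra_simps)
    finally have "fps_deriv (fps_deriv p) = 2 + fps_const b2 * p + 3 * fps_const b4 * p\<^sup>2 + 2 * fps_const b6 * p ^ 3"
      using p' by simp
    with pX p0 show ?thesis by blast
  qed
  obtain p where p: "p * hirota F = F\<^sup>2" "p $ 0 = 0" "p $ 1 = 0"
      "fps_deriv (fps_deriv p) = 2 + fps_const b2 * p + 3 * fps_const b4 * p\<^sup>2 + 2 * fps_const b6 * p ^ 3"
    using ode[OF F] by blast
  obtain q where q: "q * hirota G = G\<^sup>2" "q $ 0 = 0" "q $ 1 = 0"
      "fps_deriv (fps_deriv q) = 2 + fps_const b2 * q + 3 * fps_const b4 * q\<^sup>2 + 2 * fps_const b6 * q ^ 3"
    using ode[OF G] by blast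
  have "p = q"
  proof (rule fps_ode2_unique)
    show "causal (\<lambda>f. 2 + fps_const b2 * f () + 3 * fps_const b4 * (f ())\<^sup>2 + 2 * fps_const b6 * f () ^ 3)"
      by (intro causal_intros)
  qed (use p q in simp_all)
  then show ?thesis
    unfolding p(1)[symmetric] q(1)[symmetric] by simp
qed

text \<open>Where F does not vanish, x itself is regular and solves the second-order equation, with
  x(0) and x'(0) prescribed. The equation for \<open>x'\<^sup>2\<close> would not determine x at a
  point with x' = 0, where it also admits constants.\<close>

lemma sigma_eq2_unit_unique:
  assumes F: "sigma_eq2 b2 b4 F" "F $ 0 \<noteq> 0" and G: "sigma_eq2 b2 b4 G" "G $ 0 \<noteq> 0"
    and x: "hirota F $ 0 / (F $ 0)\<^sup>2 = hirota G $ 0 / (G $ 0)\<^sup>2"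
    and w: "W_fps F $ 0 / (F $ 0) ^ 3 = W_fps G $ 0 / (G $ 0) ^ 3"
  shows "hirota F * G\<^sup>2 = hirota G * F\<^sup>2"
proof -
  have ode: "\<exists>x. x * F\<^sup>2 = hirota F \<and> x $ 0 = hirota F $ 0 / (F $ 0)\<^sup>2 \<and> x $ 1 = W_fps F $ 0 / (F $ 0) ^ 3 \<and>
      fps_deriv (fps_deriv x) = 6 * x\<^sup>2 + fps_const b2 * x + fps_const b4"
    if F: "sigma_eq2 b2 b4 F" "F $ 0 \<noteq> 0" for F
  proof -
    define x where "x = hirota F * inverse (F\<^sup>2)"
    have Fnz: "F \<noteq> 0" using F(2) by auto
    have xF: "x * F\<^sup>2 = hirota F"
      unfolding x_def using F(2) by (simp add: mult.assoc inverse_mult_eq_1 fps_nth_power_0)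
    have X': "fps_deriv (hirota F) = fps_deriv x * F\<^sup>2 + x * (2 * F * fps_deriv F)"
      unfolding xF[symmetric] by (simp add: fps_deriv_power' algebra_simps)
    have x': "W_fps F = fps_deriv x * F ^ 3"
      unfolding W_fps_def X' unfolding xF[symmetric] by algebra
    have W': "fps_deriv (W_fps F) = fps_deriv (fps_deriv x) * F ^ 3 + fps_deriv x * (3 * F\<^sup>2 * fps_deriv F)"
      unfolding x' by (simp add: fps_deriv_power' algebra_simps)
    have "fps_deriv (fps_deriv x) * F ^ 4 = fps_deriv (W_fps F) * F - 3 * W_fps F * fps_deriv F"
      unfolding W' unfolding x' by algebra
    also have "\<dots> = 6 * (hirota F)\<^sup>2 + fps_const b2 * hirota F * F\<^sup>2 + fps_const b4 * F ^ 4"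
      using F(1) unfolding sigma_eq2_def .
    also have "\<dots> = (6 * x\<^sup>2 + fps_const b2 * x + fps_const b4) * F ^ 4"
      unfolding xF[symmetric] by algebra
    finally have x'': "fps_deriv (fps_deriv x) = 6 * x\<^sup>2 + fps_const b2 * x + fps_const b4"
      using Fnz by simp
    have "x $ 0 = hirota F $ 0 / (F $ 0)\<^sup>2"
      using arg_cong[OF xF, of "\<lambda>f. f $ 0"] F(2) by (simp add: fps_nth_power_0 eq_divide_eq)
    moreover have "x $ 1 = W_fps F $ 0 / (F $ 0) ^ 3"
      using arg_cong[OF x', of "\<lambda>f. f $ 0"] F(2) by (simp add: fps_nth_power_0 eq_divide_eq)
    ultimately show ?thesis using xF x'' by blast
  qed
  obtain p where p: "p * F\<^sup>2 = hirota F" "p $ 0 = hirota F $ 0 / (F $ 0)\<^sup>2" "p $ 1 = W_fps F $ 0 / (F $ 0) ^ 3"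
      "fps_deriv (fps_deriv p) = 6 * p\<^sup>2 + fps_const b2 * p + fps_const b4"
    using ode[OF F] by blast
  obtain q where q: "q * G\<^sup>2 = hirota G" "q $ 0 = hirota G $ 0 / (G $ 0)\<^sup>2" "q $ 1 = W_fps G $ 0 / (G $ 0) ^ 3"
      "fps_deriv (fps_deriv q) = 6 * q\<^sup>2 + fps_const b2 * q + fps_const b4"
    using ode[OF G] by blast
  have "p = q"
  proof (rule fps_ode2_unique)
    show "causal (\<lambda>f. 6 * (f ())\<^sup>2 + fps_const b2 * f () + fps_const b4)"
      by (intro causal_intros)
  qed (use p q x w in simp_all)
  then show ?thesis
    unfolding p(1)[symmetric] q(1)[symmetric] by simp
qed

section \<open>Entire solutions of the sigma equation\<close>

lemma entire_has_fps_expansion: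
  fixes f :: "complex \<Rightarrow> complex"
  assumes "f holomorphic_on UNIV"
  shows "(\<lambda>u. f (z + u)) has_fps_expansion fps_expansion f z"
  by (rule analytic_at_imp_has_fps_expansion) (metis analytic_at assms open_UNIV UNIV_I)

lemma entire_shift:
  fixes f :: "complex \<Rightarrow> complex"
  assumes "f holomorphic_on UNIV"
  shows "(\<lambda>u. f (c + u)) holomorphic_on UNIV"
  using holomorphic_on_compose_gen[of "\<lambda>u. c + u" UNIV f UNIV] assms
  by (simp add: o_def holomorphic_intros)

lemma entire_fps_expansion_eqI:
  "(\<lambda>u. f (z + u)) has_fps_expansion F \<Longrightarrow> fps_expansion f z = F" for f :: "complex \<Rightarrow> complex"
proof -
  assume "(\<lambda>u. f (z + u)) has_fps_expansion F"
  then have "fps_expansion (\<lambda>u. f (z + u)) 0 = F" by (rule fps_expansion_eqI)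
  moreover have "(deriv ^^ n) (\<lambda>u. f (z + u)) 0 = (deriv ^^ n) f z" for n
    by (subst (2) higher_deriv_shift_0) (simp add: o_def)
  ultimately show ?thesis by (simp add: fps_expansion_def)
qed

lemma fps_expansion_entire:
  fixes f g :: "complex \<Rightarrow> complex"
  assumes f: "f holomorphic_on UNIV" and g: "g holomorphic_on UNIV"
  shows "fps_expansion (\<lambda>u. f u + g u) z = fps_expansion f z + fps_expansion g z"
    and "fps_expansion (\<lambda>u. f u - g u) z = fps_expansion f z - fps_expansion g z"
    and "fps_expansion (\<lambda>u. f u * g u) z = fps_expansion f z * fps_expansion g z"
    and "fps_expansion (\<lambda>u. f u ^ n) z = fps_expansion f z ^ n"
    and "fps_expansion (\<lambda>u. c * f u) z = fps_const c * fps_expansion f z"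
    and "fps_expansion (deriv f) z = fps_deriv (fps_expansion f z)"
proof -
  note F = entire_has_fps_expansion[OF f, of z] and G = entire_has_fps_expansion[OF g, of z]
  show "fps_expansion (\<lambda>u. f u + g u) z = fps_expansion f z + fps_expansion g z"
    by (intro entire_fps_expansion_eqI has_fps_expansion_add F G)
  show "fps_expansion (\<lambda>u. f u - g u) z = fps_expansion f z - fps_expansion g z"
    by (intro entire_fps_expansion_eqI has_fps_expansion_diff F G)
  show "fps_expansion (\<lambda>u. f u * g u) z = fps_expansion f z * fps_expansion g z"
    by (intro entire_fps_expansion_eqI has_fps_expansion_mult F G)
  show "fps_expansion (\<lambda>u. f u ^ n) z = fps_expansion f z ^ n"
    by (intro entire_fps_expansion_eqI has_fps_expansion_power F)
  show "fps_expansion (\<lambda>u. c * f u) z = fps_const c * fps_expansion f z"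
    by (intro entire_fps_expansion_eqI has_fps_expansion_cmult_left F)
  show "fps_expansion (deriv f) z = fps_deriv (fps_expansion f z)"
    by (rule fps_ext) (simp add: fps_expansion_def funpow_swap1 fact_Suc field_simps del: of_nat_Suc)
qed

lemma fps_expansion_const_fun: "fps_expansion (\<lambda>_. c :: complex) z = fps_const c"
  by (rule entire_fps_expansion_eqI) (rule has_fps_expansion_const)

lemma fps_expansion_eq_imp_eq:
  fixes f g :: "complex \<Rightarrow> complex"
  assumes f: "f holomorphic_on UNIV" and g: "g holomorphic_on UNIV"
    and eq: "fps_expansion f z = fps_expansion g z"
  shows "f = g"
proof
  fix w
  have "fps_expansion (\<lambda>u. f u - g u) z = 0"
    using fps_expansion_entire(2)[OF f g] eq by simp
  then have "(\<lambda>u. f (z + u) - g (z + u)) has_fps_expansion 0"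
    using entire_has_fps_expansion[OF holomorphic_on_diff[OF f g], of z] by simp
  moreover have "(\<lambda>u. f (z + u) - g (z + u)) holomorphic_on UNIV"
    by (intro holomorphic_on_diff entire_shift f g)
  ultimately have "f (z + (w - z)) - g (z + (w - z)) = 0"
    by (rule has_fps_expansion_0_analytic_continuation[where A = UNIV]) auto
  then show "f w = g w" by simp
qed

lemma fps_expansion_nth_0: "fps_expansion f z $ 0 = f z"
  and fps_expansion_nth_1: "fps_expansion f z $ 1 = deriv f z"
  by (simp_all add: fps_expansion_def)

lemma fps_expansion_shift: "fps_expansion (\<lambda>u. f (c + u)) z = fps_expansion f (c + z)"
  for f :: "complex \<Rightarrow> complex"
proof (rule fps_ext)
  fix n
  have "(deriv ^^ n) (\<lambda>u. f (c + u)) z = (deriv ^^ n) ((\<lambda>u. f (c + u)) \<circ> (+) z) 0"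
    by (rule higher_deriv_shift_0)
  also have "(\<lambda>u. f (c + u)) \<circ> (+) z = f \<circ> (+) (c + z)"
    by (simp add: o_def add.assoc)
  also have "(deriv ^^ n) (f \<circ> (+) (c + z)) 0 = (deriv ^^ n) f (c + z)"
    by (rule higher_deriv_shift_0[symmetric])
  finally show "fps_expansion (\<lambda>u. f (c + u)) z $ n = fps_expansion f (c + z) $ n"
    by (simp add: fps_expansion_def)
qed

text \<open>The two equations are demanded at the origin only; they spread to all points in
  \<open>curve\<close> and \<open>curve_deriv\<close>.\<close>

locale sigma_function =
  fixes \<sigma> :: "complex \<Rightarrow> complex" and b2 b4 b6 :: complex
  assumes entire: "\<sigma> holomorphic_on UNIV"
    and odd: "\<sigma> (- u) = - \<sigma> u"
    and deriv_0: "deriv \<sigma> 0 = 1"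
    and eq1_0: "sigma_eq1 b2 b4 b6 (fps_expansion \<sigma> 0)"
    and eq2_0: "sigma_eq2 b2 b4 (fps_expansion \<sigma> 0)"
begin

definition "X u = (deriv \<sigma> u)\<^sup>2 - \<sigma> u * deriv (deriv \<sigma>) u"
definition "W u = deriv X u * \<sigma> u - 2 * X u * deriv \<sigma> u"
definition "x u = X u / (\<sigma> u)\<^sup>2"
definition "w u = W u / (\<sigma> u) ^ 3"
definition "\<zeta> u = deriv \<sigma> u / \<sigma> u"

lemma entire_deriv: "deriv \<sigma> holomorphic_on UNIV" "deriv (deriv \<sigma>) holomorphic_on UNIV"
  by (intro holomorphic_deriv entire; simp)+

lemma entire_X: "X holomorphic_on UNIV"
  unfolding X_def[abs_def] by (intro holomorphic_intros entire entire_deriv)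

lemma entire_deriv_X: "deriv X holomorphic_on UNIV"
  by (intro holomorphic_deriv entire_X) simp

lemma entire_W: "W holomorphic_on UNIV"
  unfolding W_def[abs_def] by (intro holomorphic_intros entire entire_deriv entire_X entire_deriv_X)

lemmas entires = entire entire_deriv entire_X entire_deriv_X entire_W

lemma fps_expansion_X: "fps_expansion X z = hirota (fps_expansion \<sigma> z)"
proof -
  have "fps_expansion X z = fps_expansion (\<lambda>u. (deriv \<sigma> u)\<^sup>2) z - fps_expansion (\<lambda>u. \<sigma> u * deriv (deriv \<sigma>) u) z"
    unfolding X_def[abs_def] by (intro fps_expansion_entire(2) holomorphic_intros entires)
  then show ?thesis
    by (simp add: hirota_def fps_expansion_entire(3,4,6)[of _ "\<lambda>_. 0"] fps_expansion_entire(3) entires)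
qed

lemma fps_expansion_W: "fps_expansion W z = W_fps (fps_expansion \<sigma> z)"
proof -
  have "fps_expansion W z = fps_expansion (\<lambda>u. deriv X u * \<sigma> u) z - fps_expansion (\<lambda>u. 2 * X u * deriv \<sigma> u) z"
    unfolding W_def[abs_def] by (intro fps_expansion_entire(2) holomorphic_intros entires)
  moreover have "fps_expansion (\<lambda>u. 2 * X u * deriv \<sigma> u) z = fps_expansion (\<lambda>u. 2 * X u) z * fps_expansion (deriv \<sigma>) z"
    by (intro fps_expansion_entire(3) holomorphic_intros entires)
  ultimately show ?thesis
    by (simp add: W_fps_def fps_expansion_entire(3) fps_expansion_entire(5,6)[of _ "\<lambda>_. 0"] fps_expansion_X entires
        fps_expansion_const_fun numeral_fps_const)
qed

lemma nth_0: "hirota (fps_expansion \<sigma> z) $ 0 = X z" "W_fps (fps_expansion \<sigma> z) $ 0 = W z"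
  by (simp_all flip: fps_expansion_X fps_expansion_W add: fps_expansion_nth_0)

lemma shifted_expansions:
  "(\<lambda>u. \<sigma> (z + u)) has_fps_expansion fps_expansion \<sigma> z"
  "(\<lambda>u. deriv \<sigma> (z + u)) has_fps_expansion fps_deriv (fps_expansion \<sigma> z)"
  "(\<lambda>u. X (z + u)) has_fps_expansion hirota (fps_expansion \<sigma> z)"
  "(\<lambda>u. W (z + u)) has_fps_expansion W_fps (fps_expansion \<sigma> z)"
  "(\<lambda>u. deriv W (z + u)) has_fps_expansion fps_deriv (W_fps (fps_expansion \<sigma> z))"
proof -
  have "deriv W holomorphic_on UNIV" by (intro holomorphic_deriv entire_W) simp
  then show "(\<lambda>u. \<sigma> (z + u)) has_fps_expansion fps_expansion \<sigma> z"
    "(\<lambda>u. deriv \<sigma> (z + u)) has_fps_expansion fps_deriv (fps_expansion \<sigma> z)"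
    "(\<lambda>u. X (z + u)) has_fps_expansion hirota (fps_expansion \<sigma> z)"
    "(\<lambda>u. W (z + u)) has_fps_expansion W_fps (fps_expansion \<sigma> z)"
    "(\<lambda>u. deriv W (z + u)) has_fps_expansion fps_deriv (W_fps (fps_expansion \<sigma> z))"
    using entires entire_has_fps_expansion fps_expansion_entire(6) fps_expansion_X fps_expansion_W by metis+
qed

text \<open>Both sides are entire and have the same expansion at 0, so they coincide. Expanding the
  identity at z gives the equation for the expansion of \<sigma> there.\<close>

lemma curve: "(W u)\<^sup>2 = 4 * X u ^ 3 + b2 * (X u)\<^sup>2 * (\<sigma> u)\<^sup>2 + 2 * b4 * X u * \<sigma> u ^ 4 + b6 * \<sigma> u ^ 6"
  and sigma_eq1: "sigma_eq1 b2 b4 b6 (fps_expansion \<sigma> z)"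
proof -
  define L R where "L = (\<lambda>u. W u ^ 2)"
    and "R = (\<lambda>u. 4 * X u ^ 3 + b2 * X u ^ 2 * \<sigma> u ^ 2 + 2 * b4 * X u * \<sigma> u ^ 4 + b6 * \<sigma> u ^ 6)"
  have hol: "L holomorphic_on UNIV" "R holomorphic_on UNIV"
    unfolding L_def R_def by (intro holomorphic_intros entires)+
  have iff: "sigma_eq1 b2 b4 b6 (fps_expansion \<sigma> z) \<longleftrightarrow> fps_expansion L z = fps_expansion R z" for z
  proof -
    let ?F = "fps_expansion \<sigma> z"
    have "fps_expansion L z = (W_fps ?F)\<^sup>2"
      unfolding L_def by (intro entire_fps_expansion_eqI fps_expansion_intros shifted_expansions)
    moreover have "fps_expansion R z = 4 * hirota ?F ^ 3 + fps_const b2 * (hirota ?F)\<^sup>2 * ?F\<^sup>2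
       + 2 * fps_const b4 * hirota ?F * ?F ^ 4 + fps_const b6 * ?F ^ 6"
      unfolding R_def by (intro entire_fps_expansion_eqI fps_expansion_intros shifted_expansions)
    ultimately show ?thesis by (simp add: sigma_eq1_def)
  qed
  have LR: "L = R"
    by (rule fps_expansion_eq_imp_eq[OF hol]) (use iff eq1_0 in blast)
  then show "sigma_eq1 b2 b4 b6 (fps_expansion \<sigma> z)"
    using iff by simp
  show "(W u)\<^sup>2 = 4 * X u ^ 3 + b2 * (X u)\<^sup>2 * (\<sigma> u)\<^sup>2 + 2 * b4 * X u * \<sigma> u ^ 4 + b6 * \<sigma> u ^ 6"
    using fun_cong[OF LR, of u] by (simp add: L_def R_def)
qed

lemma curve_deriv: "deriv W u * \<sigma> u - 3 * W u * deriv \<sigma> u = 6 * (X u)\<^sup>2 + b2 * X u * (\<sigma> u)\<^sup>2 + b4 * \<sigma> u ^ 4"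
  and sigma_eq2: "sigma_eq2 b2 b4 (fps_expansion \<sigma> z)"
proof -
  define L R where "L = (\<lambda>u. deriv W u * \<sigma> u - 3 * W u * deriv \<sigma> u)"
    and "R = (\<lambda>u. 6 * X u ^ 2 + b2 * X u * \<sigma> u ^ 2 + b4 * \<sigma> u ^ 4)"
  have hol: "L holomorphic_on UNIV" "R holomorphic_on UNIV"
    unfolding L_def R_def by (intro holomorphic_intros entires holomorphic_deriv entire_W; simp)+
  have iff: "sigma_eq2 b2 b4 (fps_expansion \<sigma> z) \<longleftrightarrow> fps_expansion L z = fps_expansion R z" for z
  proof -
    let ?F = "fps_expansion \<sigma> z"
    have "fps_expansion L z = fps_deriv (W_fps ?F) * ?F - 3 * W_fps ?F * fps_deriv ?F"
      unfolding L_def by (intro entire_fps_expansion_eqI fps_expansion_intros shifted_expansions)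
    moreover have "fps_expansion R z = 6 * (hirota ?F)\<^sup>2 + fps_const b2 * hirota ?F * ?F\<^sup>2 + fps_const b4 * ?F ^ 4"
      unfolding R_def by (intro entire_fps_expansion_eqI fps_expansion_intros shifted_expansions)
    ultimately show ?thesis by (simp add: sigma_eq2_def)
  qed
  have LR: "L = R"
    by (rule fps_expansion_eq_imp_eq[OF hol]) (use iff eq2_0 in blast)
  then show "sigma_eq2 b2 b4 (fps_expansion \<sigma> z)"
    using iff by simp
  show "deriv W u * \<sigma> u - 3 * W u * deriv \<sigma> u = 6 * (X u)\<^sup>2 + b2 * X u * (\<sigma> u)\<^sup>2 + b4 * \<sigma> u ^ 4"
    using fun_cong[OF LR, of u] by (simp add: L_def R_def)
qed

lemma sigma_0: "\<sigma> 0 = 0"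
  using odd[of 0] by simp

lemma fps_expansion_nonzero: "fps_expansion \<sigma> z \<noteq> 0"
proof
  assume "fps_expansion \<sigma> z = 0"
  moreover have "fps_expansion (\<lambda>_. 0) z = 0"
    by (simp add: fps_expansion_const_fun)
  ultimately have "\<sigma> = (\<lambda>_. 0)"
    by (intro fps_expansion_eq_imp_eq[OF entire, of _ z]) auto
  then show False using deriv_0 by simp
qed

lemma simple_zero:
  assumes "\<sigma> z = 0" shows "deriv \<sigma> z \<noteq> 0"
proof -
  let ?F = "fps_expansion \<sigma> z"
  have "subdegree ?F \<le> 1"
    by (rule sigma_eq1_subdegree[OF sigma_eq1 fps_expansion_nonzero])
  moreover have "subdegree ?F \<noteq> 0"
    using assms fps_expansion_nonzero by (simp add: subdegree_eq_0_iff fps_expansion_nth_0)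
  ultimately have "subdegree ?F = 1" by simp
  then have "?F $ 1 \<noteq> 0" using nth_subdegree_nonzero[OF fps_expansion_nonzero, of z] by simp
  then show ?thesis unfolding fps_expansion_nth_1 .
qed

lemma X_zero: "\<sigma> z = 0 \<Longrightarrow> X z = (deriv \<sigma> z)\<^sup>2" and W_zero: "\<sigma> z = 0 \<Longrightarrow> W z = - 2 * (deriv \<sigma> z) ^ 3"
  by (simp_all add: X_def W_def power2_eq_square power3_eq_cube)

lemma has_derivs:
  "(\<sigma> has_field_derivative deriv \<sigma> u) (at u)"
  "(deriv \<sigma> has_field_derivative deriv (deriv \<sigma>) u) (at u)"
  "(X has_field_derivative deriv X u) (at u)"
  "(W has_field_derivative deriv W u) (at u)"
  by (rule holomorphic_derivI[where S = UNIV]; simp add: entires)+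

lemma deriv_x:
  assumes "\<sigma> u \<noteq> 0" shows "(x has_field_derivative w u) (at u)"
  unfolding x_def[abs_def] using assms
  by (auto intro!: derivative_eq_intros has_derivs simp: w_def W_def)
     (simp add: divide_simps, algebra)

lemma deriv_w:
  assumes "\<sigma> u \<noteq> 0" shows "(w has_field_derivative 6 * (x u)\<^sup>2 + b2 * x u + b4) (at u)"
proof -
  have "(w has_field_derivative (deriv W u * \<sigma> u - 3 * W u * deriv \<sigma> u) / \<sigma> u ^ 4) (at u)"
    unfolding w_def[abs_def] using assms
    by (auto intro!: derivative_eq_intros has_derivs)
      (simp add: divide_simps eval_nat_numeral, algebra)
  also have "(deriv W u * \<sigma> u - 3 * W u * deriv \<sigma> u) / \<sigma> u ^ 4 = 6 * (x u)\<^sup>2 + b2 * x u + b4"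
    unfolding curve_deriv x_def using assms by (simp add: add_divide_distrib power_divide eval_nat_numeral)
  finally show ?thesis .
qed

lemma deriv_zeta:
  assumes "\<sigma> u \<noteq> 0" shows "(\<zeta> has_field_derivative - x u) (at u)"
  unfolding \<zeta>_def[abs_def] x_def X_def using assms
  by (auto intro!: derivative_eq_intros has_derivs simp: power2_eq_square algebra_simps diff_divide_distrib)

lemma curve_xw:
  assumes "\<sigma> u \<noteq> 0" shows "(w u)\<^sup>2 = 4 * x u ^ 3 + b2 * (x u)\<^sup>2 + 2 * b4 * x u + b6"
proof -
  have "(w u)\<^sup>2 = (W u)\<^sup>2 / \<sigma> u ^ 6"
    by (simp add: w_def power_divide flip: power_mult)
  then show ?thesis
    unfolding curve x_def using assms by (simp add: add_divide_distrib power_divide eval_nat_numeral mult_ac)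
qed

section \<open>Quasi-periods and the group of zeros\<close>

definition quasi_period :: "complex \<Rightarrow> complex \<Rightarrow> bool" where
  "quasi_period l a \<longleftrightarrow> (\<exists>c. c \<noteq> 0 \<and> (\<forall>u. \<sigma> (u + l) = c * exp (a * u) * \<sigma> u))"

text \<open>If x has the same germ at z0 and z1, the two expansions of \<sigma> differ by a factor c
  exp (a u). The identity theorem makes this global, and recentring from z0 to 0 only changes
  c.\<close>

lemma hirota_eq_imp_quasi_period:
  assumes eq: "hirota (fps_expansion \<sigma> z1) * (fps_expansion \<sigma> z0)\<^sup>2 = hirota (fps_expansion \<sigma> z0) * (fps_expansion \<sigma> z1)\<^sup>2"
    and r: "fps_expansion \<sigma> z1 = r * fps_expansion \<sigma> z0" "r $ 0 \<noteq> 0"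
  shows "\<exists>a. quasi_period (z1 - z0) a"
proof -
  define c a where "c = r $ 0" and "a = r $ 1 / r $ 0"
  have F: "fps_expansion \<sigma> z1 = fps_const c * fps_exp a * fps_expansion \<sigma> z0"
    using hirota_eq_imp_exp[OF eq r(1) fps_expansion_nonzero r(2)] r(1) by (simp add: c_def a_def)
  have "fps_expansion (\<lambda>u. c * exp (a * u) * \<sigma> (z0 + u)) 0 = fps_expansion \<sigma> z1"
    unfolding F by (rule fps_expansion_eqI)
      (intro has_fps_expansion_mult has_fps_expansion_cmult_left has_fps_expansion_exp entire_has_fps_expansion entire)
  moreover have "fps_expansion (\<lambda>u. \<sigma> (z1 + u)) 0 = fps_expansion \<sigma> z1"
    by (simp add: fps_expansion_shift)
  ultimately have "(\<lambda>u. \<sigma> (z1 + u)) = (\<lambda>u. c * exp (a * u) * \<sigma> (z0 + u))"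
    by (intro fps_expansion_eq_imp_eq[of _ _ 0] holomorphic_intros entire_shift entire) simp
  then have *: "\<sigma> (z1 + u) = c * exp (a * u) * \<sigma> (z0 + u)" for u by meson
  have "\<sigma> (u + (z1 - z0)) = c * exp (- a * z0) * exp (a * u) * \<sigma> u" for u
    using *[of "u - z0"] by (simp add: algebra_simps exp_diff exp_minus field_simps)
  moreover have "c * exp (- a * z0) \<noteq> 0" using r by (simp add: c_def)
  ultimately show ?thesis unfolding quasi_period_def by blast
qed

text \<open>At a zero the curve equation leaves no freedom for x, so the germ of x at l is that at
  0.\<close>

lemma zero_imp_quasi_period:
  assumes "\<sigma> l = 0" shows "\<exists>a. quasi_period l a"
proof -
  let ?F = "fps_expansion \<sigma> l" and ?G = "fps_expansion \<sigma> 0"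
  have F: "?F $ 0 = 0" "?F $ 1 \<noteq> 0" and G: "?G $ 0 = 0" "?G $ 1 \<noteq> 0"
    using assms simple_zero[OF assms] deriv_0 sigma_0 unfolding fps_expansion_nth_0 fps_expansion_nth_1 by auto
  define F1 G1 where "F1 = fps_shift 1 ?F" and "G1 = fps_shift 1 ?G"
  have FG: "?F = fps_X * F1" "?G = fps_X * G1"
    unfolding F1_def G1_def by (rule fps_ext, simp add: F G split: nat.split)+
  have nz: "F1 $ 0 \<noteq> 0" "G1 $ 0 \<noteq> 0" using F G by (simp_all add: F1_def G1_def)
  have "?F = (F1 * inverse G1) * ?G"
    using inverse_mult_eq_1[OF nz(2)] unfolding FG by (simp add: mult_ac)
  moreover have "(F1 * inverse G1) $ 0 \<noteq> 0" using nz by simp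
  ultimately have "\<exists>a. quasi_period (l - 0) a"
    by (rule hirota_eq_imp_quasi_period[OF sigma_eq1_zero_unique[OF sigma_eq1 F sigma_eq1 G]])
  then show ?thesis by simp
qed

lemma same_point_imp_quasi_period:
  assumes "\<sigma> u \<noteq> 0" "\<sigma> v \<noteq> 0" "x u = x v" "w u = w v"
  shows "\<exists>a. quasi_period (v - u) a"
proof -
  let ?F = "fps_expansion \<sigma> v" and ?G = "fps_expansion \<sigma> u"
  have nz: "?F $ 0 \<noteq> 0" "?G $ 0 \<noteq> 0" using assms by (simp_all add: fps_expansion_nth_0)
  have "?F = (?F * inverse ?G) * ?G"
    using inverse_mult_eq_1[OF nz(2)] by (simp add: mult.assoc)
  moreover have "(?F * inverse ?G) $ 0 \<noteq> 0" using nz by simp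
  moreover have "hirota ?F * ?G\<^sup>2 = hirota ?G * ?F\<^sup>2"
    by (rule sigma_eq2_unit_unique[OF sigma_eq2 nz(1) sigma_eq2 nz(2)])
      (use assms in \<open>simp_all add: nth_0 fps_expansion_nth_0 x_def w_def\<close>)
  ultimately show ?thesis
    using hirota_eq_imp_quasi_period by blast
qed

lemma quasi_period_zero: "quasi_period l a \<Longrightarrow> \<sigma> l = 0"
  unfolding quasi_period_def using sigma_0 by (metis add.left_neutral mult_zero_right)

lemma quasi_period_zero_iff: "quasi_period l a \<Longrightarrow> \<sigma> (u + l) = 0 \<longleftrightarrow> \<sigma> u = 0"
  unfolding quasi_period_def by auto

text \<open>The factor E has vanishing \<open>hirota\<close>, so X and W are multiplied by
  \<open>E\<^sup>2\<close> and \<open>E\<^sup>3\<close>, the same powers as the denominators of x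
  and w. The logarithmic derivative gains that of E, which is a.\<close>

lemma quasi_period_invariant:
  assumes "quasi_period l a"
  shows "x (u + l) = x u" "w (u + l) = w u"
    and "\<sigma> u \<noteq> 0 \<Longrightarrow> \<zeta> (u + l) = \<zeta> u + a"
proof -
  obtain c where c: "c \<noteq> 0" "\<And>u. \<sigma> (u + l) = c * exp (a * u) * \<sigma> u"
    using assms unfolding quasi_period_def by blast
  define d where "d = c * exp (a * u)"
  have d: "d \<noteq> 0" using c by (simp add: d_def)
  define E where "E = fps_const d * fps_exp a"
  have E': "fps_deriv E = fps_const a * E"
    by (simp add: E_def)
  have E0: "E $ 0 = d" by (simp add: E_def)
  have "(\<lambda>v. \<sigma> ((u + l) + v)) = (\<lambda>v. d * exp (a * v) * \<sigma> (u + v))"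
  proof
    fix v
    show "\<sigma> ((u + l) + v) = d * exp (a * v) * \<sigma> (u + v)"
      using c(2)[of "u + v"] by (simp add: d_def ring_distribs exp_add mult_ac add_ac)
  qed
  then have F: "fps_expansion \<sigma> (u + l) = E * fps_expansion \<sigma> u"
    unfolding E_def
    by (intro entire_fps_expansion_eqI) (simp add: has_fps_expansion_mult has_fps_expansion_cmult_left
        has_fps_expansion_exp entire_has_fps_expansion entire)
  let ?F = "fps_expansion \<sigma> u"
  have "hirota E = 0" unfolding hirota_def by (simp add: E' power2_eq_square)
  then have H: "hirota (E * ?F) = E\<^sup>2 * hirota ?F" by (simp add: hirota_mult)
  have "W_fps (E * ?F) = E ^ 3 * W_fps ?F"
    unfolding W_fps_def H by (simp add: fps_deriv_power' E' power2_eq_square power3_eq_cube algebra_simps)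
  then have "W (u + l) = d ^ 3 * W u"
    using nth_0(2)[of "u + l"] nth_0(2)[of u] E0 by (simp add: F fps_nth_power_0)
  moreover have "X (u + l) = d\<^sup>2 * X u"
    using nth_0(1)[of "u + l"] nth_0(1)[of u] E0 H by (simp add: F fps_nth_power_0)
  moreover have s: "\<sigma> (u + l) = d * \<sigma> u" by (simp add: c d_def)
  ultimately show "x (u + l) = x u" "w (u + l) = w u"
    using d by (simp_all add: x_def w_def power_mult_distrib)
  have "deriv \<sigma> (u + l) = d * (deriv \<sigma> u + a * \<sigma> u)"
    using arg_cong[OF F, of "\<lambda>F. fps_deriv F $ 0"] E0 E'
    by (simp add: fps_expansion_nth_0 fps_expansion_nth_1[simplified] algebra_simps)
  then show "\<zeta> (u + l) = \<zeta> u + a" if "\<sigma> u \<noteq> 0"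
    using that d s by (simp add: \<zeta>_def field_simps)
qed

lemma zeros_diff: "\<sigma> u = 0 \<Longrightarrow> \<sigma> v = 0 \<Longrightarrow> \<sigma> (u - v) = 0"
  by (metis diff_add_cancel quasi_period_zero_iff zero_imp_quasi_period)

lemma zeros_add: "\<sigma> u = 0 \<Longrightarrow> \<sigma> v = 0 \<Longrightarrow> \<sigma> (u + v) = 0"
  by (metis quasi_period_zero_iff zero_imp_quasi_period)

lemma zero_shift_invariant:
  assumes "\<sigma> l = 0"
  shows "x (u + l) = x u" "w (u + l) = w u" "\<sigma> (u + l) = 0 \<longleftrightarrow> \<sigma> u = 0"
  using quasi_period_invariant quasi_period_zero_iff zero_imp_quasi_period[OF assms] by blast+

lemma same_point_iff:
  assumes "\<sigma> u \<noteq> 0" "\<sigma> v \<noteq> 0"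
  shows "x u = x v \<and> w u = w v \<longleftrightarrow> \<sigma> (v - u) = 0"
proof
  assume "x u = x v \<and> w u = w v"
  then show "\<sigma> (v - u) = 0"
    using same_point_imp_quasi_period[OF assms] quasi_period_zero by blast
next
  assume "\<sigma> (v - u) = 0"
  from zero_shift_invariant(1,2)[OF this, of u] show "x u = x v \<and> w u = w v" by simp
qed

lemma parity: "x (- u) = x u" "w (- u) = - w u"
proof -
  have d: "deriv f (- u) = - c * deriv f u"
    if "f holomorphic_on UNIV" "\<And>u. f (- u) = c * f u" for f :: "complex \<Rightarrow> complex" and c u
  proof -
    have "((\<lambda>u. f (- u)) has_field_derivative deriv f (- u) * (- 1)) (at u)"
      by (rule DERIV_chain2[OF holomorphic_derivI[OF that(1)]]) (auto intro!: derivative_eq_intros)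
    moreover have "((\<lambda>u. f (- u)) has_field_derivative c * deriv f u) (at u)"
      unfolding that(2) by (rule DERIV_cmult[OF holomorphic_derivI[OF that(1)]]) auto
    ultimately have "deriv f (- u) * (- 1) = c * deriv f u" by (rule DERIV_unique)
    then show ?thesis by (metis minus_mult_left minus_minus mult.commute mult_1 mult_minus1)
  qed
  have d1: "deriv \<sigma> (- u) = deriv \<sigma> u" for u using d[OF entire, of "-1" u] odd by simp
  have d2: "deriv (deriv \<sigma>) (- u) = - deriv (deriv \<sigma>) u" for u using d[OF entire_deriv(1), of 1 u] d1 by simp
  have X: "X (- u) = X u" for u by (simp add: X_def odd d1 d2)
  have X': "deriv X (- u) = - deriv X u" for u using d[OF entire_X, of 1 u] X by simp
  have W: "W (- u) = W u" by (simp add: W_def X X' odd d1)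
  show "x (- u) = x u" "w (- u) = - w u"
    by (simp_all add: x_def w_def X W odd)
qed

text \<open>Isolation of 0 is enough: the zeros form a group, so any two of them are at least
  \<delta> apart.\<close>

lemma zeros_isolated: "\<exists>\<delta>>0. \<forall>l. \<sigma> l = 0 \<longrightarrow> norm l < \<delta> \<longrightarrow> l = 0"
proof -
  obtain r where r: "r > 0" "inj_on \<sigma> (ball 0 r)"
    using has_complex_derivative_locally_injective[OF entire, of 0] deriv_0 by auto
  show ?thesis
  proof (intro exI[of _ r] conjI allI impI)
    fix l assume "\<sigma> l = 0" "norm l < r"
    then show "l = 0" using inj_onD[OF r(2), of l 0] sigma_0 r(1) by simp
  qed (use r in simp)
qed

end

section \<open>The parametrisation is a covering map\<close>

lemma elliptic_ode_unique:
  fixes f g f1 g1 :: "complex \<Rightarrow> complex"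
  assumes A: "open A" "0 \<in> A"
    and f: "\<And>s. s \<in> A \<Longrightarrow> (f has_field_derivative f1 s) (at s)"
      "\<And>s. s \<in> A \<Longrightarrow> (f1 has_field_derivative 6 * (f s)\<^sup>2 + b2 * f s + b4) (at s)"
    and g: "\<And>s. s \<in> A \<Longrightarrow> (g has_field_derivative g1 s) (at s)"
      "\<And>s. s \<in> A \<Longrightarrow> (g1 has_field_derivative 6 * (g s)\<^sup>2 + b2 * g s + b4) (at s)"
    and init: "f 0 = g 0" "f1 0 = g1 0"
  shows "eventually (\<lambda>s. f s = g s) (nhds 0)"
proof -
  have expansion: "f has_fps_expansion fps_expansion f 0 \<and> fps_expansion f 0 $ 1 = f1 0 \<and>
      fps_deriv (fps_deriv (fps_expansion f 0))
        = 6 * (fps_expansion f 0)\<^sup>2 + fps_const b2 * fps_expansion f 0 + fps_const b4"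
    if f: "\<And>s. s \<in> A \<Longrightarrow> (f has_field_derivative f1 s) (at s)"
      "\<And>s. s \<in> A \<Longrightarrow> (f1 has_field_derivative 6 * (f s)\<^sup>2 + b2 * f s + b4) (at s)" for f f1 :: "complex \<Rightarrow> complex"
  proof -
    have hol: "f holomorphic_on A" "f1 holomorphic_on A"
      using f A(1) by (meson holomorphic_on_open)+
    have F: "f has_fps_expansion fps_expansion f 0"
      by (rule has_fps_expansion_fps_expansion[OF A hol(1)])
    have d: "eventually (\<lambda>s. deriv f s = f1 s) (nhds 0)"
      "eventually (\<lambda>s. deriv f1 s = 6 * (f s)\<^sup>2 + b2 * f s + b4) (nhds 0)"
      using f A by (auto simp: eventually_nhds DERIV_imp_deriv intro!: exI[of _ A])
    have "deriv f has_fps_expansion fps_deriv (fps_expansion f 0)"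
      by (rule has_fps_expansion_deriv[OF F])
    then have f1: "f1 has_fps_expansion fps_deriv (fps_expansion f 0)"
      using has_fps_expansion_cong[OF d(1) refl] by blast
    have "deriv f1 has_fps_expansion fps_deriv (fps_deriv (fps_expansion f 0))"
      by (rule has_fps_expansion_deriv[OF f1])
    then have "(\<lambda>s. 6 * (f s)\<^sup>2 + b2 * f s + b4) has_fps_expansion fps_deriv (fps_deriv (fps_expansion f 0))"
      using has_fps_expansion_cong[OF d(2) refl] by blast
    moreover have "(\<lambda>s. 6 * (f s)\<^sup>2 + b2 * f s + b4) has_fps_expansion
        6 * (fps_expansion f 0)\<^sup>2 + fps_const b2 * fps_expansion f 0 + fps_const b4"
      by (intro fps_expansion_intros F)
    ultimately have "fps_deriv (fps_deriv (fps_expansion f 0))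
        = 6 * (fps_expansion f 0)\<^sup>2 + fps_const b2 * fps_expansion f 0 + fps_const b4"
      by (rule fps_expansion_unique_complex)
    moreover have "fps_expansion f 0 $ 1 = f1 0"
      using eventually_nhds_x_imp_x[OF d(1)] by (simp add: fps_expansion_def)
    ultimately show ?thesis using F by blast
  qed
  have "fps_expansion f 0 = fps_expansion g 0"
  proof (rule fps_ode2_unique)
    show "causal (\<lambda>f. 6 * (f ())\<^sup>2 + fps_const b2 * f () + fps_const b4)"
      by (intro causal_intros)
  qed (use expansion[OF f] expansion[OF g] init in \<open>auto simp: fps_expansion_nth_0\<close>)
  then have "(\<lambda>s. f s - g s) has_fps_expansion 0"
    using has_fps_expansion_diff[of f "fps_expansion f 0" g "fps_expansion f 0"] expansion[OF f] expansion[OF g]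
    by simp
  then show ?thesis
    unfolding has_fps_expansion_0_iff by simp
qed

locale sigma_curve = sigma_function +
  assumes nonsingular: "4 * a ^ 3 + b2 * a\<^sup>2 + 2 * b4 * a + b6 = 0 \<Longrightarrow> 6 * a\<^sup>2 + b2 * a + b4 \<noteq> 0"
begin

text \<open>The solution is built without \<sigma>. The first-order equation is a first integral of
  the second-order one. A constant solution would force w0 = 0 together with
  \<open>6 x0\<^sup>2 + b2 x0 + b4 = 0\<close>, which is excluded by nonsingularity.\<close>

lemma local_solution:
  assumes "w0\<^sup>2 = 4 * x0 ^ 3 + b2 * x0\<^sup>2 + 2 * b4 * x0 + b6"
  obtains r \<xi> \<eta> where "r > 0" "\<xi> 0 = x0" "\<xi> holomorphic_on ball 0 r" "\<not> \<xi> constant_on ball 0 r"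
    "\<And>s. s \<in> ball 0 r \<Longrightarrow> (\<xi> has_field_derivative \<eta> s) (at s)"
    "\<And>s. s \<in> ball 0 r \<Longrightarrow> (\<eta> has_field_derivative 6 * (\<xi> s)\<^sup>2 + b2 * \<xi> s + b4) (at s)"
    "\<And>s. s \<in> ball 0 r \<Longrightarrow> (\<eta> s)\<^sup>2 = 4 * \<xi> s ^ 3 + b2 * (\<xi> s)\<^sup>2 + 2 * b4 * \<xi> s + b6"
proof -
  define \<Phi> :: "bool \<Rightarrow> (bool \<Rightarrow> complex fps) \<Rightarrow> complex fps" where
    "\<Phi> i = (if i then (\<lambda>f. f False) else (\<lambda>f. 6 * (f True)\<^sup>2 + fps_const b2 * f True + fps_const b4))" for i
  have "causal (\<Phi> i)" for i
    unfolding \<Phi>_def by (auto intro!: causal_intros)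
  moreover have "of_nat (Suc n) * (1 / of_nat (Suc n)) = (1::complex)" for n
    by (simp del: of_nat_Suc)
  ultimately obtain f where f: "\<And>i. fps_deriv (f i) = \<Phi> i f" "\<And>i. f i $ 0 = (if i then x0 else w0)"
    using fps_ode_exists[of "\<lambda>n. 1 / of_nat (Suc n)" \<Phi> "\<lambda>i. if i then x0 else w0"] by blast
  define F G where "F = f True" and "G = f False"
  have F': "fps_deriv F = G" and G': "fps_deriv G = 6 * F\<^sup>2 + fps_const b2 * F + fps_const b4"
    and init: "F $ 0 = x0" "G $ 0 = w0"
    by (simp_all add: F_def G_def f \<Phi>_def)
  have "fps_conv_radius (f i) > 0" for i
  proof (rule fps_ode_converges[of UNIV f "1 + norm x0 + norm w0" i])
    fix i
    show "norm (f i $ 0) \<le> 1 + norm x0 + norm w0" by (simp add: f)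
    show "tame (1 + norm x0 + norm w0) UNIV f (fps_deriv (f i))"
      unfolding f \<Phi>_def by (cases i) (auto intro!: tame_intros tame_proj)
  qed (auto intro: add_pos_nonneg simp: add.assoc)
  then have "min (fps_conv_radius F) (fps_conv_radius G) > 0" by (simp add: F_def G_def)
  then obtain r where r: "r > 0" "ereal r < fps_conv_radius F" "ereal r < fps_conv_radius G"
    by (metis ereal_dense2 ereal_less(2) min_less_iff_conj)
  define \<xi> \<eta> where "\<xi> = eval_fps F" and "\<eta> = eval_fps G"
  have in_r: "ereal (norm s) < fps_conv_radius F" "ereal (norm s) < fps_conv_radius G" if "s \<in> ball 0 r" for s
    using that r less_trans[of "ereal (norm s)" "ereal r"] by auto
  have xi': "(\<xi> has_field_derivative \<eta> s) (at s)" if "s \<in> ball 0 r" for s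
    unfolding \<xi>_def \<eta>_def F'[symmetric] by (rule has_field_derivative_eval_fps) (use in_r[OF that] in simp)
  have GF: "G\<^sup>2 = 4 * F ^ 3 + fps_const b2 * F\<^sup>2 + 2 * fps_const b4 * F + fps_const b6"
  proof -
    have "fps_deriv (G\<^sup>2 - (4 * F ^ 3 + fps_const b2 * F\<^sup>2 + 2 * fps_const b4 * F)) = 0"
      by (simp add: fps_deriv_power' F' G' algebra_simps)
    then have "G\<^sup>2 - (4 * F ^ 3 + fps_const b2 * F\<^sup>2 + 2 * fps_const b4 * F)
      = fps_const ((G\<^sup>2 - (4 * F ^ 3 + fps_const b2 * F\<^sup>2 + 2 * fps_const b4 * F)) $ 0)"
      by (rule fps_deriv_eq_0_const)
    also have "(G\<^sup>2 - (4 * F ^ 3 + fps_const b2 * F\<^sup>2 + 2 * fps_const b4 * F)) $ 0 = b6"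
      using assms by (simp add: fps_nth_power_0 init)
    finally show ?thesis by (simp add: algebra_simps)
  qed
  have eventually_r: "eventually (\<lambda>s. s \<in> ball 0 r) (nhds 0)"
    using r by (intro eventually_nhds_in_open) auto
  have radii: "fps_conv_radius F > 0" "fps_conv_radius G > 0"
    using r by (metis ereal_less(2) less_trans)+
  have E: "\<xi> has_fps_expansion F" "\<eta> has_fps_expansion G"
    unfolding \<xi>_def \<eta>_def using radii by (auto intro: eval_fps_has_fps_expansion)
  have hol: "\<xi> holomorphic_on ball 0 r" "\<eta> holomorphic_on ball 0 r"
    unfolding \<xi>_def \<eta>_def using in_r by (auto intro!: holomorphic_on_eval_fps)
  have eta': "(\<eta> has_field_derivative 6 * (\<xi> s)\<^sup>2 + b2 * \<xi> s + b4) (at s)"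
    and eta_sq: "(\<eta> s)\<^sup>2 = 4 * \<xi> s ^ 3 + b2 * (\<xi> s)\<^sup>2 + 2 * b4 * \<xi> s + b6" if s: "s \<in> ball 0 r" for s
  proof -
    have "(\<lambda>s. deriv \<eta> s - (6 * (\<xi> s)\<^sup>2 + b2 * \<xi> s + b4)) has_fps_expansion
        fps_deriv G - (6 * F\<^sup>2 + fps_const b2 * F + fps_const b4)"
      by (intro fps_expansion_intros E)
    then have "deriv \<eta> s - (6 * (\<xi> s)\<^sup>2 + b2 * \<xi> s + b4) = 0"
      unfolding G' diff_self
      by (rule has_fps_expansion_0_analytic_continuation[where A = "ball 0 r"])
        (use s r in \<open>auto intro!: holomorphic_intros hol holomorphic_deriv\<close>)
    then show "(\<eta> has_field_derivative 6 * (\<xi> s)\<^sup>2 + b2 * \<xi> s + b4) (at s)"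
      using holomorphic_derivI[OF hol(2) open_ball s] by simp
    have "(\<lambda>s. (\<eta> s)\<^sup>2 - (4 * \<xi> s ^ 3 + b2 * (\<xi> s)\<^sup>2 + 2 * b4 * \<xi> s + b6)) has_fps_expansion
        G\<^sup>2 - (4 * F ^ 3 + fps_const b2 * F\<^sup>2 + 2 * fps_const b4 * F + fps_const b6)"
      by (intro fps_expansion_intros E)
    then have "(\<eta> s)\<^sup>2 - (4 * \<xi> s ^ 3 + b2 * (\<xi> s)\<^sup>2 + 2 * b4 * \<xi> s + b6) = 0"
      unfolding GF diff_self
      by (rule has_fps_expansion_0_analytic_continuation[where A = "ball 0 r"])
        (use s r in \<open>auto intro!: holomorphic_intros hol\<close>)
    then show "(\<eta> s)\<^sup>2 = 4 * \<xi> s ^ 3 + b2 * (\<xi> s)\<^sup>2 + 2 * b4 * \<xi> s + b6" by simp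
  qed
  have xi0: "\<xi> 0 = x0" "\<eta> 0 = w0" by (simp_all add: \<xi>_def \<eta>_def eval_fps_at_0 init)
  have "\<not> \<xi> constant_on ball 0 r"
  proof
    assume "\<xi> constant_on ball 0 r"
    then obtain c where c: "\<And>s. s \<in> ball 0 r \<Longrightarrow> \<xi> s = c" unfolding constant_on_def by blast
    have eta0: "\<eta> s = 0" if s: "s \<in> ball 0 r" for s
    proof -
      have "(\<xi> has_field_derivative 0) (at s)"
        using has_field_derivative_transform_within_open[of "\<lambda>_. c" 0 s "ball 0 r" \<xi>] s c by simp
      then show ?thesis using xi'[OF s] DERIV_unique by blast
    qed
    have "(\<eta> has_field_derivative 0) (at 0)"
      using has_field_derivative_transform_within_open[of "\<lambda>_. 0" 0 0 "ball 0 r" \<eta>] r eta0 by simp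
    moreover have "(\<eta> has_field_derivative 6 * x0\<^sup>2 + b2 * x0 + b4) (at 0)"
      using eta'[of 0] r xi0 by simp
    ultimately have "6 * x0\<^sup>2 + b2 * x0 + b4 = 0" by (metis DERIV_unique)
    moreover have "w0 = 0" using eta0[of 0] xi0 r by simp
    ultimately show False using nonsingular[of x0] assms by simp
  qed
  then show ?thesis using that[of r \<xi> \<eta>] r xi' eta' eta_sq xi0 hol by blast
qed

lemma nonzero_X: "\<sigma> u = 0 \<Longrightarrow> X u \<noteq> 0"
  using simple_zero X_zero by simp

text \<open>Suppose x0 is omitted, and let \<xi> be the local solution through x0. If x took a value
  \<xi> t, it would agree near some point with a translate of \<xi>, and continuation back to the
  parameter 0 would reach x0. So x omits a whole neighbourhood of x0, whence 1/(x - x0) is bounded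
  and Liouville's theorem applies.\<close>

lemma x_surj: "\<exists>u. \<sigma> u \<noteq> 0 \<and> x u = x0"
proof (rule ccontr)
  assume contra: "\<nexists>u. \<sigma> u \<noteq> 0 \<and> x u = x0"
  define w0 where "w0 = csqrt (4 * x0 ^ 3 + b2 * x0\<^sup>2 + 2 * b4 * x0 + b6)"
  obtain r \<xi> \<eta> where r: "r > 0" and xi0: "\<xi> 0 = x0" and hol: "\<xi> holomorphic_on ball 0 r"
    and nc: "\<not> \<xi> constant_on ball 0 r"
    and xi': "\<And>s. s \<in> ball 0 r \<Longrightarrow> (\<xi> has_field_derivative \<eta> s) (at s)"
    and eta': "\<And>s. s \<in> ball 0 r \<Longrightarrow> (\<eta> has_field_derivative 6 * (\<xi> s)\<^sup>2 + b2 * \<xi> s + b4) (at s)"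
    and eta_sq: "\<And>s. s \<in> ball 0 r \<Longrightarrow> (\<eta> s)\<^sup>2 = 4 * \<xi> s ^ 3 + b2 * (\<xi> s)\<^sup>2 + 2 * b4 * \<xi> s + b6"
    by (rule local_solution[of w0 x0]) (auto simp: w0_def)
  have omit: "x u \<noteq> \<xi> t" if t: "t \<in> ball 0 r" and u: "\<sigma> u \<noteq> 0" for u t
  proof
    assume xu: "x u = \<xi> t"
    have "(w u)\<^sup>2 = (\<eta> t)\<^sup>2" using curve_xw[OF u] eta_sq[OF t] xu by simp
    \<comment> \<open>The sign of w is adjusted by replacing u by -u.\<close>
    then have "w u = \<eta> t \<or> w (- u) = \<eta> t" using parity by (auto simp: power2_eq_iff)
    then obtain v where v: "\<sigma> v \<noteq> 0" "x v = \<xi> t" "w v = \<eta> t"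
      using u xu parity odd[of u] by (metis neg_equal_0_iff_equal)
    have "isCont \<sigma> v"
      using has_derivs(1) DERIV_isCont by blast
    then obtain d where d: "d > 0" "\<And>s. dist v s < d \<Longrightarrow> \<sigma> s \<noteq> 0"
      using continuous_at_avoid[of v \<sigma> 0] v by blast
    define A where "A = ball 0 d \<inter> ball (- t) r"
    have A: "open A" "0 \<in> A" using d t by (auto simp: A_def dist_norm)
    have "eventually (\<lambda>s. x (v + s) = \<xi> (t + s)) (nhds 0)"
    proof (rule elliptic_ode_unique[OF A])
      fix s assume s: "s \<in> A"
      then have nz: "\<sigma> (v + s) \<noteq> 0" and ts: "t + s \<in> ball 0 r"
        using d by (auto simp: A_def dist_norm norm_minus_commute add.commute)
      show "((\<lambda>s. x (v + s)) has_field_derivative w (v + s)) (at s)"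
        using deriv_x[OF nz] DERIV_shift[of x _ s v] by (simp add: add.commute)
      show "((\<lambda>s. w (v + s)) has_field_derivative 6 * (x (v + s))\<^sup>2 + b2 * x (v + s) + b4) (at s)"
        using deriv_w[OF nz] DERIV_shift[of w _ s v] by (simp add: add.commute)
      show "((\<lambda>s. \<xi> (t + s)) has_field_derivative \<eta> (t + s)) (at s)"
        using xi'[OF ts] DERIV_shift[of \<xi> _ s t] by (simp add: add.commute)
      show "((\<lambda>s. \<eta> (t + s)) has_field_derivative 6 * (\<xi> (t + s))\<^sup>2 + b2 * \<xi> (t + s) + b4) (at s)"
        using eta'[OF ts] DERIV_shift[of \<eta> _ s t] by (simp add: add.commute)
    qed (use v in auto)
    moreover have "eventually (\<lambda>s. s \<in> ball 0 d) (nhds 0)"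
      using d by (intro eventually_nhds_in_open) auto
    \<comment> \<open>The identity x = \<xi> is continued without denominators, as x may have poles
      along the way. At s = -t it reads \<open>X = x0 \<sigma>\<^sup>2\<close>, which excludes a
      zero of \<sigma> because X and \<sigma> have no common zero.\<close>
    ultimately have "eventually (\<lambda>s. X (v + s) - \<xi> (t + s) * (\<sigma> (v + s))\<^sup>2 = 0) (nhds 0)"
    proof eventually_elim
      case (elim s)
      then have "\<sigma> (v + s) \<noteq> 0" using d(2)[of "v + s"] by (simp add: dist_norm)
      then show ?case using elim by (simp add: x_def divide_eq_eq)
    qed
    then have "(\<lambda>s. X (v + s) - \<xi> (t + s) * (\<sigma> (v + s))\<^sup>2) has_fps_expansion 0"
      unfolding has_fps_expansion_0_iff .
    then have "X (v + (- t)) - \<xi> (t + (- t)) * (\<sigma> (v + (- t)))\<^sup>2 = 0"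
    proof (rule has_fps_expansion_0_analytic_continuation[where A = "ball (- t) r"])
      have "(\<lambda>s. \<xi> (t + s)) holomorphic_on ball (- t) r"
      proof (rule holomorphic_on_compose_gen[of "\<lambda>s. t + s" _ \<xi> "ball 0 r", unfolded o_def])
        have "norm (t + s) = dist (- t) s" for s
          using norm_minus_cancel[of "t + s"] by (simp add: dist_norm del: norm_minus_cancel)
        then show "(+) t ` ball (- t) r \<subseteq> ball 0 r" by auto
      qed (auto intro!: holomorphic_intros hol)
      then show "(\<lambda>s. X (v + s) - \<xi> (t + s) * (\<sigma> (v + s))\<^sup>2) holomorphic_on ball (- t) r"
        by (intro holomorphic_intros holomorphic_on_subset[OF entire_shift[OF entire_X]]
            holomorphic_on_subset[OF entire_shift[OF entire]]) auto
    qed (use t r in auto)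
    then have eq: "X (v - t) = x0 * (\<sigma> (v - t))\<^sup>2" using xi0 by simp
    then have "\<sigma> (v - t) \<noteq> 0" using nonzero_X by fastforce
    moreover from this eq have "x (v - t) = x0" by (simp add: x_def)
    ultimately show False using contra by blast
  qed
  have "open (\<xi> ` ball 0 r)"
    by (rule open_mapping_thm[OF hol open_ball _ open_ball order_refl nc]) auto
  moreover have "x0 \<in> \<xi> ` ball 0 r" using xi0 r by (intro image_eqI[of _ _ 0]) auto
  ultimately obtain e where e: "e > 0" "ball x0 e \<subseteq> \<xi> ` ball 0 r"
    using open_contains_ball by blast
  have nz: "X u - x0 * (\<sigma> u)\<^sup>2 \<noteq> 0" for u
    using contra nonzero_X[of u] by (cases "\<sigma> u = 0") (auto simp: x_def divide_eq_eq)
  \<comment> \<open>This is 1/(x - x0), extended by 0 over the poles of x.\<close>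
  define g where "g u = (\<sigma> u)\<^sup>2 / (X u - x0 * (\<sigma> u)\<^sup>2)" for u
  have "g holomorphic_on UNIV"
    unfolding g_def using nz by (intro holomorphic_intros entire entire_X) auto
  moreover have "norm (g u) \<le> 1 / e" for u
  proof (cases "\<sigma> u = 0")
    case False
    then have "x u \<notin> ball x0 e" using e(2) omit by blast
    then have "e \<le> norm (x u - x0)" by (simp add: dist_norm norm_minus_commute)
    moreover have "g u = 1 / (x u - x0)"
      using False nz[of u] by (simp add: g_def x_def divide_simps)
    ultimately show ?thesis using e(1) by (simp add: norm_divide frac_le)
  qed (use e in \<open>simp add: g_def\<close>)
  then have "bounded (range g)" by (intro boundedI[of _ "1 / e"]) auto
  ultimately obtain c where c: "\<And>u. g u = c"
    using Liouville_theorem unfolding constant_on_def by blast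
  have "c = 0" using c[of 0] sigma_0 by (simp add: g_def)
  then have "\<sigma> u = 0" for u using c[of u] nz[of u] by (simp add: g_def)
  then have "\<sigma> = (\<lambda>_. 0)" by blast
  then show False using deriv_0 by simp
qed

lemma xw_surj:
  assumes "w0\<^sup>2 = 4 * x0 ^ 3 + b2 * x0\<^sup>2 + 2 * b4 * x0 + b6"
  shows "\<exists>u. \<sigma> u \<noteq> 0 \<and> x u = x0 \<and> w u = w0"
proof -
  obtain u where u: "\<sigma> u \<noteq> 0" "x u = x0" using x_surj by blast
  then have "(w u)\<^sup>2 = w0\<^sup>2" using curve_xw[OF u(1)] assms by simp
  then have "w u = w0 \<or> w (- u) = w0" using parity by (auto simp: power2_eq_iff)
  then show ?thesis using u parity odd[of u] by (metis neg_equal_0_iff_equal)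
qed

end

text \<open>The projective plane is embedded in \<open>\<complex>\<^sup>3\<close> by three entries of the projection matrix \<open>v v\<^sup>* / |v|\<^sup>2\<close>, namely
  those in the third column; this suffices on the curve.\<close>

definition plane_embedding :: "complex \<times> complex \<times> complex \<Rightarrow> complex \<times> complex \<times> complex" where
  "plane_embedding v = (case v of (a, b, c) \<Rightarrow>
     let N = of_real ((norm a)\<^sup>2 + (norm b)\<^sup>2 + (norm c)\<^sup>2) in (a * cnj c / N, b * cnj c / N, c * cnj c / N))"

lemma norm_sum_squares_eq_0_iff:
  "(norm a)\<^sup>2 + (norm b)\<^sup>2 + (norm c)\<^sup>2 = 0 \<longleftrightarrow> (a, b, c) = (0 :: complex \<times> complex \<times> complex)"
  by (auto simp: zero_prod_def add_nonneg_eq_0_iff)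

lemma plane_embedding_scale:
  assumes "k \<noteq> 0" shows "plane_embedding (k * a, k * b, k * c) = plane_embedding (a, b, c)"
proof -
  define N where "N = (norm a)\<^sup>2 + (norm b)\<^sup>2 + (norm c)\<^sup>2"
  have "(norm (k * a))\<^sup>2 + (norm (k * b))\<^sup>2 + (norm (k * c))\<^sup>2 = (norm k)\<^sup>2 * N"
    by (simp add: N_def norm_mult power_mult_distrib algebra_simps)
  then show ?thesis
    unfolding plane_embedding_def prod.case Let_def N_def[symmetric]
    by (simp only: of_real_mult complex_norm_square complex_cnj_mult) (use assms in simp)
qed

lemma continuous_on_plane_embedding: "continuous_on (- {0}) plane_embedding"
proof -
  have "continuous_on (- {0}) (\<lambda>v. (fst v * cnj (snd (snd v)) / of_real ((norm (fst v))\<^sup>2 + (norm (fst (snd v)))\<^sup>2 + (norm (snd (snd v)))\<^sup>2),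
     fst (snd v) * cnj (snd (snd v)) / of_real ((norm (fst v))\<^sup>2 + (norm (fst (snd v)))\<^sup>2 + (norm (snd (snd v)))\<^sup>2),
     snd (snd v) * cnj (snd (snd v)) / of_real ((norm (fst v))\<^sup>2 + (norm (fst (snd v)))\<^sup>2 + (norm (snd (snd v)))\<^sup>2) :: complex))"
    by (intro continuous_intros)
      (use norm_sum_squares_eq_0_iff in \<open>auto simp flip: of_real_power of_real_add simp del: of_real_add of_real_power\<close>)
  then show ?thesis
    by (rule continuous_on_eq) (auto simp: plane_embedding_def Let_def)
qed

definition affine_embedding :: "complex \<Rightarrow> complex \<Rightarrow> complex \<times> complex \<times> complex" where
  "affine_embedding a b = plane_embedding (a, b, 1)"

lemma affine_embedding_eq:
  defines "N a b \<equiv> complex_of_real (1 + (norm a)\<^sup>2 + (norm b)\<^sup>2)"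
  shows "affine_embedding a b = (a / N a b, b / N a b, 1 / N a b)" "N a b \<noteq> 0"
proof -
  have "1 + (norm a)\<^sup>2 + (norm b)\<^sup>2 > 0" by (simp add: add_pos_nonneg)
  then show "N a b \<noteq> 0" unfolding N_def of_real_eq_0_iff by linarith
qed (simp add: affine_embedding_def plane_embedding_def Let_def N_def add_ac)

lemma affine_embedding_inj: "affine_embedding a b = affine_embedding a' b' \<longleftrightarrow> a = a' \<and> b = b'"
proof
  assume eq: "affine_embedding a b = affine_embedding a' b'"
  define N N' where "N = complex_of_real (1 + (norm a)\<^sup>2 + (norm b)\<^sup>2)" and "N' = complex_of_real (1 + (norm a')\<^sup>2 + (norm b')\<^sup>2)"
  have e: "a / N = a' / N'" "b / N = b' / N'" "1 / N = 1 / N'" "N \<noteq> 0" "N' \<noteq> 0"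
    using eq affine_embedding_eq[of a b] affine_embedding_eq[of a' b'] by (simp_all add: N_def N'_def)
  then have "N = N'" by simp
  with e show "a = a' \<and> b = b'" by simp
qed simp

lemma affine_embedding_nonzero: "affine_embedding a b \<noteq> 0"
  using affine_embedding_eq[of a b] by (simp add: zero_prod_def)

section \<open>The map \<Phi> from the plane to the embedded curve\<close>

locale sigma_cover = sigma_curve +
  fixes m1 m3 :: complex
begin

definition "y u = (w u - m1 * x u - m3) / 2"

text \<open>The homogeneous coordinates (x : y : 1) are multiplied by
  \<open>\<sigma>\<^sup>3\<close>. They are entire and have no common zero: where \<sigma> vanishes
  the middle one is W/2, which is nonzero.\<close>

definition "\<Phi> u = plane_embedding (X u * \<sigma> u, (W u - m1 * X u * \<sigma> u - m3 * \<sigma> u ^ 3) / 2, \<sigma> u ^ 3)"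

lemma Phi_affine: assumes "\<sigma> u \<noteq> 0" shows "\<Phi> u = affine_embedding (x u) (y u)"
proof -
  have "\<Phi> u = plane_embedding (\<sigma> u ^ 3 * x u, \<sigma> u ^ 3 * y u, \<sigma> u ^ 3 * 1)"
    unfolding \<Phi>_def by (rule arg_cong[where f = plane_embedding])
      (use assms in \<open>simp add: x_def y_def w_def field_simps eval_nat_numeral\<close>)
  then show ?thesis
    unfolding affine_embedding_def using assms plane_embedding_scale[of "\<sigma> u ^ 3" "x u" "y u" 1] by simp
qed

lemma Phi_zero: "\<sigma> u = 0 \<Longrightarrow> \<Phi> u = 0"
  by (simp add: \<Phi>_def plane_embedding_def zero_prod_def)

lemma Phi_eq_0_iff: "\<Phi> u = 0 \<longleftrightarrow> \<sigma> u = 0"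
  using Phi_affine Phi_zero affine_embedding_nonzero by metis

lemma continuous_Phi: "continuous_on UNIV \<Phi>"
  unfolding \<Phi>_def
proof (rule continuous_on_compose2[OF continuous_on_plane_embedding])
  note c = holomorphic_on_imp_continuous_on[OF entire] holomorphic_on_imp_continuous_on[OF entire_X]
    holomorphic_on_imp_continuous_on[OF entire_W]
  show "continuous_on UNIV (\<lambda>u. (X u * \<sigma> u, (W u - m1 * X u * \<sigma> u - m3 * \<sigma> u ^ 3) / 2, \<sigma> u ^ 3))"
    by (intro continuous_intros c) auto
  show "range (\<lambda>u. (X u * \<sigma> u, (W u - m1 * X u * \<sigma> u - m3 * \<sigma> u ^ 3) / 2, \<sigma> u ^ 3)) \<subseteq> - {0}"
    using simple_zero W_zero by (auto simp: zero_prod_def)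
qed

lemma Phi_eq_iff: "\<Phi> u = \<Phi> v \<longleftrightarrow> \<sigma> (v - u) = 0"
proof (cases "\<sigma> u = 0 \<or> \<sigma> v = 0")
  case True
  then show ?thesis
  proof
    assume u: "\<sigma> u = 0"
    then have "\<sigma> (v - u) = 0 \<longleftrightarrow> \<sigma> v = 0"
      using zero_shift_invariant(3)[OF u, of "v - u"] by simp
    then show ?thesis using u Phi_eq_0_iff by metis
  next
    assume v: "\<sigma> v = 0"
    then have "\<sigma> (v - u) = 0 \<longleftrightarrow> \<sigma> u = 0"
      using zero_shift_invariant(3)[OF v, of "- u"] odd[of u] by (simp add: add.commute)
    then show ?thesis using v Phi_eq_0_iff by metis
  qed
next
  case False
  then show ?thesis
    using same_point_iff[of u v] by (auto simp: Phi_affine affine_embedding_inj y_def)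
qed

text \<open>Since only the sign of \<open>w\<close> is missing from \<open>x\<close>, openness of \<open>x\<close> carries over to \<open>\<Phi>\<close>: near a point with
  \<open>w = 0\<close> or at infinity the sign is adjusted by a reflection in that point.\<close>

lemma Phi_reflect:
  assumes z: "\<sigma> (2 * z) = 0" and u: "\<sigma> u \<noteq> 0" "\<sigma> v \<noteq> 0" "x u = x v"
  shows "\<Phi> v = \<Phi> u \<or> \<Phi> (2 * z - v) = \<Phi> u"
proof -
  have "(w u)\<^sup>2 = (w v)\<^sup>2" using curve_xw u by simp
  then consider "w u = w v" | "w u = w (- v)" using parity by (auto simp: power2_eq_iff)
  then show ?thesis
  proof cases
    case 1
    then show ?thesis using u by (simp add: Phi_affine y_def)
  next
    case 2
    then have "\<sigma> (- v - u) = 0"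
      using same_point_iff[of u "- v"] u parity odd[of v] by simp
    then have "\<sigma> (2 * z + (- v - u)) = 0" by (intro zeros_add z)
    then show ?thesis using Phi_eq_iff[of "2 * z - v" u] odd[of "2 * z - v - u"] by (simp add: algebra_simps)
  qed
qed

lemma reflect_in_ball: "v \<in> ball z e \<Longrightarrow> 2 * z - v \<in> ball z e" for z :: complex
proof -
  have "z - (2 * z - v) = v - z" by simp
  then show "v \<in> ball z e \<Longrightarrow> 2 * z - v \<in> ball z e"
    unfolding mem_ball dist_norm using norm_minus_commute by metis
qed

lemma x_not_constant:
  assumes "\<And>u. u \<in> ball z r \<Longrightarrow> \<sigma> u \<noteq> 0" "r > 0"
  shows "\<not> x constant_on ball z r"
proof
  assume "x constant_on ball z r"
  then obtain c where c: "\<And>s. s \<in> ball z r \<Longrightarrow> x s = c" unfolding constant_on_def by blast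
  have w0: "w s = 0" if s: "s \<in> ball z r" for s
  proof -
    have "(x has_field_derivative 0) (at s)"
      using has_field_derivative_transform_within_open[of "\<lambda>_. c" 0 s "ball z r" x] s c by simp
    then show ?thesis using deriv_x[OF assms(1)[OF s]] DERIV_unique by blast
  qed
  have z: "z \<in> ball z r" using assms by simp
  have "(w has_field_derivative 0) (at z)"
    using has_field_derivative_transform_within_open[of "\<lambda>_. 0" 0 z "ball z r" w] z w0 by simp
  then have "6 * (x z)\<^sup>2 + b2 * x z + b4 = 0"
    using deriv_w[OF assms(1)[OF z]] DERIV_unique by blast
  then show False using nonsingular[of "x z"] curve_xw[OF assms(1)[OF z]] w0[OF z] by simp
qed

lemma Phi_locally_open_finite:
  assumes z: "\<sigma> z \<noteq> 0" and e: "e > 0"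
  shows "\<exists>\<delta>>0. \<forall>u. dist (\<Phi> u) (\<Phi> z) < \<delta> \<longrightarrow> (\<exists>v\<in>ball z e. \<Phi> v = \<Phi> u)"
proof -
  have cont: "isCont \<sigma> z" "isCont w z"
    using has_derivs(1) deriv_w[OF z] DERIV_isCont by blast+
  obtain r1 where r1: "r1 > 0" "\<And>v. dist z v < r1 \<Longrightarrow> \<sigma> v \<noteq> 0"
    using continuous_at_avoid[OF cont(1) z] by blast
  \<comment> \<open>For w z = 0 no sign has to be controlled, and 1 is just some positive
    radius.\<close>
  have "(if w z = 0 then 1 else norm (w z)) > 0" by simp
  then obtain r2 where r2: "r2 > 0" "\<And>v. dist v z < r2 \<Longrightarrow> dist (w v) (w z) < (if w z = 0 then 1 else norm (w z))"
    using cont(2) unfolding continuous_at_eps_delta by blast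
  define r where "r = min r1 r2"
  have r: "r > 0" "\<And>v. dist v z < r \<Longrightarrow> \<sigma> v \<noteq> 0 \<and> (w z \<noteq> 0 \<longrightarrow> dist (w v) (w z) < norm (w z))"
    using r1 r2 by (auto simp: r_def dist_commute)
  define s where "s = min r e"
  have s: "s > 0" using r e by (simp add: s_def)
  have nz: "\<sigma> v \<noteq> 0" "w z \<noteq> 0 \<Longrightarrow> dist (w v) (w z) < norm (w z)" if "v \<in> ball z s" for v
    using that r(2)[of v] by (auto simp: s_def dist_commute)
  have hol: "x holomorphic_on ball z s"
    using nz deriv_x by (meson holomorphic_on_open open_ball)
  have "open (x ` ball z s)"
    by (rule open_mapping_thm[OF hol open_ball _ open_ball order_refl x_not_constant]) (use nz s in auto)
  moreover have "x z \<in> x ` ball z s" using s by auto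
  ultimately have ev_x: "eventually (\<lambda>p. p \<in> x ` ball z s) (nhds (x z))"
    by (rule eventually_nhds_in_open)
  have Phi_z: "snd (snd (\<Phi> z)) \<noteq> 0" "fst (\<Phi> z) / snd (snd (\<Phi> z)) = x z"
    "2 * (fst (snd (\<Phi> z)) / snd (snd (\<Phi> z))) + m1 * x z + m3 = w z"
    if z: "\<sigma> z \<noteq> 0" for z
  proof -
    obtain N where N: "\<Phi> z = (x z / N, y z / N, 1 / N)" "N \<noteq> 0"
      using affine_embedding_eq[of "x z" "y z"] Phi_affine[OF z] by metis
    then show "snd (snd (\<Phi> z)) \<noteq> 0" "fst (\<Phi> z) / snd (snd (\<Phi> z)) = x z" by simp_all
    have *: "fst (snd (\<Phi> z)) / snd (snd (\<Phi> z)) = y z" using N by simp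
    show "2 * (fst (snd (\<Phi> z)) / snd (snd (\<Phi> z))) + m1 * x z + m3 = w z"
      unfolding * by (simp add: y_def diff_divide_distrib)
  qed
  have tx: "((\<lambda>q. fst q / snd (snd q)) \<longlongrightarrow> x z) (nhds (\<Phi> z))"
    unfolding Phi_z(2)[OF z, symmetric] by (intro tendsto_intros Phi_z(1) z filterlim_ident)
  have tw: "((\<lambda>q. 2 * (fst (snd q) / snd (snd q)) + m1 * (fst q / snd (snd q)) + m3) \<longlongrightarrow> w z) (nhds (\<Phi> z))"
    unfolding Phi_z(3)[OF z, symmetric] by (intro tendsto_intros Phi_z(1) z filterlim_ident tx)
  have tz: "((\<lambda>q::complex\<times>complex\<times>complex. snd (snd q)) \<longlongrightarrow> snd (snd (\<Phi> z))) (nhds (\<Phi> z))"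
    by (intro tendsto_intros filterlim_ident)
  have "eventually (\<lambda>q. snd (snd q) \<noteq> 0 \<and> fst q / snd (snd q) \<in> x ` ball z s \<and>
      (w z \<noteq> 0 \<longrightarrow> dist (2 * (fst (snd q) / snd (snd q)) + m1 * (fst q / snd (snd q)) + m3) (w z) < norm (w z))) (nhds (\<Phi> z))"
  proof (intro eventually_conj)
    show "eventually (\<lambda>q. snd (snd q) \<noteq> 0) (nhds (\<Phi> z))"
      by (rule tendsto_imp_eventually_ne[OF tz Phi_z(1)[OF z]])
    show "eventually (\<lambda>q. fst q / snd (snd q) \<in> x ` ball z s) (nhds (\<Phi> z))"
      by (rule filterlim_iff[THEN iffD1, OF tx, rule_format, OF ev_x])
    show "eventually (\<lambda>q. w z \<noteq> 0 \<longrightarrow> dist (2 * (fst (snd q) / snd (snd q)) + m1 * (fst q / snd (snd q)) + m3) (w z)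
        < norm (w z)) (nhds (\<Phi> z))"
      using tendstoD[OF tw, of "norm (w z)"] by (cases "w z = 0") simp_all
  qed
  then obtain \<delta> where d: "\<delta> > 0" "\<And>q. dist q (\<Phi> z) < \<delta> \<Longrightarrow> snd (snd q) \<noteq> 0 \<and> fst q / snd (snd q) \<in> x ` ball z s \<and>
      (w z \<noteq> 0 \<longrightarrow> dist (2 * (fst (snd q) / snd (snd q)) + m1 * (fst q / snd (snd q)) + m3) (w z) < norm (w z))"
    unfolding eventually_nhds_metric by blast
  show ?thesis
  proof (intro exI[of _ \<delta>] conjI allI impI)
    fix u assume "dist (\<Phi> u) (\<Phi> z) < \<delta>"
    note u = d(2)[OF this]
    then have su: "\<sigma> u \<noteq> 0" using Phi_zero[of u] by auto
    obtain v where v: "v \<in> ball z s" "x v = x u" using u Phi_z(2)[OF su] by (metis imageE)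
    then have vball: "v \<in> ball z e" by (simp add: s_def)
    note vball = this reflect_in_ball[OF this]
    show "\<exists>v\<in>ball z e. \<Phi> v = \<Phi> u"
    proof (cases "w z = 0")
      case True
      then have "\<sigma> (2 * z) = 0"
        using same_point_iff[of "- z" z] parity[of z] odd[of z] z by simp
      then have "\<Phi> v = \<Phi> u \<or> \<Phi> (2 * z - v) = \<Phi> u"
        using Phi_reflect[OF _ su nz(1)[OF v(1)]] v(2) by simp
      then show ?thesis using vball by blast
    next
      case False
      have "(w u)\<^sup>2 = (w v)\<^sup>2" using curve_xw su nz(1)[OF v(1)] v(2) by simp
      \<comment> \<open>Both w u and w v are closer to w z than |w z|, so they cannot be
        opposite.\<close>
      moreover have "w u \<noteq> - w v"
      proof
        assume "w u = - w v"
        moreover have "dist (w u) (w z) < norm (w z)" "dist (w v) (w z) < norm (w z)"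
          using u Phi_z(2,3)[OF su] nz(2)[OF v(1)] False by auto
        ultimately have "norm ((w u - w z) + (w v - w z)) < 2 * norm (w z)"
          using norm_triangle_ineq[of "w u - w z" "w v - w z"] by (simp add: dist_norm)
        with \<open>w u = - w v\<close> show False by (simp add: norm_mult flip: mult_2)
      qed
      ultimately have "w u = w v" by (simp add: power2_eq_iff)
      then have "\<Phi> v = \<Phi> u" using v(2) su nz(1)[OF v(1)] by (simp add: Phi_affine y_def)
      then show ?thesis using vball(1) by blast
    qed
  qed (use d in simp)
qed

text \<open>Near a zero of \<sigma> the function p = 1/x is holomorphic and open. It remains to see
  that a small \<Phi> u forces |x u| to be large, since then 1/x u lies in the image of p.\<close>

lemma Phi_locally_open_infinite:
  assumes z: "\<sigma> z = 0" and e: "e > 0"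
  shows "\<exists>\<delta>>0. \<forall>u. dist (\<Phi> u) (\<Phi> z) < \<delta> \<longrightarrow> (\<exists>v\<in>ball z e. \<Phi> v = \<Phi> u)"
proof -
  have "isCont X z" using has_derivs(3) DERIV_isCont by blast
  then obtain r where r: "r > 0" "\<And>v. dist z v < r \<Longrightarrow> X v \<noteq> 0"
    using continuous_at_avoid[of z X 0] nonzero_X[OF z] by blast
  obtain \<delta> where \<delta>: "\<delta> > 0" "\<And>l. \<sigma> l = 0 \<Longrightarrow> norm l < \<delta> \<Longrightarrow> l = 0" using zeros_isolated by blast
  define s where "s = min (min r e) \<delta>"
  have s: "s > 0" using r e \<delta> by (simp add: s_def)
  have nz: "X v \<noteq> 0" "\<sigma> v = 0 \<Longrightarrow> v = z" if "v \<in> ball z s" for v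
    using that r(2)[of v] \<delta>(2)[of "v - z"] zeros_diff[OF _ z, of v] by (auto simp: s_def dist_norm norm_minus_commute)
  define p where "p v = (\<sigma> v)\<^sup>2 / X v" for v
  have hol: "p holomorphic_on ball z s"
    unfolding p_def using nz
    by (intro holomorphic_intros holomorphic_on_subset[OF entire] holomorphic_on_subset[OF entire_X]) auto
  have pz: "p z = 0" using z by (simp add: p_def)
  have "\<not> p constant_on ball z s"
  proof
    assume "p constant_on ball z s"
    then obtain c where c: "\<And>v. v \<in> ball z s \<Longrightarrow> p v = c" unfolding constant_on_def by blast
    define v where "v = z + of_real (s / 2)"
    have v: "v \<in> ball z s" "v \<noteq> z" using s by (auto simp: v_def dist_norm)
    then have "p v = 0" using c[of v] c[of z] pz s by simp
    then show False using nz[OF v(1)] v(2) by (simp add: p_def)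
  qed
  then have "open (p ` ball z s)"
    by (intro open_mapping_thm[OF hol]) auto
  moreover have "0 \<in> p ` ball z s" using s pz by (intro image_eqI[of _ _ z]) auto
  ultimately obtain \<rho> where \<rho>: "\<rho> > 0" "ball 0 \<rho> \<subseteq> p ` ball z s"
    using open_contains_ball by blast
  define R where "R = 1 / \<rho>"
  \<comment> \<open>On |x| \<le> R the curve equation gives \<open>|w|\<^sup>2 \<le> K\<close>,
    hence |w| \<le> K + 1; then L bounds |y|, and M bounds the denominator of
    \<open>affine_embedding\<close>, so that the third coordinate is at least 1/M.\<close>
  define K where "K = 4 * R ^ 3 + norm b2 * R\<^sup>2 + 2 * norm b4 * R + norm b6"
  define L where "L = K + 1 + norm m1 * R + norm m3"
  define M where "M = 1 + R\<^sup>2 + L\<^sup>2"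
  have R: "R > 0" using \<rho> by (simp add: R_def)
  have K: "K \<ge> 0" using R by (simp add: K_def)
  have M: "M > 0" by (simp add: M_def add_pos_nonneg)
  have large: "norm (x u) > R" if u: "\<sigma> u \<noteq> 0" "norm (\<Phi> u) < 1 / M" for u
  proof (rule ccontr)
    assume "\<not> norm (x u) > R"
    then have xR: "norm (x u) \<le> R" by simp
    have "norm (w u) ^ 2 = norm (4 * x u ^ 3 + b2 * (x u)\<^sup>2 + 2 * b4 * x u + b6)"
      using curve_xw[OF u(1)] by (metis norm_power)
    also have "\<dots> \<le> 4 * norm (x u) ^ 3 + norm b2 * (norm (x u))\<^sup>2 + 2 * norm b4 * norm (x u) + norm b6"
      by (intro norm_triangle_mono order_refl) (simp_all add: norm_mult norm_power)
    also have "\<dots> \<le> K"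
      unfolding K_def using xR R by (intro add_mono mult_left_mono power_mono) auto
    finally have w2: "norm (w u) ^ 2 \<le> K" .
    have "norm (w u) \<le> K + 1"
    proof (rule ccontr)
      assume "\<not> norm (w u) \<le> K + 1"
      then have "(K + 1)\<^sup>2 \<le> norm (w u) ^ 2" using K by (intro power_mono) auto
      moreover have "(K + 1)\<^sup>2 = K * K + 2 * K + 1" by (simp add: power2_eq_square algebra_simps)
      ultimately show False using w2 K mult_nonneg_nonneg[OF K K] by linarith
    qed
    moreover have "norm (y u) \<le> norm (w u) + norm m1 * norm (x u) + norm m3"
    proof -
      have "norm (y u) = norm (w u - m1 * x u - m3) / 2" by (simp add: y_def norm_divide)
      also have "\<dots> \<le> norm (w u - m1 * x u - m3)" by simp
      also have "\<dots> \<le> norm (w u) + norm (m1 * x u) + norm m3"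
        using norm_triangle_ineq4[of "w u - m1 * x u" m3] norm_triangle_ineq4[of "w u" "m1 * x u"] by linarith
      finally show ?thesis by (simp add: norm_mult)
    qed
    moreover have "norm m1 * norm (x u) \<le> norm m1 * R" using xR by (intro mult_left_mono) auto
    ultimately have yL: "norm (y u) \<le> L" by (simp add: L_def)
    have "1 + (norm (x u))\<^sup>2 + (norm (y u))\<^sup>2 \<le> M"
      unfolding M_def using xR yL by (intro add_mono power_mono) auto
    then have "1 / M \<le> 1 / (1 + (norm (x u))\<^sup>2 + (norm (y u))\<^sup>2)"
      by (intro divide_left_mono) (auto intro!: mult_pos_pos M add_pos_nonneg)
    also have "\<dots> = norm (snd (snd (\<Phi> u)))"
    proof -
      have "norm (1 / complex_of_real t) = 1 / t" if "t > 0" for t using that by (simp add: norm_divide)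
      then show ?thesis
        unfolding Phi_affine[OF u(1)] affine_embedding_eq(1) snd_conv by (simp add: add_pos_nonneg del: of_real_add)
    qed
    also have "\<dots> \<le> norm (\<Phi> u)"
      by (metis norm_snd_le order_trans prod.collapse)
    finally show False using u(2) by simp
  qed
  show ?thesis
  proof (intro exI[of _ "1 / M"] conjI allI impI)
    fix u assume u: "dist (\<Phi> u) (\<Phi> z) < 1 / M"
    show "\<exists>v\<in>ball z e. \<Phi> v = \<Phi> u"
    proof (cases "\<sigma> u = 0")
      case True
      then have "\<Phi> z = \<Phi> u" using Phi_zero[OF z] Phi_zero[of u] by simp
      then show ?thesis using e by (intro bexI[of _ z]) simp_all
    next
      case False
      have "norm (\<Phi> u) < 1 / M" using u by (simp add: Phi_zero[OF z])
      from large[OF False this] have xR: "1 / \<rho> < norm (x u)" by (simp add: R_def)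
      then have pos: "0 < norm (x u)" using R unfolding R_def by linarith
      have "1 < norm (x u) * \<rho>" using xR by (simp only: pos_divide_less_eq[OF \<rho>(1)])
      then have "1 / norm (x u) < \<rho>" by (simp only: pos_divide_less_eq[OF pos] mult.commute)
      then have "1 / x u \<in> ball 0 \<rho>" by (simp add: norm_divide)
      then have "1 / x u \<in> p ` ball z s" by (rule subsetD[OF \<rho>(2)])
      then obtain v where v: "1 / x u = p v" "v \<in> ball z s" by (rule imageE)
      have "x u \<noteq> 0" using pos by simp
      then have "p v \<noteq> 0" unfolding v(1)[symmetric] by simp
      then have sv: "\<sigma> v \<noteq> 0" unfolding p_def by auto
      have "p v = inverse (x v)" unfolding p_def x_def by simp
      then have "inverse (x v) = inverse (x u)" using v(1) by (simp only: inverse_eq_divide)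
      then have xv: "x v = x u" by (simp only: inverse_eq_iff_eq)
      have "\<sigma> (2 * z) = 0" unfolding mult_2 by (rule zeros_add[OF z z])
      then have "\<Phi> v = \<Phi> u \<or> \<Phi> (2 * z - v) = \<Phi> u"
        by (rule Phi_reflect[OF _ False sv xv[symmetric]])
      moreover have "v \<in> ball z e" using v(2) by (simp add: s_def)
      moreover from this have "2 * z - v \<in> ball z e" by (rule reflect_in_ball)
      ultimately show ?thesis by blast
    qed
  qed (use M in simp)
qed

lemma Phi_open:
  assumes "open U" shows "openin (top_of_set (range \<Phi>)) (\<Phi> ` U)"
  unfolding openin_euclidean_subtopology_iff
proof (intro conjI ballI)
  fix q assume "q \<in> \<Phi> ` U"
  then obtain z where z: "z \<in> U" "q = \<Phi> z" by blast
  obtain e where e: "e > 0" "ball z e \<subseteq> U" using assms z open_contains_ball by blast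
  obtain \<delta> where d: "\<delta> > 0" "\<And>u. dist (\<Phi> u) (\<Phi> z) < \<delta> \<Longrightarrow> \<exists>v\<in>ball z e. \<Phi> v = \<Phi> u"
    using Phi_locally_open_finite Phi_locally_open_infinite e(1) by metis
  show "\<exists>\<delta>>0. \<forall>q'\<in>range \<Phi>. dist q' q < \<delta> \<longrightarrow> q' \<in> \<Phi> ` U"
  proof (intro exI[of _ \<delta>] conjI ballI impI d(1))
    fix q' assume "q' \<in> range \<Phi>" "dist q' q < \<delta>"
    then obtain u v where "q' = \<Phi> u" "v \<in> ball z e" "\<Phi> v = \<Phi> u"
      using d(2) z(2) by blast
    then show "q' \<in> \<Phi> ` U" using e(2) by (metis image_eqI subsetD)
  qed
qed auto

text \<open>Fibres are cosets of the group of zeros, whose elements are at least \<delta> apart.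
  Balls of radius \<delta>/2 around the points of a fibre are therefore disjoint, and \<Phi> is
  injective and open on each, with the same image.\<close>

lemma covering_Phi: "covering_space UNIV \<Phi> (range \<Phi>)"
proof
  show "continuous_on UNIV \<Phi>" by (rule continuous_Phi)
next
  fix q assume "q \<in> range \<Phi>"
  then obtain u0 where u0: "q = \<Phi> u0" by blast
  obtain \<delta> where d: "\<delta> > 0" "\<And>l. \<sigma> l = 0 \<Longrightarrow> norm l < \<delta> \<Longrightarrow> l = 0" using zeros_isolated by blast
  define B where "B l = ball (u0 + l) (\<delta> / 2)" for l
  define T where "T = \<Phi> ` B 0"
  have period: "\<Phi> (u + l) = \<Phi> u" if "\<sigma> l = 0" for u l
    using that Phi_eq_iff[of u "u + l"] by simp
  have inj: "inj_on \<Phi> (B l)" for l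
  proof
    fix u v assume uv: "u \<in> B l" "v \<in> B l" "\<Phi> u = \<Phi> v"
    then have "dist u v < \<delta>"
      using dist_triangle2[of u v "u0 + l"] by (simp add: B_def dist_commute)
    then show "u = v" using uv(3) Phi_eq_iff[of u v] d(2)[of "v - u"] by (simp add: dist_norm norm_minus_commute)
  qed
  have image: "\<Phi> ` B l = T" if l: "\<sigma> l = 0" for l
  proof -
    have "B l = (\<lambda>u. u + l) ` B 0"
    proof (intro set_eqI iffI)
      fix u assume "u \<in> B l"
      then have "u - l \<in> B 0" by (simp add: B_def dist_norm diff_diff_eq2)
      then show "u \<in> (\<lambda>u. u + l) ` B 0" by (intro image_eqI[of _ _ "u - l"]) simp_all
    next
      fix u assume "u \<in> (\<lambda>u. u + l) ` B 0"
      then show "u \<in> B l" by (auto simp: B_def)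
    qed
    then show ?thesis unfolding T_def using period[OF l] by (simp add: image_image)
  qed
  show "\<exists>T. q \<in> T \<and> openin (top_of_set (range \<Phi>)) T \<and>
      (\<exists>v. \<Union> v = UNIV \<inter> \<Phi> -` T \<and> (\<forall>u\<in>v. openin (top_of_set UNIV) u) \<and> pairwise disjnt v \<and>
        (\<forall>u\<in>v. \<exists>q. homeomorphism u T \<Phi> q))"
  proof (intro exI[of _ T] exI[of _ "B ` {l. \<sigma> l = 0}"] conjI ballI)
    show "q \<in> T" using d by (auto simp: u0 T_def B_def)
    show "openin (top_of_set (range \<Phi>)) T" unfolding T_def by (rule Phi_open) (simp add: B_def)
    show "\<Union> (B ` {l. \<sigma> l = 0}) = UNIV \<inter> \<Phi> -` T"
    proof (intro set_eqI iffI)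
      fix u assume "u \<in> UNIV \<inter> \<Phi> -` T"
      then obtain v where v: "v \<in> B 0" "\<Phi> u = \<Phi> v" by (auto simp: T_def)
      then have "\<sigma> (u - v) = 0" using Phi_eq_iff[of v u] by simp
      moreover have "u \<in> B (u - v)" using v(1) by (simp add: B_def dist_norm diff_diff_eq2 diff_add_eq)
      ultimately show "u \<in> \<Union> (B ` {l. \<sigma> l = 0})" by blast
    next
      fix u assume "u \<in> \<Union> (B ` {l. \<sigma> l = 0})"
      then obtain l where "\<sigma> l = 0" "u \<in> B l" by blast
      then show "u \<in> UNIV \<inter> \<Phi> -` T" using image[of l] by blast
    qed
    show "pairwise disjnt (B ` {l. \<sigma> l = 0})"
    proof (rule pairwiseI)
      fix S S' assume S: "S \<in> B ` {l. \<sigma> l = 0}" "S' \<in> B ` {l. \<sigma> l = 0}" "S \<noteq> S'"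
      then obtain l l' where l: "\<sigma> l = 0" "\<sigma> l' = 0" "S = B l" "S' = B l'" by auto
      show "disjnt S S'"
      proof (rule ccontr)
        assume "\<not> disjnt S S'"
        then obtain u where "u \<in> B l" "u \<in> B l'" using l by (auto simp: disjnt_def)
        then have "dist (u0 + l) (u0 + l') < \<delta>"
          using dist_triangle[of "u0 + l" "u0 + l'" u] by (simp add: B_def dist_commute)
        then have "l - l' = 0" using d(2)[of "l - l'"] zeros_diff[OF l(1,2)] by (simp add: dist_norm)
        then show False using S(3) l by simp
      qed
    qed
    fix S assume "S \<in> B ` {l. \<sigma> l = 0}"
    then obtain l where l: "\<sigma> l = 0" "S = B l" by auto
    have "open S" by (simp add: l B_def)
    then show "openin (top_of_set UNIV) S" by simp
    obtain g where "homeomorphism S T \<Phi> g"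
    proof (rule homeomorphism_injective_open_map[of S \<Phi> T])
      show "continuous_on S \<Phi>" using continuous_Phi continuous_on_subset by blast
      show "\<Phi> ` S = T" "inj_on \<Phi> S" using image l inj by auto
      fix U assume "openin (top_of_set S) U"
      then have "open U" "U \<subseteq> S" by (simp_all add: openin_open_eq[OF \<open>open S\<close>])
      then show "openin (top_of_set T) (\<Phi> ` U)"
        using image[OF l(1)] l(2) by (intro openin_subset_trans[OF Phi_open]) (auto simp: T_def)
    qed (use that in blast)
    then show "\<exists>g. homeomorphism S T \<Phi> g" by blast
  qed
qed simp

end

section \<open>Lifting paths on the curve\<close>

text \<open>A lift is only known to be continuous; near k t it is the composition of the
  differentiable path h k with a holomorphic inverse of h.\<close>

lemma has_vector_derivative_lift:
  fixes k :: "real \<Rightarrow> complex"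
  assumes h: "h holomorphic_on U" "open U" "k t \<in> U" and h': "(h has_field_derivative d) (at (k t))" "d \<noteq> 0"
    and k: "isCont k t" and hk: "((\<lambda>s. h (k s)) has_vector_derivative v) (at t)"
  shows "(k has_vector_derivative v / d) (at t)"
proof -
  have dh: "deriv h (k t) = d" using h' by (simp add: DERIV_imp_deriv)
  obtain r where r: "r > 0" "ball (k t) r \<subseteq> U" "inj_on h (ball (k t) r)"
    using has_complex_derivative_locally_injective[OF h(1,3,2)] dh h'(2) by blast
  have holB: "h holomorphic_on ball (k t) r" using h(1) r(2) holomorphic_on_subset by blast
  obtain g where g: "g holomorphic_on (h ` ball (k t) r)"
      "\<And>z. z \<in> ball (k t) r \<Longrightarrow> deriv h z * deriv g (h z) = 1" "\<And>z. z \<in> ball (k t) r \<Longrightarrow> g (h z) = z"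
    using holomorphic_has_inverse[OF holB open_ball r(3)] by blast
  have op: "open (h ` ball (k t) r)" by (rule open_mapping_thm3[OF holB open_ball r(3)])
  have "deriv g (h (k t)) = 1 / d"
    using g(2)[of "k t"] r(1) dh h'(2) by (simp add: eq_divide_eq mult.commute)
  then have dg: "(g has_field_derivative 1 / d) (at (h (k t)))"
    using holomorphic_derivI[OF g(1) op, of "h (k t)"] r(1) by simp
  have "((g \<circ> (\<lambda>s. h (k s))) has_vector_derivative v * (1 / d)) (at t)"
    using hk dg by (intro field_vector_diff_chain_at) auto
  then have gh: "((\<lambda>s. g (h (k s))) has_vector_derivative v / d) (at t)"
    by (simp add: o_def)
  obtain e where e: "e > 0" "\<And>s. dist s t < e \<Longrightarrow> dist (k s) (k t) < r"
    using k r(1) unfolding continuous_at_eps_delta by blast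
  show ?thesis
  proof (rule has_vector_derivative_transform_within[OF gh e(1)])
    fix s assume "dist s t < e"
    then have "k s \<in> ball (k t) r" using e(2)[of s] by (simp add: dist_commute)
    then show "g (h (k s)) = k s" by (rule g(3))
  qed simp
qed

section \<open>From the projective curve to the image of \<Phi>\<close>

lemma rep_abs_cproj2:
  assumes "v \<noteq> 0" shows "proj_rel v (rep_cproj2 (abs_cproj2 v))"
proof -
  have "proj_rel v v"
    unfolding proj_rel_def using assms by (intro conjI exI[of _ 1]) auto
  then have "proj_rel (rep_cproj2 (abs_cproj2 v)) v"
    by (rule Quotient3_rep_abs[OF Quotient3_cproj2])
  then show ?thesis by (rule part_equivp_symp[OF part_equivp_proj_rel])
qed

definition cproj2_embedding :: "cproj2 \<Rightarrow> complex \<times> complex \<times> complex" where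
  "cproj2_embedding P = plane_embedding (rep_cproj2 P)"

lemma cproj2_embedding_abs:
  assumes "v \<noteq> 0" shows "cproj2_embedding (abs_cproj2 v) = plane_embedding v"
proof -
  obtain c where c: "c \<noteq> 0" "rep_cproj2 (abs_cproj2 v) = (c * fst v, c * fst (snd v), c * snd (snd v))"
    using rep_abs_cproj2[OF assms] unfolding proj_rel_def by (elim conjE exE)
  have "v = (fst v, fst (snd v), snd (snd v))" by simp
  then show ?thesis unfolding cproj2_embedding_def c(2) using plane_embedding_scale[OF c(1)] by metis
qed

lemma continuous_cproj2_embedding: "continuous_on UNIV cproj2_embedding"
  unfolding continuous_on_open_vimage[OF open_UNIV]
proof (intro allI impI)
  fix U :: "(complex \<times> complex \<times> complex) set" assume "open U"
  then have "open (plane_embedding -` U \<inter> - {0})"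
    by (rule continuous_on_open_vimage[OF open_Compl[OF closed_singleton], THEN iffD1,
        OF continuous_on_plane_embedding, THEN spec, THEN mp])
  moreover have "{v. v \<noteq> 0 \<and> abs_cproj2 v \<in> cproj2_embedding -` U \<inter> UNIV} = plane_embedding -` U \<inter> - {0}"
    by (auto simp: cproj2_embedding_abs)
  ultimately show "open (cproj2_embedding -` U \<inter> UNIV)"
    unfolding open_cproj2_def by simp
qed

lemma cproj2_embedding_affine: "cproj2_embedding (affine_pt p) = affine_embedding (fst p) (snd p)"
  unfolding affine_pt_def affine_embedding_def by (rule cproj2_embedding_abs) (simp add: zero_prod_def)

lemma continuous_affine_embedding: "continuous_on UNIV (\<lambda>p. affine_embedding (fst p) (snd p))"
  unfolding affine_embedding_def
  by (rule continuous_on_compose2[OF continuous_on_plane_embedding])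
    (auto intro!: continuous_intros simp: zero_prod_def)

lemma eventually_nonzero:
  fixes f :: "real \<Rightarrow> complex"
  assumes "continuous_on UNIV f" "f s \<noteq> 0"
  shows "eventually (\<lambda>s. f s \<noteq> 0) (nhds s)"
  using eventually_nhds_in_open[OF open_Collect_neq[OF assms(1) continuous_on_const, of 0], of s] assms(2) by simp

locale curve_cover = sigma_cover +
  fixes \<mu> :: "nat \<Rightarrow> complex"
  assumes m: "\<mu> 1 = m1" "\<mu> 3 = m3"
    and b2: "b2 = m1\<^sup>2 + 4 * \<mu> 2" and b4: "b4 = 2 * \<mu> 4 + m1 * m3" and b6: "b6 = m3\<^sup>2 + 4 * \<mu> 6"
begin

lemma mu [simp]: "\<mu> (Suc 0) = m1" "\<mu> 3 = m3"
  using m by simp_all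

lemma affine_curve_iff:
  "(a, b) \<in> affine_curve \<mu> \<longleftrightarrow> (2 * b + m1 * a + m3)\<^sup>2 = 4 * a ^ 3 + b2 * a\<^sup>2 + 2 * b4 * a + b6"
proof -
  have "(2 * b + m1 * a + m3)\<^sup>2 - (4 * a ^ 3 + b2 * a\<^sup>2 + 2 * b4 * a + b6)
    = 4 * (b\<^sup>2 + (m1 * a + m3) * b - (a ^ 3 + \<mu> 2 * a\<^sup>2 + \<mu> 4 * a + \<mu> 6))"
    unfolding b2 b4 b6 by algebra
  then have "(2 * b + m1 * a + m3)\<^sup>2 = 4 * a ^ 3 + b2 * a\<^sup>2 + 2 * b4 * a + b6
      \<longleftrightarrow> b\<^sup>2 + (m1 * a + m3) * b = a ^ 3 + \<mu> 2 * a\<^sup>2 + \<mu> 4 * a + \<mu> 6"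
    by (metis eq_iff_diff_eq_0 mult_eq_0_iff zero_neq_numeral)
  then show ?thesis by (simp add: affine_curve_def)
qed

lemma w_eq: "w u = 2 * y u + m1 * x u + m3"
  by (simp add: y_def diff_divide_distrib)

lemma affine_embedding_in_range:
  assumes "p \<in> affine_curve \<mu>" shows "affine_embedding (fst p) (snd p) \<in> range \<Phi>"
proof -
  obtain a b where p: "p = (a, b)" by fastforce
  obtain u where u: "\<sigma> u \<noteq> 0" "x u = a" "w u = 2 * b + m1 * a + m3"
    using xw_surj assms unfolding p affine_curve_iff by blast
  then have "y u = b" by (simp add: y_def)
  then show ?thesis using Phi_affine[OF u(1)] u(2) p by (metis fst_conv snd_conv rangeI)
qed

lemma cproj2_embedding_in_range:
  assumes "P \<in> proj_curve \<mu>" shows "cproj2_embedding P \<in> range \<Phi>"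
proof -
  obtain X Y Z where P: "P = abs_cproj2 (X, Y, Z)" "(X, Y, Z) \<noteq> 0"
    and eq: "Y\<^sup>2 * Z + (m1 * X + m3 * Z) * Y * Z = X ^ 3 + \<mu> 2 * X\<^sup>2 * Z + \<mu> 4 * X * Z\<^sup>2 + \<mu> 6 * Z ^ 3"
    using assms unfolding proj_curve_def m by blast
  show ?thesis
  proof (cases "Z = 0")
    case True
    then have "cproj2_embedding P = 0"
      unfolding P(1) cproj2_embedding_abs[OF P(2)] by (simp add: plane_embedding_def zero_prod_def)
    then show ?thesis using Phi_zero[OF sigma_0] by (metis rangeI)
  next
    case False
    define a b where "a = X / Z" and "b = Y / Z"
    have XY: "X = Z * a" "Y = Z * b" using False by (simp_all add: a_def b_def)
    have "Z ^ 3 * (b\<^sup>2 + (m1 * a + m3) * b) = Z ^ 3 * (a ^ 3 + \<mu> 2 * a\<^sup>2 + \<mu> 4 * a + \<mu> 6)"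
      using eq unfolding XY by (simp add: power2_eq_square power3_eq_cube algebra_simps)
    then have "(a, b) \<in> affine_curve \<mu>" using False by (simp add: affine_curve_def)
    moreover have "cproj2_embedding P = affine_embedding a b"
      unfolding P(1) cproj2_embedding_abs[OF P(2)] affine_embedding_def
      using plane_embedding_scale[OF False, of a b 1] by (simp add: XY)
    ultimately show ?thesis using affine_embedding_in_range[of "(a, b)"] by simp
  qed
qed

lemma lift_affine:
  assumes "\<Phi> u = affine_embedding (fst p) (snd p)"
  shows "\<sigma> u \<noteq> 0" "x u = fst p" "y u = snd p"
proof -
  show "\<sigma> u \<noteq> 0" using assms Phi_zero affine_embedding_nonzero by metis
  then show "x u = fst p" "y u = snd p" using assms Phi_affine affine_embedding_inj by metis+
qed

lemma open_nonzero: "open {u. \<sigma> u \<noteq> 0}"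
  using open_Collect_neq[of \<sigma> "\<lambda>_. 0"] holomorphic_on_imp_continuous_on[OF entire] by simp

lemma x_holomorphic: "x holomorphic_on {u. \<sigma> u \<noteq> 0}"
  using deriv_x open_nonzero by (metis (mono_tags, lifting) holomorphic_on_open mem_Collect_eq)

text \<open>The value of dy/du at p; it is also the denominator in the second branch of
  \<open>omega1\<close>.\<close>

definition "y' p = 3 * (fst p)\<^sup>2 + 2 * \<mu> 2 * fst p + \<mu> 4 - m1 * snd p"

lemma deriv_y:
  assumes "\<sigma> u \<noteq> 0" shows "(y has_field_derivative y' (x u, y u)) (at u)"
proof -
  have "(y has_field_derivative (6 * (x u)\<^sup>2 + b2 * x u + b4 - m1 * w u) / 2) (at u)"
    unfolding y_def[abs_def] by (auto intro!: derivative_eq_intros deriv_x deriv_w assms)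
  also have "(6 * (x u)\<^sup>2 + b2 * x u + b4 - m1 * w u) / 2 = y' (x u, y u)"
    unfolding w_eq y'_def b2 b4 by (simp add: power2_eq_square field_simps)
  finally show ?thesis .
qed

lemma y_holomorphic: "y holomorphic_on {u. \<sigma> u \<noteq> 0}"
  using deriv_y open_nonzero by (metis (mono_tags, lifting) holomorphic_on_open mem_Collect_eq)

lemma smooth_point:
  assumes "\<sigma> u \<noteq> 0" "w u = 0" shows "y' (x u, y u) \<noteq> 0"
proof -
  have "6 * (x u)\<^sup>2 + b2 * x u + b4 - m1 * w u = 2 * y' (x u, y u)"
    unfolding w_eq y'_def b2 b4 by (simp add: power2_eq_square algebra_simps)
  then show ?thesis
    using nonsingular[of "x u"] curve_xw[OF assms(1)] assms(2) by auto
qed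

text \<open>Where w or dy/du is nonzero, x or y is a local coordinate, and nonsingularity guarantees
  one of the two cases. The resulting quotients are the two branches of \<open>omega1\<close>: the
  form pulls back to du.\<close>

lemma lift_derivative:
  fixes k :: "real \<Rightarrow> complex" and g :: "real \<Rightarrow> complex \<times> complex"
  assumes k: "isCont k t" and lift: "eventually (\<lambda>s. \<Phi> (k s) = affine_embedding (fst (g s)) (snd (g s))) (nhds t)"
    and g: "(g has_vector_derivative v) (at t)"
  shows "w (k t) \<noteq> 0 \<Longrightarrow> (k has_vector_derivative fst v / w (k t)) (at t)"
    and "y' (g t) \<noteq> 0 \<Longrightarrow> (k has_vector_derivative snd v / y' (g t)) (at t)"
    and "(k has_vector_derivative omega1 \<mu> (g t) v) (at t)"
proof -
  note lt = lift_affine[OF eventually_nhds_x_imp_x[OF lift]]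
  have ev: "eventually (\<lambda>s. x (k s) = fst (g s)) (nhds t)" "eventually (\<lambda>s. y (k s) = snd (g s)) (nhds t)"
    using lift by (auto elim!: eventually_mono dest: lift_affine)
  have "((\<lambda>s. fst (g s)) has_vector_derivative fst v) (at t)"
    using g by (rule bounded_linear.has_vector_derivative[OF bounded_linear_fst])
  then have hx: "((\<lambda>s. x (k s)) has_vector_derivative fst v) (at t)"
    using has_vector_derivative_cong_ev[of UNIV "\<lambda>s. x (k s)" "\<lambda>s. fst (g s)"] ev(1) lt by simp
  have "((\<lambda>s. snd (g s)) has_vector_derivative snd v) (at t)"
    using g by (rule bounded_linear.has_vector_derivative[OF bounded_linear_snd])
  then have hy: "((\<lambda>s. y (k s)) has_vector_derivative snd v) (at t)"
    using has_vector_derivative_cong_ev[of UNIV "\<lambda>s. y (k s)" "\<lambda>s. snd (g s)"] ev(2) lt by simp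
  show 1: "(k has_vector_derivative fst v / w (k t)) (at t)" if "w (k t) \<noteq> 0"
    by (rule has_vector_derivative_lift[OF x_holomorphic open_nonzero _ deriv_x that k hx]) (use lt in auto)
  show 2: "(k has_vector_derivative snd v / y' (g t)) (at t)" if "y' (g t) \<noteq> 0"
  proof (rule has_vector_derivative_lift[OF y_holomorphic open_nonzero _ _ that k hy])
    show "(y has_field_derivative y' (g t)) (at (k t))"
      using deriv_y[OF lt(1)] lt by simp
  qed (use lt in auto)
  show "(k has_vector_derivative omega1 \<mu> (g t) v) (at t)"
  proof (cases "w (k t) = 0")
    case False
    then show ?thesis using 1 lt w_eq[of "k t"] by (cases "g t"; cases v) (simp add: omega1_def)
  next
    case True
    then have "y' (g t) \<noteq> 0" using smooth_point[OF lt(1)] lt by simp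
    then show ?thesis using 2 lt True w_eq[of "k t"] by (cases "g t"; cases v) (simp add: omega1_def y'_def)
  qed
qed

lemma zeros_constant:
  assumes "connected S" "continuous_on S f" "\<And>s. s \<in> S \<Longrightarrow> \<sigma> (f s) = 0" "a \<in> S" "b \<in> S"
  shows "f a = f b"
proof -
  obtain \<delta> where d: "\<delta> > 0" "\<And>l. \<sigma> l = 0 \<Longrightarrow> norm l < \<delta> \<Longrightarrow> l = 0" using zeros_isolated by blast
  have "f constant_on S"
  proof (rule continuous_discrete_range_constant[OF assms(1,2)])
    fix s assume s: "s \<in> S"
    show "\<exists>e>0. \<forall>y. y \<in> S \<and> f y \<noteq> f s \<longrightarrow> e \<le> norm (f y - f s)"
      using d zeros_diff assms(3) s by (intro exI[of _ \<delta>]) (metis linorder_not_less right_minus_eq)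
  qed
  then show ?thesis using assms(4,5) unfolding constant_on_def by metis
qed

lemma lift_path:
  assumes "continuous_on {0..1} \<alpha>" "\<alpha> ` {0..1} \<subseteq> affine_curve \<mu>"
  obtains k where "continuous_on {0..1::real} k" "\<And>t. t \<in> {0..1} \<Longrightarrow> \<Phi> (k t) = affine_embedding (fst (\<alpha> t)) (snd (\<alpha> t))"
proof (rule covering_space_lift[OF covering_Phi, of "{0..1::real}" "\<lambda>t. affine_embedding (fst (\<alpha> t)) (snd (\<alpha> t))"])
  show "simply_connected {0..1::real}" "locally path_connected {0..1::real}"
    by (simp_all add: convex_imp_simply_connected convex_imp_locally_path_connected)
  show "continuous_on {0..1} (\<lambda>t. affine_embedding (fst (\<alpha> t)) (snd (\<alpha> t)))"
    using continuous_on_compose2[OF continuous_affine_embedding assms(1)] by simp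
qed (use assms affine_embedding_in_range that in auto)

text \<open>Along the lift \<open>omega1\<close> becomes du and \<open>eta1\<close> becomes - x du =
  d\<zeta>. The finite set S contains the corners of the path.\<close>

lemma form_integrals:
  assumes \<alpha>: "valid_path \<alpha>" "path_image \<alpha> \<subseteq> affine_curve \<mu>"
    and k: "continuous_on {0..1} k" "\<And>t. t \<in> {0..1} \<Longrightarrow> \<Phi> (k t) = affine_embedding (fst (\<alpha> t)) (snd (\<alpha> t))"
  shows "form_integral (omega1 \<mu>) \<alpha> = k 1 - k 0" "form_integral (eta1 \<mu>) \<alpha> = \<zeta> (k 1) - \<zeta> (k 0)"
proof -
  obtain S where S: "finite S" "\<alpha> C1_differentiable_on ({0..1} - S)"
    using \<alpha>(1) unfolding valid_path_def piecewise_C1_differentiable_on_def by blast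
  define d where "d t = omega1 \<mu> (\<alpha> t) (vector_derivative \<alpha> (at t within {0..1}))" for t
  have nz: "\<sigma> (k t) \<noteq> 0" "x (k t) = fst (\<alpha> t)" if "t \<in> {0..1}" for t
    using lift_affine[OF k(2)[OF that]] by auto
  have dk: "(k has_vector_derivative d t) (at t)" if t: "t \<in> {0<..<1} - S" for t
  proof -
    have "(\<alpha> has_vector_derivative vector_derivative \<alpha> (at t)) (at t)"
      using S(2) t unfolding C1_differentiable_on_eq by (auto simp flip: vector_derivative_works)
    moreover from this have "vector_derivative \<alpha> (at t within {0..1}) = vector_derivative \<alpha> (at t)"
      using t by (intro vector_derivative_at_within_ivl) auto
    moreover have "isCont k t"
      using k(1) t continuous_on_interior[of "{0..1}" k t] by simp
    moreover have "eventually (\<lambda>s. s \<in> {0<..<1}) (nhds t)"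
      using t by (intro eventually_nhds_in_open) auto
    then have "eventually (\<lambda>s. \<Phi> (k s) = affine_embedding (fst (\<alpha> s)) (snd (\<alpha> s))) (nhds t)"
      by eventually_elim (use k(2) in auto)
    ultimately show ?thesis using lift_derivative(3) by (simp add: d_def)
  qed
  have "(d has_integral (k 1 - k 0)) {0..1}"
    by (rule fundamental_theorem_of_calculus_interior_strong[OF S(1) _ dk k(1)]) auto
  then show "form_integral (omega1 \<mu>) \<alpha> = k 1 - k 0"
    unfolding form_integral_def d_def by (rule integral_unique)
  have "((\<lambda>t. - fst (\<alpha> t) * d t) has_integral (\<zeta> (k 1) - \<zeta> (k 0))) {0..1}"
  proof (rule fundamental_theorem_of_calculus_interior_strong[OF S(1)])
    fix t :: real assume t: "t \<in> {0<..<1} - S"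
    have "((\<zeta> \<circ> k) has_vector_derivative d t * (- x (k t))) (at t)"
      using t by (intro field_vector_diff_chain_at dk deriv_zeta nz) auto
    then show "((\<lambda>t. \<zeta> (k t)) has_vector_derivative - fst (\<alpha> t) * d t) (at t)"
      using nz[of t] t by (simp add: o_def mult.commute)
  next
    have "isCont \<zeta> u" if "\<sigma> u \<noteq> 0" for u using deriv_zeta[OF that] DERIV_isCont by blast
    then show "continuous_on {0..1} (\<lambda>t. \<zeta> (k t))"
      using nz by (intro continuous_on_compose2[OF continuous_at_imp_continuous_on k(1), of "{u. \<sigma> u \<noteq> 0}"]) auto
  qed auto
  then show "form_integral (eta1 \<mu>) \<alpha> = \<zeta> (k 1) - \<zeta> (k 0)"
    unfolding form_integral_def eta1_def d_def by (rule integral_unique)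
qed

lemma period_of_loop:
  assumes \<alpha>: "valid_path \<alpha>" "path_image \<alpha> \<subseteq> affine_curve \<mu>" "pathfinish \<alpha> = pathstart \<alpha>"
  shows "quasi_period (form_integral (omega1 \<mu>) \<alpha>) (form_integral (eta1 \<mu>) \<alpha>)"
proof -
  have c: "continuous_on {0..1} \<alpha>" using valid_path_imp_path[OF \<alpha>(1)] by (simp add: path_def)
  obtain k where k: "continuous_on {0..1} k" "\<And>t. t \<in> {0..1} \<Longrightarrow> \<Phi> (k t) = affine_embedding (fst (\<alpha> t)) (snd (\<alpha> t))"
    using lift_path[OF c] \<alpha>(2) unfolding path_image_def by blast
  note I = form_integrals[OF \<alpha>(1,2) k]
  have "\<Phi> (k 0) = \<Phi> (k 1)" using k(2) \<alpha>(3) by (simp add: pathstart_def pathfinish_def)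
  then have "\<sigma> (k 1 - k 0) = 0" by (simp add: Phi_eq_iff)
  then obtain a where a: "quasi_period (k 1 - k 0) a" using zero_imp_quasi_period by blast
  have "\<sigma> (k 0) \<noteq> 0" using lift_affine(1)[OF k(2)[of 0]] by simp
  then have "\<zeta> (k 1) = \<zeta> (k 0) + a" using quasi_period_invariant(3)[OF a, of "k 0"] by simp
  then show ?thesis using a I by simp
qed

text \<open>Continuity of the speed is not visible in \<open>omega1\<close>, whose formula switches
  branches. Near each parameter the speed is identified with one fixed continuous quotient by
  uniqueness of derivatives.\<close>

lemma lift_C1_loop:
  assumes a: "C1_loop \<mu> a"
  obtains A l where "\<And>s. \<Phi> (A s) = affine_embedding (fst (a s)) (snd (a s))"
    "\<And>s. (A has_vector_derivative omega1 \<mu> (a s) (vector_derivative a (at s))) (at s)"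
    "continuous_on UNIV (\<lambda>s. omega1 \<mu> (a s) (vector_derivative a (at s)))"
    "\<And>s. A (s + 1) = A s + l" "\<sigma> l = 0"
proof -
  have C1: "\<And>s. (a has_vector_derivative vector_derivative a (at s)) (at s)"
      "continuous_on UNIV (\<lambda>s. vector_derivative a (at s))"
    and per: "\<And>s. a (s + 1) = a s" and img: "range a \<subseteq> affine_curve \<mu>"
    using a vector_derivative_works unfolding C1_loop_def C1_differentiable_on_eq by auto
  have ca: "continuous_on UNIV a"
    using C1(1) has_vector_derivative_continuous continuous_at_imp_continuous_on by blast
  obtain A where A: "continuous_on UNIV A" "\<And>s. \<Phi> (A s) = affine_embedding (fst (a s)) (snd (a s))"
  proof (rule covering_space_lift[OF covering_Phi, of "UNIV :: real set" "\<lambda>t. affine_embedding (fst (a t)) (snd (a t))"])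
    show "simply_connected (UNIV :: real set)" "locally path_connected (UNIV :: real set)"
      by (simp_all add: convex_imp_simply_connected convex_imp_locally_path_connected)
    show "continuous_on UNIV (\<lambda>t. affine_embedding (fst (a t)) (snd (a t)))"
      using continuous_on_compose2[OF continuous_affine_embedding ca] by simp
  qed (use img affine_embedding_in_range that in auto)
  define l where "l = A 1 - A 0"
  define d where "d s = omega1 \<mu> (a s) (vector_derivative a (at s))" for s
  have "\<sigma> (A (s + 1) - A s) = 0" for s
    using A(2)[of s] A(2)[of "s + 1"] per[of s] by (simp flip: Phi_eq_iff)
  moreover have "continuous_on UNIV (\<lambda>s. A (s + 1) - A s)"
    by (intro continuous_intros continuous_on_compose2[OF A(1)]) auto
  ultimately have const: "A (s + 1) - A s = l" "\<sigma> l = 0" for s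
    using zeros_constant[of UNIV "\<lambda>s. A (s + 1) - A s" s 0] unfolding l_def by (simp, metis add_0)
  have isCont: "isCont A s" for s using A(1) by (simp add: continuous_on_eq_continuous_at)
  have lift: "eventually (\<lambda>s. \<Phi> (A s) = affine_embedding (fst (a s)) (snd (a s))) (nhds s)" for s
    using A(2) by simp
  note dA = lift_derivative[OF isCont lift C1(1)]
  have nz: "\<sigma> (A s) \<noteq> 0" "x (A s) = fst (a s)" "y (A s) = snd (a s)" for s
    using lift_affine[OF A(2)[of s]] by auto
  have w: "w (A s) = 2 * snd (a s) + m1 * fst (a s) + m3" for s
    using w_eq[of "A s"] nz by simp
  have cw: "continuous_on UNIV (\<lambda>s. w (A s))" "continuous_on UNIV (\<lambda>s. y' (a s))"
    unfolding w y'_def by (intro continuous_intros ca)+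
  have "isCont d s" for s
  proof (cases "w (A s) = 0")
    case False
    then have ev: "eventually (\<lambda>s. w (A s) \<noteq> 0) (nhds s)"
      by (rule eventually_nonzero[OF cw(1)])
    have "eventually (\<lambda>s. d s = fst (vector_derivative a (at s)) / w (A s)) (nhds s)"
      using ev by eventually_elim (metis dA(1,3) d_def vector_derivative_unique_at)
    moreover have "isCont (\<lambda>s. fst (vector_derivative a (at s)) / w (A s)) s"
      using C1(2) cw(1) False by (auto simp: continuous_on_eq_continuous_at intro!: continuous_intros)
    ultimately show ?thesis by (rule isCont_cong[THEN iffD2])
  next
    case True
    then have nz': "y' (a s) \<noteq> 0" using smooth_point[OF nz(1)[of s]] nz[of s] by simp
    then have ev: "eventually (\<lambda>s. y' (a s) \<noteq> 0) (nhds s)"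
      by (rule eventually_nonzero[OF cw(2)])
    have "eventually (\<lambda>s. d s = snd (vector_derivative a (at s)) / y' (a s)) (nhds s)"
      using ev by eventually_elim (metis dA(2,3) d_def vector_derivative_unique_at)
    moreover have "isCont (\<lambda>s. snd (vector_derivative a (at s)) / y' (a s)) s"
      using C1(2) cw(2) nz' by (auto simp: continuous_on_eq_continuous_at intro!: continuous_intros)
    ultimately show ?thesis by (rule isCont_cong[THEN iffD2])
  qed
  then have "continuous_on UNIV d" by (simp add: continuous_at_imp_continuous_on)
  moreover have "A (s + 1) = A s + l" for s using const(1)[of s] by (simp add: algebra_simps)
  ultimately show ?thesis
    using that[of A l] A(2) dA(3) const(2) unfolding d_def by blast
qed

text \<open>The homotopy lifts to k. The displacement k (r, 1) - k (r, 0) is always a zero of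
  \<sigma>, hence constant in r; at r = 1 the lift differs from A by a constant, so the displacement
  there is l.\<close>

lemma homotopic_loops_same_period:
  assumes \<alpha>: "valid_path \<alpha>" "path_image \<alpha> \<subseteq> affine_curve \<mu>"
    and A: "continuous_on UNIV A" "\<And>s. \<Phi> (A s) = affine_embedding (fst (a s)) (snd (a s))" "\<And>s. A (s + 1) = A s + l"
    and hom: "homotopic_loops (proj_curve \<mu>) (affine_pt \<circ> \<alpha>) (affine_pt \<circ> a)"
  shows "l = form_integral (omega1 \<mu>) \<alpha>"
proof -
  have c: "continuous_on {0..1} \<alpha>" using valid_path_imp_path[OF \<alpha>(1)] by (simp add: path_def)
  obtain k0 where k0: "continuous_on {0..1} k0" "\<And>t. t \<in> {0..1} \<Longrightarrow> \<Phi> (k0 t) = affine_embedding (fst (\<alpha> t)) (snd (\<alpha> t))"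
    using lift_path[OF c] \<alpha>(2) unfolding path_image_def by blast
  obtain h where h: "continuous_on ({0..1::real} \<times> {0..1::real}) h" "h \<in> ({0..1} \<times> {0..1}) \<rightarrow> proj_curve \<mu>"
    "\<And>t. t \<in> {0..1} \<Longrightarrow> h (0, t) = affine_pt (\<alpha> t)" "\<And>t. t \<in> {0..1} \<Longrightarrow> h (1, t) = affine_pt (a t)"
    "\<And>r. r \<in> {0..1} \<Longrightarrow> h (r, 1) = h (r, 0)"
    using hom unfolding homotopic_loops by (auto simp: pathfinish_def pathstart_def)
  obtain k where k: "continuous_on ({0..1} \<times> {0..1}) k" "\<And>t. t \<in> {0..1} \<Longrightarrow> k (0, t) = k0 t"
    "\<And>z. z \<in> {0..1} \<times> {0..1} \<Longrightarrow> cproj2_embedding (h z) = \<Phi> (k z)"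
  proof (rule covering_space_lift_homotopy[OF covering_Phi, of "{0..1}" "\<lambda>z. cproj2_embedding (h z)" k0])
    show "continuous_on ({0..1} \<times> {0..1}) (\<lambda>z. cproj2_embedding (h z))"
      using continuous_on_compose2[OF continuous_cproj2_embedding h(1)] by simp
    show "(\<lambda>z. cproj2_embedding (h z)) \<in> {0..1} \<times> {0..1} \<rightarrow> range \<Phi>"
      using h(2) cproj2_embedding_in_range by blast
    show "\<And>t. t \<in> {0..1} \<Longrightarrow> cproj2_embedding (h (0, t)) = \<Phi> (k0 t)"
      using h(3) k0(2) cproj2_embedding_affine by simp
  qed (use k0 that in auto)
  have e1: "k (0, 1) - k (0, 0) = k (1, 1) - k (1, 0)"
  proof (rule zeros_constant[of "{0..1::real}" "\<lambda>r. k (r, 1) - k (r, 0)"])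
    show "continuous_on {0..1} (\<lambda>r. k (r, 1) - k (r, 0))"
      by (intro continuous_intros continuous_on_compose2[OF k(1)]) auto
    show "\<sigma> (k (r, 1) - k (r, 0)) = 0" if "r \<in> {0..1}" for r
      using k(3)[of "(r, 0)"] k(3)[of "(r, 1)"] h(5)[OF that] that by (simp flip: Phi_eq_iff)
  qed auto
  have "k (1, 0) - A 0 = k (1, 1) - A 1"
  proof (rule zeros_constant[of "{0..1::real}" "\<lambda>t. k (1, t) - A t"])
    show "continuous_on {0..1} (\<lambda>t. k (1, t) - A t)"
      by (intro continuous_intros continuous_on_compose2[OF k(1)] continuous_on_subset[OF A(1)]) auto
    show "\<sigma> (k (1, t) - A t) = 0" if "t \<in> {0..1}" for t
      using k(3)[of "(1, t)"] h(4)[OF that] that A(2)[of t] cproj2_embedding_affine[of "a t"] by (simp flip: Phi_eq_iff)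
  qed auto
  then have "k (1, 1) - k (1, 0) = A 1 - A 0" by (simp add: algebra_simps)
  then have "k0 1 - k0 0 = l"
    using A(3)[of 0] k(2)[of 0] k(2)[of 1] e1 by simp
  then show ?thesis using form_integrals(1)[OF \<alpha> k0] by simp
qed

end

section \<open>The Legendre relation\<close>

lemma Ln_times_minus_ii: "Re z > 0 \<Longrightarrow> Ln (- (\<i> * z)) = Ln z - \<i> * pi / 2"
  using Ln_times_ii[of "- (\<i> * z)"] by (cases "z = 0") (auto simp: algebra_simps)

lemma Ln_times_ii_right: "Re z > 0 \<Longrightarrow> Ln (\<i> * z) = Ln z + \<i> * pi / 2"
  using Ln_times_ii[of z] by (cases "z = 0") auto

text \<open>The two branches of the logarithm have their cuts on opposite halves of the imaginary
  axis. From the left to the right half plane they pass the origin on opposite sides, so their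
  increments differ by a full turn, with sign given by \<epsilon>.\<close>

lemma Ln_rotation_jump:
  assumes "Re p > 0" "Re q < 0" "\<epsilon> = 1 \<or> \<epsilon> = (-1 :: real)"
  shows "(Ln (p / (\<i> * \<epsilon>)) - Ln (q / (\<i> * \<epsilon>))) - (Ln (p / (- (\<i> * \<epsilon>))) - Ln (q / (- (\<i> * \<epsilon>)))) = - 2 * pi * \<i> * \<epsilon>"
proof -
  define r where "r = - q"
  have r: "Re r > 0" using assms by (simp add: r_def)
  note L = Ln_times_minus_ii[OF assms(1)] Ln_times_minus_ii[OF r] Ln_times_ii_right[OF assms(1)] Ln_times_ii_right[OF r]
  from assms(3) show ?thesis
  proof
    assume \<epsilon>: "\<epsilon> = 1"
    have "p / (\<i> * \<epsilon>) = - (\<i> * p)" "q / (\<i> * \<epsilon>) = \<i> * r" "p / (- (\<i> * \<epsilon>)) = \<i> * p" "q / (- (\<i> * \<epsilon>)) = - (\<i> * r)"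
      by (simp_all add: \<epsilon> r_def field_simps)
    then show ?thesis by (simp only: L) (simp add: \<epsilon> algebra_simps)
  next
    assume \<epsilon>: "\<epsilon> = - 1"
    have "p / (\<i> * \<epsilon>) = \<i> * p" "q / (\<i> * \<epsilon>) = - (\<i> * r)" "p / (- (\<i> * \<epsilon>)) = - (\<i> * p)" "q / (- (\<i> * \<epsilon>)) = \<i> * r"
      by (simp_all add: \<epsilon> r_def field_simps)
    then show ?thesis by (simp only: L) (simp add: \<epsilon> algebra_simps)
  qed
qed

lemma linear_approximation:
  fixes f :: "real \<Rightarrow> complex"
  assumes "(f has_vector_derivative f') (at a)" "e > 0"
  obtains d where "d > 0" "\<And>t. \<bar>t - a\<bar> < d \<Longrightarrow> norm (f t - f a - of_real (t - a) * f') \<le> e * \<bar>t - a\<bar>"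
proof -
  obtain d where d: "d > 0" "\<And>t. norm (t - a) < d \<Longrightarrow> norm (f t - f a - (t - a) *\<^sub>R f') \<le> e * norm (t - a)"
    using assms unfolding has_vector_derivative_def has_derivative_at_alt by blast
  show ?thesis
    by (rule that[OF d(1)]) (use d(2) in \<open>simp add: scaleR_conv_of_real\<close>)
qed

text \<open>J may take any value on D itself; only the one-sided limits there are compared with the
  constant values in between. The induction splits off the largest point of D.\<close>

lemma step_function_increment:
  fixes J :: "real \<Rightarrow> complex"
  assumes "finite D" "D \<subseteq> {a<..<b}" "a \<le> b"
    and "\<And>s. s \<in> {a..b} - D \<Longrightarrow> \<forall>\<^sub>F s' in at s. J s = J s'"
    and "\<And>s. s \<in> D \<Longrightarrow> \<exists>L1 L2. (J \<longlongrightarrow> L1) (at_right s) \<and> (J \<longlongrightarrow> L2) (at_left s) \<and> L1 - L2 = j s"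
  shows "J b - J a = (\<Sum>s\<in>D. j s)"
proof -
  have const: "J u = J v" if "u \<in> I" "v \<in> I" "connected I" "\<And>s. s \<in> I \<Longrightarrow> \<forall>\<^sub>F s' in at s. J s = J s'" for u v and I :: "real set"
    by (rule connected_local_const[OF that(3,1,2)]) (use that(4) in \<open>blast intro: filter_leD[OF at_le[OF subset_UNIV]]\<close>)
  show ?thesis
    using assms
  proof (induction D arbitrary: b rule: finite_linorder_max_induct)
    case empty
    then have "J b = J a" by (intro const[of b "{a..b}" a]) auto
    then show ?case by simp
  next
    case (insert d D)
    note lc = insert.prems(3) and jump = insert.prems(4)
    have d: "a < d" "d < b" using insert.prems(1) by auto
    \<comment> \<open>The jump preceding d, or a if there is none; n is a point strictly between the
      two where the induction hypothesis is evaluated.\<close>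
    define m where "m = Max (insert a D)"
    have m: "a \<le> m" "m < d" "\<And>s. s \<in> D \<Longrightarrow> s \<le> m"
      using insert.hyps d unfolding m_def by auto
    define n where "n = (m + d) / 2"
    have n: "m < n" "n < d" using m by (auto simp: n_def)
    have IH: "J n - J a = (\<Sum>s\<in>D. j s)"
    proof (rule insert.IH)
      show "D \<subseteq> {a<..<n}" using insert.prems(1) m(3) n by force
      show "a \<le> n" using m n by linarith
      show "\<forall>\<^sub>F s' in at s. J s = J s'" if "s \<in> {a..n} - D" for s
        by (rule lc) (use that n d in auto)
    qed (use jump in blast)
    obtain L1 L2 where L: "(J \<longlongrightarrow> L1) (at_right d)" "(J \<longlongrightarrow> L2) (at_left d)" "L1 - L2 = j d"
      using jump[of d] by auto
    have R: "J s = J b" if "s \<in> {d<..b}" for s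
      by (rule const[of _ "{d<..b}"]) (use that d insert.hyps m in \<open>auto intro!: lc connected_Ioc\<close>)
    have Lf: "J s = J n" if "s \<in> {m<..<d}" for s
      by (rule const[of _ "{m<..<d}"]) (use that d n insert.hyps m in \<open>force intro!: lc\<close>)+
    have "\<forall>\<^sub>F s in at_right d. J b = J s"
      unfolding eventually_at_right_field using d by (intro exI[of _ b]) (auto intro!: R[symmetric])
    then have "(J \<longlongrightarrow> J b) (at_right d)"
      by (rule Lim_transform_eventually[OF tendsto_const])
    then have "L1 = J b" by (rule tendsto_unique[OF trivial_limit_at_right_real L(1)])
    moreover have "\<forall>\<^sub>F s in at_left d. J n = J s"
      unfolding eventually_at_left_field using m by (intro exI[of _ m]) (auto intro!: Lf[symmetric])
    then have "(J \<longlongrightarrow> J n) (at_left d)"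
      by (rule Lim_transform_eventually[OF tendsto_const])
    then have "L2 = J n" by (rule tendsto_unique[OF trivial_limit_at_left_real L(2)])
    ultimately have "J b - J n = j d" using L(3) by simp
    moreover have "(\<Sum>s\<in>insert d D. j s) = j d + (\<Sum>s\<in>D. j s)"
      using insert.hyps by (intro sum.insert) auto
    ultimately show ?case using IH by (simp add: algebra_simps)
  qed
qed

lemma quasi_periodic_derivative:
  fixes f :: "real \<Rightarrow> 'a::real_normed_vector"
  assumes f: "\<And>s. (f has_vector_derivative f' s) (at s)" and per: "\<And>s. f (s + 1) = f s + l"
  shows "f' (s + 1) = f' s"
proof -
  have "((\<lambda>s. s + 1) has_vector_derivative 1) (at s)"
    by (auto intro!: derivative_eq_intros)
  from vector_diff_chain_at[OF this f] have "((\<lambda>s. f s + l) has_vector_derivative f' (s + 1)) (at s)"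
    by (simp add: o_def per)
  moreover have "((\<lambda>s. f s + l) has_vector_derivative f' s) (at s)"
    using has_vector_derivative_add[OF f has_vector_derivative_const[of l]] by simp
  ultimately show ?thesis by (rule vector_derivative_unique_at)
qed

text \<open>By continuity nearby values differ by less than 1 < 2 pi, and then equal exponentials
  come from equal arguments.\<close>

lemma exp_const_imp_locally_const:
  fixes J :: "'a::t2_space \<Rightarrow> complex"
  assumes "isCont J s" "\<forall>\<^sub>F s' in at s. exp (J s') = exp (J s)"
  shows "\<forall>\<^sub>F s' in at s. J s = J s'"
proof -
  have "\<forall>\<^sub>F s' in at s. dist (J s') (J s) < 1"
    using assms(1) unfolding isCont_def by (rule tendstoD) simp
  with assms(2) show ?thesis
  proof eventually_elim
    fix s' assume e: "exp (J s') = exp (J s)" and d: "dist (J s') (J s) < 1"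
    show "J s = J s'"
    proof (rule exp_complex_eqI)
      have "\<bar>Im (J s - J s')\<bar> < 1"
        using d abs_Im_le_cmod[of "J s - J s'"] by (simp add: dist_norm norm_minus_commute)
      then show "\<bar>Im (J s) - Im (J s')\<bar> < 2 * pi" using pi_gt3 by simp
    qed (use e in simp)
  qed
qed

section \<open>The winding integral and its jumps\<close>

locale two_lifts = sigma_function +
  fixes A B A' B' :: "real \<Rightarrow> complex"
  assumes A: "\<And>s. (A has_vector_derivative A' s) (at s)"
    and B: "\<And>t. (B has_vector_derivative B' t) (at t)" and B': "continuous_on UNIV B'"
begin

definition "crossing s t \<longleftrightarrow> \<sigma> (B t - A s) = 0"
text \<open>As \<zeta> = \<sigma>'/\<sigma>, this is the change of log \<sigma> (B t - A s) for t
  from l to r, as long as there is no crossing.\<close>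

definition "wind l r s = integral {l..r} (\<lambda>t. \<zeta> (B t - A s) * B' t)"
definition "sg s t = sgn (Im (cnj (A' s) * B' t))"

text \<open>At s0 itself the integrand may be singular, so only punctured neighbourhoods and
  one-sided limits occur.\<close>

definition "has_jump s0 l r J \<longleftrightarrow> (\<forall>\<^sub>F s in at s0. \<forall>t\<in>{l..r}. \<not> crossing s t) \<and>
   (\<exists>L1 L2. (wind l r \<longlongrightarrow> L1) (at_right s0) \<and> (wind l r \<longlongrightarrow> L2) (at_left s0) \<and> L1 - L2 = J)"

lemma contA: "continuous_on S A" and contB: "continuous_on S B" and contB': "continuous_on S B'"
  by (intro continuous_at_imp_continuous_on ballI has_vector_derivative_continuous[OF A]
      has_vector_derivative_continuous[OF B] continuous_on_subset[OF B'] subset_UNIV)+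

lemma cont_zeta: "continuous_on {u. \<sigma> u \<noteq> 0} \<zeta>"
  by (rule continuous_at_imp_continuous_on) (auto intro: DERIV_isCont[OF deriv_zeta])

lemma cont_sigma: "continuous_on S \<sigma>"
  by (rule continuous_on_subset[OF holomorphic_on_imp_continuous_on[OF entire] subset_UNIV])

lemma cont_integrand:
  assumes "\<And>t. t \<in> {l..r} \<Longrightarrow> \<not> crossing s t"
  shows "continuous_on {l..r} (\<lambda>t. \<zeta> (B t - A s) * B' t)"
  by (intro continuous_intros contB' continuous_on_compose2[OF cont_zeta] contB)
    (use assms in \<open>auto simp: crossing_def\<close>)

lemma wind_add:
  assumes "l \<le> m" "m \<le> r" "\<And>t. t \<in> {l..r} \<Longrightarrow> \<not> crossing s t"
  shows "wind l r s = wind l m s + wind m r s"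
  unfolding wind_def using assms
  by (intro Henstock_Kurzweil_Integration.integral_combine[symmetric] integrable_continuous_real cont_integrand) auto

lemma has_jump_add:
  assumes "l \<le> m" "m \<le> r" and 1: "has_jump s0 l m J1" and 2: "has_jump s0 m r J2"
  shows "has_jump s0 l r (J1 + J2)"
proof -
  obtain L1 L2 where L: "(wind l m \<longlongrightarrow> L1) (at_right s0)" "(wind l m \<longlongrightarrow> L2) (at_left s0)" "L1 - L2 = J1"
    and n1: "\<forall>\<^sub>F s in at s0. \<forall>t\<in>{l..m}. \<not> crossing s t"
    using 1 unfolding has_jump_def by blast
  obtain M1 M2 where M: "(wind m r \<longlongrightarrow> M1) (at_right s0)" "(wind m r \<longlongrightarrow> M2) (at_left s0)" "M1 - M2 = J2"
    and n2: "\<forall>\<^sub>F s in at s0. \<forall>t\<in>{m..r}. \<not> crossing s t"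
    using 2 unfolding has_jump_def by blast
  have n: "\<forall>\<^sub>F s in at s0. \<forall>t\<in>{l..r}. \<not> crossing s t"
    using n1 n2 by eventually_elim (use assms(1,2) in force)
  then have e: "\<forall>\<^sub>F s in at s0. wind l m s + wind m r s = wind l r s"
    by eventually_elim (use wind_add[OF assms(1,2)] in metis)
  have "(wind l r \<longlongrightarrow> L1 + M1) (at_right s0)"
    by (rule Lim_transform_eventually[OF tendsto_add[OF L(1) M(1)] filter_leD[OF at_le[OF subset_UNIV] e]])
  moreover have "(wind l r \<longlongrightarrow> L2 + M2) (at_left s0)"
    by (rule Lim_transform_eventually[OF tendsto_add[OF L(2) M(2)] filter_leD[OF at_le[OF subset_UNIV] e]])
  moreover have "(L1 + M1) - (L2 + M2) = J1 + J2" by (simp flip: L(3) M(3))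
  ultimately show ?thesis using n unfolding has_jump_def by blast
qed

lemma no_crossing_nhds:
  assumes "\<And>t. t \<in> {l..r} \<Longrightarrow> \<not> crossing s0 t"
  obtains e where "e > 0" "\<And>s t. \<bar>s - s0\<bar> \<le> e \<Longrightarrow> t \<in> {l..r} \<Longrightarrow> \<not> crossing s t"
proof -
  define K where "K = {s0} \<times> {l..r}"
  define U where "U = {p. \<sigma> (B (snd p) - A (fst p)) \<noteq> 0}"
  have "open U" unfolding U_def
    by (intro open_Collect_neq continuous_on_compose2[OF cont_sigma[of UNIV]] continuous_intros
       continuous_on_compose2[OF contA[of UNIV]] continuous_on_compose2[OF contB[of UNIV]]) auto
  moreover have "compact K" by (auto simp: K_def intro: compact_Times)
  moreover have "K \<subseteq> U" using assms by (auto simp: K_def U_def crossing_def)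
  ultimately obtain e where e: "e > 0" "(\<Union>x\<in>K. ball x e) \<subseteq> U"
    using compact_subset_open_imp_ball_epsilon_subset by metis
  show ?thesis
  proof (rule that[of "e / 2"])
    fix s t assume s: "\<bar>s - s0\<bar> \<le> e / 2" and t: "t \<in> {l..r}"
    have "(s, t) \<in> ball (s0, t) e"
      using s e(1) by (simp add: dist_prod_def dist_real_def abs_minus_commute)
    moreover have "(s0, t) \<in> K" using t by (simp add: K_def)
    ultimately have "(s, t) \<in> U" using e(2) by blast
    then show "\<not> crossing s t" by (simp add: U_def crossing_def)
  qed (use e in simp)
qed

lemma wind_continuous:
  assumes "\<And>t. t \<in> {l..r} \<Longrightarrow> \<not> crossing s0 t"
  shows "isCont (wind l r) s0"
proof -
  obtain e where e: "e > 0" "\<And>s t. \<bar>s - s0\<bar> \<le> e \<Longrightarrow> t \<in> {l..r} \<Longrightarrow> \<not> crossing s t"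
    using no_crossing_nhds[OF assms] by blast
  have "continuous_on {s0 - e..s0 + e} (\<lambda>s. integral (cbox l r) (\<lambda>t. \<zeta> (B t - A s) * B' t))"
  proof (rule integral_continuous_on_param)
    have "continuous_on ({s0 - e..s0 + e} \<times> cbox l r) (\<lambda>p. \<zeta> (B (snd p) - A (fst p)) * B' (snd p))"
      by (intro continuous_intros continuous_on_compose2[OF cont_zeta] continuous_on_compose2[OF contA[of UNIV]]
          continuous_on_compose2[OF contB[of UNIV]] continuous_on_compose2[OF contB'[of UNIV]])
        (use e(2) in \<open>auto simp: crossing_def abs_le_iff\<close>)
    then show "continuous_on ({s0 - e..s0 + e} \<times> cbox l r) (\<lambda>(s, t). \<zeta> (B t - A s) * B' t)"
      by (simp add: case_prod_unfold)
  qed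
  then have "continuous_on {s0 - e..s0 + e} (wind l r)" by (simp add: wind_def[abs_def])
  then show ?thesis using e(1) by (intro continuous_on_interior[of "{s0 - e..s0 + e}"]) auto
qed

lemma has_jump_0:
  assumes "\<And>t. t \<in> {l..r} \<Longrightarrow> \<not> crossing s0 t"
  shows "has_jump s0 l r 0"
proof -
  obtain e where e: "e > 0" "\<And>s t. \<bar>s - s0\<bar> \<le> e \<Longrightarrow> t \<in> {l..r} \<Longrightarrow> \<not> crossing s t"
    using no_crossing_nhds[OF assms] by blast
  have "(wind l r \<longlongrightarrow> wind l r s0) (at s0)"
    using wind_continuous[OF assms] by (simp add: isCont_def)
  then have "(wind l r \<longlongrightarrow> wind l r s0) (at_right s0)" "(wind l r \<longlongrightarrow> wind l r s0) (at_left s0)"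
    by (auto intro: filterlim_mono at_le)
  moreover have "\<forall>\<^sub>F s in at s0. \<forall>t\<in>{l..r}. \<not> crossing s t"
    unfolding eventually_at using e by (intro exI[of _ e]) (auto simp: dist_real_def)
  ultimately show ?thesis unfolding has_jump_def by (metis diff_self)
qed

lemma wind_primitive:
  assumes "l \<le> r" "\<And>t. t \<in> {l..r} \<Longrightarrow> (\<phi> has_field_derivative \<zeta> (B t - A s)) (at (B t - A s))"
  shows "wind l r s = \<phi> (B r - A s) - \<phi> (B l - A s)"
proof -
  have "((\<lambda>t. \<zeta> (B t - A s) * B' t) has_integral (\<phi> (B r - A s) - \<phi> (B l - A s))) {l..r}"
  proof (rule fundamental_theorem_of_calculus[OF assms(1)])
    fix t assume t: "t \<in> {l..r}"
    have "((\<lambda>t. B t - A s) has_vector_derivative B' t) (at t)"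
      using has_vector_derivative_diff[OF B has_vector_derivative_const[of "A s"]] by simp
    then have "((\<phi> \<circ> (\<lambda>t. B t - A s)) has_vector_derivative B' t * \<zeta> (B t - A s)) (at t)"
      by (rule field_vector_diff_chain_at) (rule assms(2)[OF t])
    then show "((\<lambda>t. \<phi> (B t - A s)) has_vector_derivative \<zeta> (B t - A s) * B' t) (at t within {l..r})"
      by (simp add: o_def mult.commute has_vector_derivative_at_within)
  qed
  then show ?thesis unfolding wind_def by (rule integral_unique)
qed

text \<open>The zero is simple, so \<sigma> u = (u - z) g u with g nonzero near z, and \<zeta> =
  1/(u - z) + g'/g. The function q is a primitive of the regular part, and c rotates the cut of the
  logarithm.\<close>

lemma zeta_primitive:
  assumes z: "\<sigma> z = 0"
  obtains \<rho> q where "\<rho> > 0" "continuous_on (ball z \<rho>) q"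
    "\<And>u c. u \<in> ball z \<rho> \<Longrightarrow> c \<noteq> 0 \<Longrightarrow> (u - z) / c \<notin> \<real>\<^sub>\<le>\<^sub>0 \<Longrightarrow>
       ((\<lambda>u. Ln ((u - z) / c) + q u) has_field_derivative \<zeta> u) (at u)"
    "\<And>u. u \<in> ball z \<rho> \<Longrightarrow> u \<noteq> z \<Longrightarrow> \<sigma> u \<noteq> 0"
proof -
  define g where "g u = (if u = z then deriv \<sigma> z else \<sigma> u / (u - z))" for u
  have g: "g holomorphic_on UNIV"
    by (rule pole_theorem_open_0[OF entire open_UNIV, of z]) (auto simp: g_def z)
  have gz: "g z \<noteq> 0" using simple_zero[OF z] by (simp add: g_def)
  have sg: "\<sigma> u = (u - z) * g u" for u by (simp add: g_def z)
  have "isCont g z" using holomorphic_on_imp_continuous_on[OF g] by (simp add: continuous_on_eq_continuous_at)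
  then obtain \<rho> where \<rho>: "\<rho> > 0" "\<And>u. dist z u < \<rho> \<Longrightarrow> g u \<noteq> 0"
    using continuous_at_avoid[of z g 0] gz by blast
  have hol: "(\<lambda>u. deriv g u / g u) holomorphic_on ball z \<rho>"
    using \<rho>(2) by (intro holomorphic_intros holomorphic_on_subset[OF holomorphic_deriv[OF g open_UNIV]]
        holomorphic_on_subset[OF g]) auto
  obtain q where q: "\<And>u. u \<in> ball z \<rho> \<Longrightarrow> (q has_field_derivative deriv g u / g u) (at u within ball z \<rho>)"
  proof (rule holomorphic_convex_primitive'[OF convex_ball open_ball hol])
    fix q assume *: "\<And>u. u \<in> ball z \<rho> \<Longrightarrow> (q has_field_derivative deriv g u / g u) (at u within ball z \<rho>)"
    show thesis by (rule that[OF *])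
  qed
  have q': "(q has_field_derivative deriv g u / g u) (at u)" if "u \<in> ball z \<rho>" for u
    using q[OF that] unfolding at_within_open[OF that open_ball] .
  show ?thesis
  proof (rule that[OF \<rho>(1), of q])
    show "continuous_on (ball z \<rho>) q"
      by (rule continuous_at_imp_continuous_on, rule ballI, rule DERIV_isCont, rule q')
    show nz: "\<sigma> u \<noteq> 0" if "u \<in> ball z \<rho>" "u \<noteq> z" for u
      using that \<rho>(2)[of u] by (simp add: sg)
    fix u c assume u: "u \<in> ball z \<rho>" and c: "c \<noteq> 0" "(u - z) / c \<notin> \<real>\<^sub>\<le>\<^sub>0"
    then have uz: "u \<noteq> z" by auto
    have gu: "g u \<noteq> 0" using \<rho>(2)[of u] u by simp
    have "((\<lambda>u. Ln ((u - z) / c) + q u) has_field_derivative (1 / c) / ((u - z) / c) + deriv g u / g u) (at u)"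
    proof (rule DERIV_add[OF _ q'[OF u]])
      have "((\<lambda>u. (u - z) / c) has_field_derivative 1 / c) (at u)"
        using c(1) by (auto intro!: derivative_eq_intros)
      from DERIV_chain2[OF has_field_derivative_Ln[OF c(2)] this]
      show "((\<lambda>u. Ln ((u - z) / c)) has_field_derivative (1 / c) / ((u - z) / c)) (at u)"
        by (simp add: divide_inverse mult.commute)
    qed
    also have "(1 / c) / ((u - z) / c) + deriv g u / g u = \<zeta> u"
    proof -
      have "(\<sigma> has_field_derivative g u + (u - z) * deriv g u) (at u)"
        unfolding sg[abs_def] by (auto intro!: derivative_eq_intros holomorphic_derivI[OF g open_UNIV])
      then have "deriv \<sigma> u = g u + (u - z) * deriv g u" by (rule DERIV_imp_deriv)
      then show ?thesis
        using c uz gu by (simp add: \<zeta>_def sg field_simps)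
    qed
    finally show "((\<lambda>u. Ln ((u - z) / c) + q u) has_field_derivative \<zeta> u) (at u)" .
  qed
qed

text \<open>For s on either side of s0 the short arc t -> B t - A s passes the zero z0 on opposite
  sides. On each side a logarithm whose cut avoids the arc gives a primitive of \<zeta>, and the
  jump is the difference of the two branches.\<close>

lemma has_jump_local:
  assumes c: "crossing s0 t0" and tr: "Im (cnj (A' s0) * B' t0) \<noteq> 0"
  obtains \<delta>0 where "\<delta>0 > 0"
    "\<And>\<delta>. 0 < \<delta> \<Longrightarrow> \<delta> \<le> \<delta>0 \<Longrightarrow> has_jump s0 (t0 - \<delta>) (t0 + \<delta>) (- 2 * pi * \<i> * sg s0 t0)"
proof -
  \<comment> \<open>Division by b = B'(t0) makes the arc run in the real direction, while s moves it
    by -\<kappa>. Transversality means that Im \<kappa> is nonzero, and the crossing sign is the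
    sign of - Im \<kappa>.\<close>
  define b \<kappa> \<epsilon> z0 where "b = B' t0" and "\<kappa> = A' s0 / b" and "\<epsilon> = sg s0 t0" and "z0 = B t0 - A s0"
  have b: "b \<noteq> 0" using tr by (auto simp: b_def)
  have "A' s0 = \<kappa> * b" using b by (simp add: \<kappa>_def)
  then have "cnj (A' s0) * b = cnj \<kappa> * (b * cnj b)" by simp
  then have Im_eq: "Im (cnj (A' s0) * B' t0) = - Im \<kappa> * (norm b)\<^sup>2"
    unfolding b_def[symmetric] complex_norm_square[symmetric] by simp
  then have k: "Im \<kappa> \<noteq> 0" using tr by auto
  have \<epsilon>: "\<epsilon> = 1 \<or> \<epsilon> = - 1" using tr by (auto simp: \<epsilon>_def sg_def sgn_if)
  have \<epsilon>k: "\<epsilon> * Im \<kappa> = - \<bar>Im \<kappa>\<bar>"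
    unfolding \<epsilon>_def sg_def Im_eq using b k by (auto simp: sgn_if mult_less_0_iff zero_less_mult_iff)
  \<comment> \<open>The admissible relative error of the linear approximations. The bound 1/2 yields
    |t - t0| \<le> (2 |\<kappa>| + 1) |s - s0| where Re P = 0; the other bound then keeps the error
    below |Im \<kappa>| |s - s0|, so the sign of Im P is decided.\<close>
  define e0 where "e0 = min (1 / 2) (\<bar>Im \<kappa>\<bar> / (2 * (2 * norm \<kappa> + 2)))"
  have nk: "2 * norm \<kappa> + 2 > 0" by (simp add: add_nonneg_pos)
  have e0: "e0 > 0" "e0 \<le> 1 / 2" "e0 * (2 * norm \<kappa> + 2) < \<bar>Im \<kappa>\<bar>"
  proof -
    show "e0 > 0" using k nk unfolding e0_def by (simp only: min_less_iff_conj) (simp add: divide_pos_pos)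
    show "e0 \<le> 1 / 2" unfolding e0_def by (rule min.cobounded1)
    have half: "a / (2 * n) * n = a / 2" if "n > 0" for a n :: real using that by (simp add: field_simps)
    have "e0 * (2 * norm \<kappa> + 2) \<le> \<bar>Im \<kappa>\<bar> / (2 * (2 * norm \<kappa> + 2)) * (2 * norm \<kappa> + 2)"
      using nk by (intro mult_right_mono) (auto simp: e0_def)
    also have "\<dots> = \<bar>Im \<kappa>\<bar> / 2" by (rule half) (rule nk)
    finally show "e0 * (2 * norm \<kappa> + 2) < \<bar>Im \<kappa>\<bar>" using k by simp
  qed
  have eb: "e0 * norm b > 0" using e0 b by simp
  obtain d1 where d1: "d1 > 0" "\<And>t. \<bar>t - t0\<bar> < d1 \<Longrightarrow> norm (B t - B t0 - of_real (t - t0) * b) \<le> e0 * norm b * \<bar>t - t0\<bar>"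
    using linear_approximation[OF B eb] unfolding b_def by blast
  obtain d2 where d2: "d2 > 0" "\<And>s. \<bar>s - s0\<bar> < d2 \<Longrightarrow> norm (A s - A s0 - of_real (s - s0) * A' s0) \<le> e0 * norm b * \<bar>s - s0\<bar>"
    using linear_approximation[OF A eb] by blast
  define P where "P s t = (B t - A s - z0) / b" for s t
  have P: "norm (P s t - (of_real (t - t0) - \<kappa> * of_real (s - s0))) \<le> e0 * (\<bar>t - t0\<bar> + \<bar>s - s0\<bar>)"
    if "\<bar>t - t0\<bar> < d1" "\<bar>s - s0\<bar> < d2" for s t
  proof -
    have "P s t - (of_real (t - t0) - \<kappa> * of_real (s - s0))
      = ((B t - B t0 - of_real (t - t0) * b) - (A s - A s0 - of_real (s - s0) * A' s0)) / b"
      using b by (simp add: P_def z0_def \<kappa>_def field_simps)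
    moreover have "norm ((B t - B t0 - of_real (t - t0) * b) - (A s - A s0 - of_real (s - s0) * A' s0))
       \<le> e0 * norm b * \<bar>t - t0\<bar> + e0 * norm b * \<bar>s - s0\<bar>"
      by (rule norm_triangle_le_diff) (intro add_mono d1 d2 that)
    ultimately have "norm (P s t - (of_real (t - t0) - \<kappa> * of_real (s - s0)))
        \<le> (e0 * norm b * \<bar>t - t0\<bar> + e0 * norm b * \<bar>s - s0\<bar>) / norm b"
      by (simp add: norm_divide divide_right_mono)
    also have "\<dots> = e0 * (\<bar>t - t0\<bar> + \<bar>s - s0\<bar>)" using b by (simp add: field_simps)
    finally show ?thesis .
  qed
  text \<open>\<open>P s t \<approx> (t - t0) - \<kappa> (s - s0)\<close> misses the imaginary half axis on the side of \<open>Im \<kappa> (s - s0)\<close>.\<close>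
  have avoid: "Im (P s t) * (Im \<kappa> * (s - s0)) < 0"
    if st: "\<bar>t - t0\<bar> < d1" "\<bar>s - s0\<bar> < d2" "s \<noteq> s0" and Re: "Re (P s t) = 0" for s t
  proof -
    define D where "D = P s t - (of_real (t - t0) - \<kappa> * of_real (s - s0))"
    have D: "norm D \<le> e0 * (\<bar>t - t0\<bar> + \<bar>s - s0\<bar>)" unfolding D_def by (rule P[OF st(1,2)])
    have ReD: "t - t0 = Re \<kappa> * (s - s0) - Re D" and ImD: "Im (P s t) = Im D - Im \<kappa> * (s - s0)"
      using Re by (simp_all add: D_def)
    have "\<bar>t - t0\<bar> \<le> \<bar>Re \<kappa>\<bar> * \<bar>s - s0\<bar> + norm D"
      unfolding ReD using abs_Re_le_cmod[of D] abs_triangle_ineq4[of "Re \<kappa> * (s - s0)" "Re D"] by (simp add: abs_mult)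
    also have "\<dots> \<le> norm \<kappa> * \<bar>s - s0\<bar> + e0 * (\<bar>t - t0\<bar> + \<bar>s - s0\<bar>)"
      using D by (intro add_mono mult_right_mono abs_Re_le_cmod) auto
    also have "e0 * (\<bar>t - t0\<bar> + \<bar>s - s0\<bar>) \<le> 1 / 2 * (\<bar>t - t0\<bar> + \<bar>s - s0\<bar>)"
      using e0(2) by (intro mult_right_mono) auto
    finally have t: "\<bar>t - t0\<bar> \<le> (2 * norm \<kappa> + 1) * \<bar>s - s0\<bar>" by (simp add: algebra_simps)
    have "norm D \<le> e0 * ((2 * norm \<kappa> + 1) * \<bar>s - s0\<bar> + \<bar>s - s0\<bar>)"
      using D e0(1) t by (intro order_trans[OF D] mult_left_mono add_mono) auto
    also have "\<dots> = e0 * (2 * norm \<kappa> + 2) * \<bar>s - s0\<bar>" by (simp add: algebra_simps)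
    also have "\<dots> < \<bar>Im \<kappa>\<bar> * \<bar>s - s0\<bar>" using e0(3) st(3) by (intro mult_strict_right_mono) auto
    finally have "\<bar>Im D\<bar> < \<bar>Im \<kappa> * (s - s0)\<bar>" using abs_Im_le_cmod[of D] by (simp add: abs_mult)
    then show ?thesis
      unfolding ImD by (subst mult_less_0_iff) linarith
  qed
  obtain \<rho> q where \<rho>: "\<rho> > 0" and q: "continuous_on (ball z0 \<rho>) q"
    and prim: "\<And>u c. u \<in> ball z0 \<rho> \<Longrightarrow> c \<noteq> 0 \<Longrightarrow> (u - z0) / c \<notin> \<real>\<^sub>\<le>\<^sub>0 \<Longrightarrow>
       ((\<lambda>u. Ln ((u - z0) / c) + q u) has_field_derivative \<zeta> u) (at u)"
    and nz: "\<And>u. u \<in> ball z0 \<rho> \<Longrightarrow> u \<noteq> z0 \<Longrightarrow> \<sigma> u \<noteq> 0"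
    using zeta_primitive[of z0] c unfolding crossing_def z0_def by blast
  have "isCont A s0" "isCont B t0"
    using has_vector_derivative_continuous A B by blast+
  then obtain d3 d4 where d3: "d3 > 0" "\<And>s. \<bar>s - s0\<bar> < d3 \<Longrightarrow> norm (A s - A s0) < \<rho> / 2"
    and d4: "d4 > 0" "\<And>t. \<bar>t - t0\<bar> < d4 \<Longrightarrow> norm (B t - B t0) < \<rho> / 2"
    using \<rho> unfolding continuous_at_eps_delta dist_norm real_norm_def by (metis half_gt_zero)
  have in_ball: "B t - A s \<in> ball z0 \<rho>" if "\<bar>s - s0\<bar> < d3" "\<bar>t - t0\<bar> < d4" for s t
  proof -
    have "norm (z0 - (B t - A s)) = norm ((A s - A s0) - (B t - B t0))"
      unfolding z0_def by (rule arg_cong[where f = norm]) simp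
    also have "\<dots> < \<rho>" using norm_triangle_ineq4[of "A s - A s0" "B t - B t0"] d3(2)[OF that(1)] d4(2)[OF that(2)] by linarith
    finally show ?thesis by (simp add: dist_norm)
  qed
  define \<delta>0 d where "\<delta>0 = min d1 d4 / 2" and "d = min d2 d3"
  have \<delta>0: "\<delta>0 > 0" and d: "d > 0" using d1(1) d2(1) d3(1) d4(1) by (simp_all add: \<delta>0_def d_def)
  show ?thesis
  proof (rule that[OF \<delta>0])
    fix \<delta> assume \<delta>: "0 < \<delta>" "\<delta> \<le> \<delta>0"
    define l r where "l = t0 - \<delta>" and "r = t0 + \<delta>"
    have near: "\<bar>t - t0\<bar> < d1" "\<bar>t - t0\<bar> < d4" if "t \<in> {l..r}" for t
    proof -
      have "\<bar>t - t0\<bar> \<le> \<delta>" using that by (auto simp: l_def r_def)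
      moreover have "\<delta> < d1" "\<delta> < d4" using \<delta> d1(1) d4(1) by (auto simp: \<delta>0_def min_def split: if_splits)
      ultimately show "\<bar>t - t0\<bar> < d1" "\<bar>t - t0\<bar> < d4" by linarith+
    qed
    have lr: "l \<in> {l..r}" "r \<in> {l..r}" "l \<le> r" using \<delta> by (auto simp: l_def r_def)
    define p1 p2 where "p1 = P s0 r" and "p2 = P s0 l"
    have end_signs: "Re p1 > 0" "Re p2 < 0"
    proof -
      have 1: "norm (p1 - of_real \<delta>) \<le> e0 * \<delta>" "norm (p2 - of_real (- \<delta>)) \<le> e0 * \<delta>"
        using P[OF near(1)[OF lr(2)], of s0] P[OF near(1)[OF lr(1)], of s0] d2(1) \<delta>(1)
        by (simp_all add: p1_def p2_def l_def r_def)
      moreover have "e0 * \<delta> \<le> 1 / 2 * \<delta>" using e0(2) \<delta>(1) by (intro mult_right_mono) auto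
      ultimately have "\<bar>Re p1 - \<delta>\<bar> \<le> \<delta> / 2" "\<bar>Re p2 + \<delta>\<bar> \<le> \<delta> / 2"
        using abs_Re_le_cmod[of "p1 - of_real \<delta>"] abs_Re_le_cmod[of "p2 - of_real (- \<delta>)"] by auto
      then show "Re p1 > 0" "Re p2 < 0" using \<delta>(1) by linarith+
    qed
    \<comment> \<open>The parameter is 1 for s > s0 and -1 for s < s0; it turns the cut to the half
      of the imaginary axis which \<open>avoid\<close> keeps free on that side.\<close>
    define \<phi> where "\<phi> \<rho> u = Ln ((u - z0) / (b * (\<i> * of_real (\<epsilon> * \<rho>)))) + q u" for \<rho> u
    have quot: "(B t - A s - z0) / (b * (\<i> * of_real (\<epsilon> * \<rho>))) = P s t / (\<i> * of_real (\<epsilon> * \<rho>))" for s t \<rho>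
      by (simp add: P_def)
    have no_real: "Re p \<noteq> 0 \<Longrightarrow> \<rho> = 1 \<or> \<rho> = - 1 \<Longrightarrow> p / (\<i> * of_real (\<epsilon> * \<rho>)) \<notin> \<real>\<^sub>\<le>\<^sub>0" for p \<rho>
      using \<epsilon> by (auto simp: complex_nonpos_Reals_iff Im_divide)
    have no_real': "P s t / (\<i> * of_real (\<epsilon> * \<rho>)) \<notin> \<real>\<^sub>\<le>\<^sub>0"
      if st: "\<bar>s - s0\<bar> < d" "t \<in> {l..r}" "s \<noteq> s0" and \<rho>: "\<rho> = sgn (s - s0)" for s t \<rho>
    proof (cases "Re (P s t) = 0")
      case True
      have a: "Im (P s t) * (Im \<kappa> * (s - s0)) < 0"
        using avoid[OF near(1)[OF st(2)] _ st(3) True] st(1) by (simp add: d_def)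
      have "P s t / (\<i> * of_real (\<epsilon> * \<rho>)) = of_real (Im (P s t) * (\<epsilon> * \<rho>))"
      proof -
        have "\<epsilon> * \<rho> = 1 \<or> \<epsilon> * \<rho> = -1" using \<epsilon> \<rho> st(3) by (auto simp: sgn_if)
        then show ?thesis using True by (auto simp: complex_eq_iff Re_divide Im_divide)
      qed
      moreover have "Im (P s t) * (\<epsilon> * \<rho>) > 0"
      proof -
        have "\<epsilon> * \<rho> * (Im \<kappa> * (s - s0)) = (\<epsilon> * Im \<kappa>) * (\<rho> * (s - s0))" by simp
        also have "\<dots> < 0" unfolding \<epsilon>k \<rho> using k st(3) by (simp add: sgn_if mult_less_0_iff)
        finally have "\<epsilon> * \<rho> * (Im \<kappa> * (s - s0)) < 0" .
        with a show ?thesis by (auto simp: mult_less_0_iff zero_less_mult_iff)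
      qed
      ultimately show ?thesis by (simp add: complex_nonpos_Reals_iff)
    next
      case False
      then show ?thesis using no_real[of "P s t" \<rho>] \<rho> st(3) by (auto simp: sgn_if)
    qed
    have wind_eq: "wind l r s = \<phi> \<rho> (B r - A s) - \<phi> \<rho> (B l - A s)"
      if s: "\<bar>s - s0\<bar> < d" "s \<noteq> s0" and \<rho>: "\<rho> = sgn (s - s0)" for s \<rho>
    proof (rule wind_primitive[OF lr(3)])
      fix t assume t: "t \<in> {l..r}"
      have c: "b * (\<i> * of_real (\<epsilon> * \<rho>)) \<noteq> 0" using b \<epsilon> \<rho> s(2) by (auto simp: sgn_if)
      show "(\<phi> \<rho> has_field_derivative \<zeta> (B t - A s)) (at (B t - A s))"
        unfolding \<phi>_def[abs_def]
        by (rule prim[OF in_ball[OF _ near(2)[OF t]] c]) (use s(1) in \<open>simp add: d_def\<close>, unfold quot, rule no_real'[OF s(1) t s(2) \<rho>])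
    qed
    have nocross: "\<not> crossing s t" if s: "\<bar>s - s0\<bar> < d" "s \<noteq> s0" and t: "t \<in> {l..r}" for s t
    proof -
      have "B t - A s \<noteq> z0"
        using no_real'[OF s(1) t s(2) refl] by (auto simp: P_def)
      moreover have "B t - A s \<in> ball z0 \<rho>" using in_ball[OF _ near(2)[OF t]] s(1) by (simp add: d_def)
      ultimately show ?thesis using nz unfolding crossing_def by blast
    qed
    have lim: "((\<lambda>s. \<phi> \<rho> (B r - A s) - \<phi> \<rho> (B l - A s)) \<longlongrightarrow> \<phi> \<rho> (B r - A s0) - \<phi> \<rho> (B l - A s0)) (at s0)"
      if \<rho>: "\<rho> = 1 \<or> \<rho> = - 1" for \<rho>
    proof -
      have c: "b * (\<i> * of_real (\<epsilon> * \<rho>)) \<noteq> 0" using b \<epsilon> \<rho> by auto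
      have cont: "isCont (\<phi> \<rho>) (B t - A s0)" if t: "t \<in> {l, r}" for t
      proof -
        have "(\<phi> \<rho> has_field_derivative \<zeta> (B t - A s0)) (at (B t - A s0))"
          unfolding \<phi>_def[abs_def]
        proof (rule prim[OF in_ball c])
          show "(B t - A s0 - z0) / (b * (\<i> * of_real (\<epsilon> * \<rho>))) \<notin> \<real>\<^sub>\<le>\<^sub>0"
            unfolding quot by (rule no_real[OF _ \<rho>]) (use t end_signs in \<open>auto simp: p1_def p2_def\<close>)
        qed (use t lr near d3(1) in auto)
        then show ?thesis by (rule DERIV_isCont)
      qed
      have "(A \<longlongrightarrow> A s0) (at s0)" using \<open>isCont A s0\<close> by (simp add: isCont_def)
      then show ?thesis
        by (intro tendsto_diff isCont_tendsto_compose[OF cont] tendsto_const) auto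
    qed
    have right: "(wind l r \<longlongrightarrow> \<phi> 1 (B r - A s0) - \<phi> 1 (B l - A s0)) (at_right s0)"
    proof (rule Lim_transform_eventually)
      show "((\<lambda>s. \<phi> 1 (B r - A s) - \<phi> 1 (B l - A s)) \<longlongrightarrow> \<phi> 1 (B r - A s0) - \<phi> 1 (B l - A s0)) (at_right s0)"
        using lim[of 1] by (auto intro: filterlim_mono at_le)
      show "\<forall>\<^sub>F s in at_right s0. \<phi> 1 (B r - A s) - \<phi> 1 (B l - A s) = wind l r s"
        unfolding eventually_at_right_field using d by (intro exI[of _ "s0 + d"]) (auto simp: wind_eq)
    qed
    have left: "(wind l r \<longlongrightarrow> \<phi> (-1) (B r - A s0) - \<phi> (-1) (B l - A s0)) (at_left s0)"
    proof (rule Lim_transform_eventually)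
      show "((\<lambda>s. \<phi> (-1) (B r - A s) - \<phi> (-1) (B l - A s)) \<longlongrightarrow> \<phi> (-1) (B r - A s0) - \<phi> (-1) (B l - A s0)) (at_left s0)"
        using lim[of "-1"] by (auto intro: filterlim_mono at_le)
      show "\<forall>\<^sub>F s in at_left s0. \<phi> (-1) (B r - A s) - \<phi> (-1) (B l - A s) = wind l r s"
        unfolding eventually_at_left_field using d by (intro exI[of _ "s0 - d"]) (auto simp: wind_eq)
    qed
    have "(\<phi> 1 (B r - A s0) - \<phi> 1 (B l - A s0)) - (\<phi> (-1) (B r - A s0) - \<phi> (-1) (B l - A s0)) = - 2 * pi * \<i> * \<epsilon>"
      using Ln_rotation_jump[OF end_signs \<epsilon>] unfolding \<phi>_def quot by (simp add: p1_def p2_def algebra_simps)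
    moreover have "\<forall>\<^sub>F s in at s0. \<forall>t\<in>{l..r}. \<not> crossing s t"
      unfolding eventually_at using d nocross by (intro exI[of _ d]) (auto simp: dist_real_def)
    ultimately show "has_jump s0 (t0 - \<delta>) (t0 + \<delta>) (- 2 * pi * \<i> * sg s0 t0)"
      using left right unfolding has_jump_def l_def r_def \<epsilon>_def by blast
  qed
qed

lemma has_jump_sum:
  assumes "finite T" "l \<le> r" "T = {t \<in> {l..r}. crossing s0 t}" "\<not> crossing s0 l" "\<not> crossing s0 r"
    and "\<And>t. t \<in> T \<Longrightarrow> Im (cnj (A' s0) * B' t) \<noteq> 0"
  shows "has_jump s0 l r (\<Sum>t\<in>T. - 2 * pi * \<i> * sg s0 t)"
  using assms
proof (induction T arbitrary: r rule: finite_linorder_max_induct)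
  case empty
  then have "has_jump s0 l r 0" by (intro has_jump_0) auto
  then show ?case by simp
next
  case (insert b T)
  note T = insert.prems(2)
  have "b \<in> {t \<in> {l..r}. crossing s0 t}" using T by blast
  then have b: "crossing s0 b" "l \<le> b" "b \<le> r" by auto
  have b': "l < b" "b < r" using b insert.prems(3,4) by (auto simp: less_le)
  obtain \<delta>0 where \<delta>0: "\<delta>0 > 0" "\<And>\<delta>. 0 < \<delta> \<Longrightarrow> \<delta> \<le> \<delta>0 \<Longrightarrow> has_jump s0 (b - \<delta>) (b + \<delta>) (- 2 * pi * \<i> * sg s0 b)"
    using has_jump_local[OF b(1) insert.prems(5)] by blast
  define m where "m = Max (insert l T)"
  have m: "l \<le> m" "m < b" "\<And>s. s \<in> T \<Longrightarrow> s \<le> m"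
    using insert.hyps b' unfolding m_def by auto
  \<comment> \<open>The interval around b must stay within the range of the local result and clear
    of both the previous crossing and r.\<close>
  define \<delta> where "\<delta> = min \<delta>0 (min ((b - m) / 2) ((r - b) / 2))"
  have \<delta>: "0 < \<delta>" "\<delta> \<le> \<delta>0" "m < b - \<delta>" "b + \<delta> < r"
  proof -
    show "0 < \<delta>" "\<delta> \<le> \<delta>0" using \<delta>0(1) m b' by (auto simp: \<delta>_def)
    have "\<delta> \<le> (b - m) / 2" "\<delta> \<le> (r - b) / 2" unfolding \<delta>_def by linarith+
    then show "m < b - \<delta>" "b + \<delta> < r" using m(2) b'(2) by (simp_all add: field_simps)
  qed
  have only: "t \<in> T \<or> t = b" if "crossing s0 t" "l \<le> t" "t \<le> r" for t
    using T that by auto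
  have nc: "\<not> crossing s0 (b - \<delta>)"
  proof
    assume "crossing s0 (b - \<delta>)"
    then have "b - \<delta> \<in> T" using only[of "b - \<delta>"] \<delta> m b' by auto
    then show False using m(3) \<delta>(3) by force
  qed
  have "has_jump s0 l (b - \<delta>) (\<Sum>t\<in>T. - 2 * pi * \<i> * sg s0 t)"
  proof (rule insert.IH)
    show "T = {t \<in> {l..b - \<delta>}. crossing s0 t}"
    proof (intro equalityI subsetI)
      fix t assume t: "t \<in> T"
      then have "t \<in> {t \<in> {l..r}. crossing s0 t}" using T by blast
      then show "t \<in> {t \<in> {l..b - \<delta>}. crossing s0 t}" using m(3)[OF t] \<delta>(3) by auto
    next
      fix t assume "t \<in> {t \<in> {l..b - \<delta>}. crossing s0 t}"
      then show "t \<in> T" using only[of t] \<delta>(1) b' by auto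
    qed
  qed (use m \<delta> nc insert.prems in auto)
  moreover have "has_jump s0 (b - \<delta>) (b + \<delta>) (- 2 * pi * \<i> * sg s0 b)" by (rule \<delta>0(2)[OF \<delta>(1,2)])
  moreover have "has_jump s0 (b + \<delta>) r 0"
  proof (rule has_jump_0, rule notI)
    fix t assume t: "t \<in> {b + \<delta>..r}" "crossing s0 t"
    then have "t \<in> T" using only[of t] \<delta>(1) b' by auto
    then show False using m(2,3) t(1) \<delta>(1) by force
  qed
  ultimately have "has_jump s0 l r ((\<Sum>t\<in>T. - 2 * pi * \<i> * sg s0 t) + (- 2 * pi * \<i> * sg s0 b) + 0)"
    using \<delta> m by (intro has_jump_add[of l "b + \<delta>"] has_jump_add[of l "b - \<delta>"]) linarith+
  moreover have "(\<Sum>t\<in>insert b T. - 2 * pi * \<i> * sg s0 t) = - 2 * pi * \<i> * sg s0 b + (\<Sum>t\<in>T. - 2 * pi * \<i> * sg s0 t)"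
    using insert.hyps by (intro sum.insert) auto
  ultimately show ?case by (simp add: add.commute)
qed

text \<open>The product of \<sigma> (B t - A s) with exp (- wind l t s) has derivative 0 in
  t.\<close>

lemma exp_wind:
  assumes "l \<le> r" "\<And>t. t \<in> {l..r} \<Longrightarrow> \<not> crossing s t"
  shows "exp (wind l r s) = \<sigma> (B r - A s) / \<sigma> (B l - A s)"
proof -
  define g where "g t = \<sigma> (B t - A s) * exp (- wind l t s)" for t
  have "(g has_vector_derivative 0) (at t within {l..r})" if t: "t \<in> {l..r}" for t
  proof -
    have Bt: "((\<lambda>t. B t - A s) has_vector_derivative B' t) (at t within {l..r})"
      using has_vector_derivative_diff[OF has_vector_derivative_at_within[OF B] has_vector_derivative_const[of "A s"]] by simp
    have s: "((\<sigma> \<circ> (\<lambda>t. B t - A s)) has_vector_derivative B' t * deriv \<sigma> (B t - A s)) (at t within {l..r})"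
      by (rule field_vector_diff_chain_within[OF Bt]) (rule has_field_derivative_at_within[OF has_derivs(1)])
    have w: "((\<lambda>t. wind l t s) has_vector_derivative \<zeta> (B t - A s) * B' t) (at t within {l..r})"
      unfolding wind_def by (rule integral_has_vector_derivative[OF cont_integrand t]) (use assms(2) in blast)
    have e: "((exp \<circ> (\<lambda>t. - wind l t s)) has_vector_derivative - (\<zeta> (B t - A s) * B' t) * exp (- wind l t s)) (at t within {l..r})"
      by (rule field_vector_diff_chain_within[OF has_vector_derivative_minus[OF w]]) (rule has_field_derivative_at_within[OF DERIV_exp])
    have "\<sigma> (B t - A s) \<noteq> 0" using assms(2)[OF t] by (simp add: crossing_def)
    then have zero: "\<sigma> (B t - A s) * (- (\<zeta> (B t - A s) * B' t) * exp (- wind l t s)) + B' t * deriv \<sigma> (B t - A s) * exp (- wind l t s) = 0"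
      by (simp add: \<zeta>_def)
    show ?thesis
      unfolding g_def[abs_def] by (rule has_vector_derivative_mult[OF s e, unfolded o_def zero])
  qed
  then obtain k where k: "\<And>t. t \<in> {l..r} \<Longrightarrow> g t = k"
    using has_vector_derivative_zero_constant[of "{l..r}" g] by (metis convex_real_interval(5))
  have "g r = g l" using k[of r] k[of l] assms(1) by simp
  moreover have "g l = \<sigma> (B l - A s)" by (simp add: g_def wind_def)
  moreover have "\<sigma> (B l - A s) \<noteq> 0" using assms by (simp add: crossing_def)
  ultimately show ?thesis by (simp add: g_def exp_minus field_simps)
qed

text \<open>Consider J s = wind c (c + 1) s + e2 A s. By the quasi-period l2 its exponential is the
  same at all s without crossings, so J is a step function with jumps -2 pi i times the crossing
  signs. On the other hand, translating A by l1 shifts \<zeta> by -e1, so the increment of J over a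
  period is e2 l1 - e1 l2.\<close>

lemma legendre_relation:
  assumes A_per: "\<And>s. A (s + 1) = A s + l1" and B_per: "\<And>t. B (t + 1) = B t + l2"
    and q1: "quasi_period l1 e1" and q2: "quasi_period l2 e2"
    and C: "C = {(s, t). s \<in> {0..<1} \<and> t \<in> {0..<1} \<and> crossing s t}" and fin: "finite C"
    and tr: "\<And>s t. (s, t) \<in> C \<Longrightarrow> Im (cnj (A' s) * B' t) \<noteq> 0"
  shows "e1 * l2 - e2 * l1 = 2 * pi * \<i> * (\<Sum>(s, t)\<in>C. sg s t)"
proof -
  have A'_per: "A' (s + 1) = A' s" for s by (rule quasi_periodic_derivative[OF A A_per])
  have B'_per: "B' (t + 1) = B' t" for t by (rule quasi_periodic_derivative[OF B B_per])
  have cr1: "crossing (s + 1) t \<longleftrightarrow> crossing s t" for s t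
    using quasi_period_zero_iff[OF q1, of "B t - A s - l1"] unfolding crossing_def A_per by (simp add: algebra_simps)
  have cr2: "crossing s (t + 1) \<longleftrightarrow> crossing s t" for s t
    using quasi_period_zero_iff[OF q2, of "B t - A s"] unfolding crossing_def B_per by (simp add: algebra_simps)
  have sg_per: "sg (s + 1) t = sg s t" "sg s (t + 1) = sg s t" for s t
    by (simp_all add: sg_def A'_per B'_per)
  \<comment> \<open>The unit square is moved to the corner (s0, c) so that no crossing lies on its
    boundary; f and g below match the crossings in the two squares by translations.\<close>
  have "infinite ({0<..<1} - fst ` C)" "infinite ({0<..<1} - snd ` C)"
    using fin by (intro Diff_infinite_finite infinite_Ioo; simp)+
  then obtain s0 c where s0: "s0 \<in> {0<..<1} - fst ` C" and c: "c \<in> {0<..<1} - snd ` C"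
    by (metis finite.emptyI ex_in_conv)
  have nc_s0: "\<not> crossing s0 t" if t: "t \<in> {c..c + 1}" for t
  proof
    assume cr: "crossing s0 t"
    have "(s0, if t < 1 then t else t - 1) \<in> C"
      using s0 c t cr cr2[of s0 "t - 1"] unfolding C by auto
    then show False using s0 by force
  qed
  have nc_c: "\<not> crossing s c" if s: "s \<in> {s0..s0 + 1}" for s
  proof
    assume cr: "crossing s c"
    have "(if s < 1 then s else s - 1, c) \<in> C"
      using s0 c s cr cr1[of "s - 1" c] unfolding C by auto
    then show False using c by force
  qed
  define C' where "C' = {(s, t). s \<in> {s0..s0 + 1} \<and> t \<in> {c..c + 1} \<and> crossing s t}"
  define f where "f = (\<lambda>(s, t). (if s < s0 then s + 1 else s, if t < c then t + 1 else t :: real))"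
  define g where "g = (\<lambda>(s, t). (if s < 1 then s else s - 1 :: real, if t < 1 then t else t - 1 :: real))"
  have fC: "f p \<in> C'" "g (f p) = p" "sg (fst (f p)) (snd (f p)) = sg (fst p) (snd p)" if p: "p \<in> C" for p
    using p s0 c unfolding C by (auto simp: C'_def f_def g_def cr1 cr2 sg_per)
  have gC: "g p \<in> C \<and> f (g p) = p" if p: "p \<in> C'" for p
  proof -
    obtain s t where st: "p = (s, t)" "s \<in> {s0..s0 + 1}" "t \<in> {c..c + 1}" "crossing s t"
      using p by (auto simp: C'_def)
    have "s \<noteq> s0 + 1" "t \<noteq> c + 1"
      using st nc_s0[of t] nc_c[of s] cr1[of s0 t] cr2[of s c] by auto
    then show ?thesis
      using st s0 c cr1[of "s - 1" t] cr2[of s "t - 1"] cr2[of "s - 1" "t - 1"] unfolding C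
      by (auto simp: f_def g_def)
  qed
  have "C' = f ` C" using fC(1) gC by (auto simp: image_iff) (metis gC)
  then have fin': "finite C'" using fin by simp
  have gsg: "sg (fst (g p)) (snd (g p)) = sg (fst p) (snd p)" if "p \<in> C'" for p
    using fC(3)[of "g p"] gC[OF that] by simp
  have sum_C': "(\<Sum>(s, t)\<in>C'. sg s t) = (\<Sum>(s, t)\<in>C. sg s t)"
    by (rule sum.reindex_bij_witness[of _ f g]) (use fC gC gsg in \<open>auto simp: case_prod_unfold\<close>)
  have sg_nz: "sg s t = 0 \<longleftrightarrow> Im (cnj (A' s) * B' t) = 0" for s t
    unfolding sg_def by (rule sgn_zero_iff)
  have tr': "Im (cnj (A' s) * B' t) \<noteq> 0" if st: "(s, t) \<in> C'" for s t
    using tr[of "fst (g (s, t))" "snd (g (s, t))"] gC[OF st] gsg[OF st] unfolding sg_nz[symmetric] by simp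
  define D where "D = fst ` C'"
  define T where "T s = {t \<in> {c..c + 1}. crossing s t}" for s
  have C'_eq: "C' = Sigma D T"
    unfolding C'_def D_def T_def by force
  have finD: "finite D" using fin' by (simp add: D_def)
  have finT: "finite (T s)" if "s \<in> D" for s
  proof (rule finite_subset)
    show "T s \<subseteq> snd ` C'" using that unfolding C'_eq by force
  qed (use fin' in simp)
  have D_sub: "D \<subseteq> {s0<..<s0 + 1}"
  proof
    fix s assume s: "s \<in> D"
    then obtain t where t: "s \<in> {s0..s0 + 1}" "t \<in> {c..c + 1}" "crossing s t"
      by (auto simp: D_def C'_def)
    then have "s \<noteq> s0" "s \<noteq> s0 + 1" using nc_s0[of t] cr1[of s0 t] by auto
    then show "s \<in> {s0<..<s0 + 1}" using t(1) by auto
  qed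
  define J where "J s = wind c (c + 1) s + e2 * A s" for s
  obtain K where K: "K \<noteq> 0" "\<And>u. \<sigma> (u + l2) = K * exp (e2 * u) * \<sigma> u"
    using q2 unfolding quasi_period_def by blast
  have expJ: "exp (J s) = K * exp (e2 * B c)" if "\<And>t. t \<in> {c..c + 1} \<Longrightarrow> \<not> crossing s t" for s
  proof -
    have nz: "\<sigma> (B c - A s) \<noteq> 0" using that[of c] by (simp add: crossing_def)
    have "exp (wind c (c + 1) s) = \<sigma> (B (c + 1) - A s) / \<sigma> (B c - A s)"
      by (rule exp_wind) (use that in auto)
    also have "B (c + 1) - A s = (B c - A s) + l2" by (simp add: B_per)
    finally have "exp (wind c (c + 1) s) = K * exp (e2 * (B c - A s))"
      using nz by (simp add: K(2))
    then show ?thesis by (simp add: J_def exp_add right_diff_distrib exp_diff)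
  qed
  have lc: "\<forall>\<^sub>F s' in at s. J s = J s'" if s: "s \<in> {s0..s0 + 1} - D" for s
  proof (rule exp_const_imp_locally_const)
    have nc: "\<not> crossing s t" if "t \<in> {c..c + 1}" for t
      using s that by (force simp: D_def C'_def)
    show "isCont J s" unfolding J_def[abs_def]
      by (intro continuous_intros wind_continuous nc has_vector_derivative_continuous[OF A])
    obtain e where e: "e > 0" "\<And>s' t. \<bar>s' - s\<bar> \<le> e \<Longrightarrow> t \<in> {c..c + 1} \<Longrightarrow> \<not> crossing s' t"
      using no_crossing_nhds[OF nc] by blast
    show "\<forall>\<^sub>F s' in at s. exp (J s') = exp (J s)"
      unfolding eventually_at dist_real_def
    proof (intro exI[of _ e] conjI ballI impI e(1))
      fix s' assume "s' \<noteq> s \<and> \<bar>s' - s\<bar> < e"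
      then have "exp (J s') = K * exp (e2 * B c)" by (intro expJ e(2)) auto
      moreover have "exp (J s) = K * exp (e2 * B c)" by (intro expJ nc)
      ultimately show "exp (J s') = exp (J s)" by simp
    qed
  qed
  have jump: "\<exists>L1 L2. (J \<longlongrightarrow> L1) (at_right s) \<and> (J \<longlongrightarrow> L2) (at_left s) \<and> L1 - L2 = (\<Sum>t\<in>T s. - 2 * pi * \<i> * sg s t)"
    if s: "s \<in> D" for s
  proof -
    have s': "s \<in> {s0..s0 + 1}" using D_sub s by force
    have "has_jump s c (c + 1) (\<Sum>t\<in>T s. - 2 * pi * \<i> * sg s t)"
    proof (rule has_jump_sum[OF finT[OF s]])
      show "Im (cnj (A' s) * B' t) \<noteq> 0" if "t \<in> T s" for t
        by (rule tr') (use s that in \<open>simp add: C'_eq\<close>)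
    qed (use nc_c[OF s'] cr2 in \<open>auto simp: T_def\<close>)
    then obtain L1 L2 where L: "(wind c (c + 1) \<longlongrightarrow> L1) (at_right s)" "(wind c (c + 1) \<longlongrightarrow> L2) (at_left s)"
      "L1 - L2 = (\<Sum>t\<in>T s. - 2 * pi * \<i> * sg s t)"
      unfolding has_jump_def by blast
    have "(A \<longlongrightarrow> A s) (at s)" using has_vector_derivative_continuous[OF A, of s] by (simp add: isCont_def)
    then have At: "(A \<longlongrightarrow> A s) (at_right s)" "(A \<longlongrightarrow> A s) (at_left s)"
      by (auto intro: filterlim_mono at_le)
    have "(J \<longlongrightarrow> L1 + e2 * A s) (at_right s)" "(J \<longlongrightarrow> L2 + e2 * A s) (at_left s)"
      unfolding J_def[abs_def] by (rule tendsto_add[OF L(1) tendsto_mult[OF tendsto_const At(1)]]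
        tendsto_add[OF L(2) tendsto_mult[OF tendsto_const At(2)]])+
    moreover have "(L1 + e2 * A s) - (L2 + e2 * A s) = (\<Sum>t\<in>T s. - 2 * pi * \<i> * sg s t)"
      using L(3) by simp
    ultimately show ?thesis by blast
  qed
  have "J (s0 + 1) - J s0 = (\<Sum>s\<in>D. \<Sum>t\<in>T s. - 2 * pi * \<i> * sg s t)"
    by (rule step_function_increment[OF finD D_sub _ lc jump]) auto
  also have "\<dots> = (\<Sum>(s, t)\<in>C'. - 2 * pi * \<i> * sg s t)"
    unfolding C'_eq by (rule sum.Sigma) (use finD finT in auto)
  also have "\<dots> = - 2 * pi * \<i> * (\<Sum>(s, t)\<in>C'. sg s t)"
    by (simp add: sum_distrib_left case_prod_unfold)
  finally have inc: "J (s0 + 1) - J s0 = - 2 * pi * \<i> * (\<Sum>(s, t)\<in>C. sg s t)"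
    unfolding sum_C' .
  have intB: "(B' has_integral l2) {c..c + 1}"
    using fundamental_theorem_of_calculus[of c "c + 1" B B'] has_vector_derivative_at_within[OF B] by (simp add: B_per)
  have "wind c (c + 1) (s0 + 1) = integral {c..c + 1} (\<lambda>t. \<zeta> (B t - A s0) * B' t - e1 * B' t)"
    unfolding wind_def
  proof (rule integral_cong)
    fix t assume t: "t \<in> {c..c + 1}"
    have "\<sigma> (B t - A (s0 + 1)) \<noteq> 0" using nc_s0[OF t] cr1[of s0 t] by (simp add: crossing_def)
    from quasi_period_invariant(3)[OF q1 this]
    have "\<zeta> (B t - A s0) = \<zeta> (B t - A (s0 + 1)) + e1" unfolding A_per by simp
    then show "\<zeta> (B t - A (s0 + 1)) * B' t = \<zeta> (B t - A s0) * B' t - e1 * B' t"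
      by (simp only:) (simp add: algebra_simps)
  qed
  also have "\<dots> = wind c (c + 1) s0 - e1 * l2"
  proof -
    have "(\<lambda>t. \<zeta> (B t - A s0) * B' t) integrable_on {c..c + 1}"
      by (rule integrable_continuous_real[OF cont_integrand[OF nc_s0]])
    then have "((\<lambda>t. \<zeta> (B t - A s0) * B' t) has_integral wind c (c + 1) s0) {c..c + 1}"
      unfolding wind_def by (rule integrable_integral)
    from has_integral_diff[OF this has_integral_mult_right[OF intB, of e1]]
    show ?thesis by (rule integral_unique)
  qed
  finally have "J (s0 + 1) - J s0 = e2 * l1 - e1 * l2"
    unfolding J_def A_per by (simp add: algebra_simps)
  with inc have "- (e1 * l2 - e2 * l1) = - (2 * pi * \<i> * (\<Sum>(s, t)\<in>C. sg s t))"
    by (simp only: minus_diff_eq mult_minus_left of_real_minus)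
  then show ?thesis by (rule neg_equal_iff_equal[THEN iffD1])
qed

end

section \<open>Fourier series of periodic functions\<close>

definition fexp :: "int \<Rightarrow> real \<Rightarrow> complex" where
  "fexp n x = exp (2 * of_real pi * \<i> * of_int n * of_real x)"

lemma fexp_0 [simp]: "fexp 0 x = 1" and fexp_mult: "fexp m x * fexp n x = fexp (m + n) x"
  and norm_fexp [simp]: "norm (fexp n x) = 1"
  by (simp_all add: fexp_def algebra_simps norm_exp_eq_Re flip: exp_add)

lemma continuous_on_fexp [continuous_intros]: "continuous_on S (fexp n)"
  unfolding fexp_def[abs_def] by (intro continuous_intros)

lemma fexp_eq_iff: "fexp 1 u = fexp 1 v \<longleftrightarrow> (\<exists>n::int. u = v + of_int n)"
proof -
  have "2 * of_real pi * \<i> * of_real u = 2 * of_real pi * \<i> * of_real v + of_int (2 * n) * pi * \<i> \<longleftrightarrow> u = v + of_int n" for n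
  proof -
    have "2 * of_real pi * \<i> * of_real v + of_int (2 * n) * pi * \<i> = 2 * of_real pi * \<i> * of_real (v + of_int n)"
      by (simp add: algebra_simps)
    then show ?thesis by (simp only: mult_cancel_left of_real_eq_iff) simp
  qed
  then show ?thesis by (simp add: fexp_def exp_eq)
qed

lemma fexp_of_int [simp]: "fexp n (of_int k) = 1"
proof -
  have "fexp n (of_int k) = exp ((2 * of_int (n * k) * pi) * \<i>)" by (simp add: fexp_def mult_ac)
  also have "\<dots> = exp 0" unfolding exp_eq by (intro exI[of _ "n * k"]) simp
  finally show ?thesis by simp
qed

lemma integral_fexp: "((\<lambda>x. fexp n x) has_integral (if n = 0 then 1 else 0)) {0..1}"
proof (cases "n = 0")
  case True
  then show ?thesis using has_integral_const_real[of "1::complex" 0 1] by simp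
next
  case False
  define c where "c = 2 * of_real pi * \<i> * of_int n"
  have c: "c \<noteq> 0" using False by (simp add: c_def)
  have "((\<lambda>x. exp (c * of_real x)) has_integral (exp (c * of_real 1) / c - exp (c * of_real 0) / c)) {0..1}"
  proof (rule fundamental_theorem_of_calculus)
    fix x :: real
    have "((\<lambda>z. exp (c * z) / c) has_field_derivative exp (c * of_real x)) (at (of_real x))"
      using c by (auto intro!: derivative_eq_intros)
    from has_vector_derivative_real_field[OF this]
    show "((\<lambda>x. exp (c * of_real x) / c) has_vector_derivative exp (c * of_real x)) (at x within {0..1})"
      by (rule has_vector_derivative_at_within)
  qed simp
  then show ?thesis using False fexp_of_int[of n 1] fexp_of_int[of n 0] by (simp add: fexp_def c_def)
qed

definition "fourier_null d \<longleftrightarrow> continuous_on {0..1} d \<and> (\<forall>n. ((\<lambda>x. d x * fexp n x) has_integral 0) {0..1})"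

lemma fourier_nullI:
  "continuous_on {0..1} d \<Longrightarrow> (\<And>n. ((\<lambda>x. d x * fexp n x) has_integral 0) {0..1}) \<Longrightarrow> fourier_null d"
  and fourier_nullD: "fourier_null d \<Longrightarrow> continuous_on {0..1} d" "fourier_null d \<Longrightarrow> ((\<lambda>x. d x * fexp n x) has_integral 0) {0..1}"
  unfolding fourier_null_def by iprover+

lemma fourier_null_fexp:
  assumes "fourier_null d" shows "fourier_null (\<lambda>x. d x * fexp n x)"
  by (rule fourier_nullI)
    (intro continuous_intros fourier_nullD(1) assms, simp only: mult.assoc fexp_mult fourier_nullD(2)[OF assms])

lemma fourier_null_cmult:
  assumes "fourier_null d" shows "fourier_null (\<lambda>x. c * d x)"
proof (rule fourier_nullI)
  show "((\<lambda>x. c * d x * fexp n x) has_integral 0) {0..1}" for n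
    using has_integral_mult_right[OF fourier_nullD(2)[OF assms], of c n] by (simp only: mult.assoc mult_zero_right)
qed (intro continuous_intros fourier_nullD(1) assms)

lemma fourier_null_add:
  assumes "fourier_null d" "fourier_null e" shows "fourier_null (\<lambda>x. d x + e x)"
proof (rule fourier_nullI)
  show "((\<lambda>x. (d x + e x) * fexp n x) has_integral 0) {0..1}" for n
    using has_integral_add[OF fourier_nullD(2)[OF assms(1)] fourier_nullD(2)[OF assms(2)], of n n] by (simp only: ring_distribs add_0)
qed (intro continuous_intros fourier_nullD(1) assms)

text \<open>On the circle a real-linear function is a combination of w and its conjugate 1/w, so
  multiplication by it only shifts Fourier indices. Products are treated by applying the induction
  hypotheses in turn, which is why d stays arbitrary.\<close>

lemma fourier_null_polynomial:
  assumes "real_polynomial_function r" "fourier_null d"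
  shows "fourier_null (\<lambda>x. d x * of_real (r (fexp 1 x)))"
  using assms
proof (induction arbitrary: d)
  case (linear f)
  interpret f: bounded_linear f by fact
  have inv: "fexp (- 1) x = cnj (fexp 1 x)" for x
    unfolding fexp_def exp_cnj by simp
  have f: "f w = Re w * f 1 + Im w * f \<i>" for w
  proof -
    have "w = Re w *\<^sub>R 1 + Im w *\<^sub>R \<i>" by (simp add: complex_eq_iff)
    then have "f w = f (Re w *\<^sub>R 1 + Im w *\<^sub>R \<i>)" by (rule arg_cong)
    then show ?thesis by (simp only: f.add f.scaleR real_scaleR_def)
  qed
  have "d x * of_real (f (fexp 1 x)) = (f 1 - \<i> * f \<i>) / 2 * (d x * fexp 1 x) + (f 1 + \<i> * f \<i>) / 2 * (d x * fexp (- 1) x)" for x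
  proof -
    have "2 * of_real (f (fexp 1 x)) = (f 1 - \<i> * f \<i>) * fexp 1 x + (f 1 + \<i> * f \<i>) * fexp (- 1) x"
      unfolding f[of "fexp 1 x"] inv by (simp add: complex_eq_iff)
    then show ?thesis by (simp add: algebra_simps) algebra
  qed
  moreover have "fourier_null (\<lambda>x. (f 1 - \<i> * f \<i>) / 2 * (d x * fexp 1 x) + (f 1 + \<i> * f \<i>) / 2 * (d x * fexp (- 1) x))"
    by (intro fourier_null_add fourier_null_cmult fourier_null_fexp linear.prems)
  ultimately show ?case by presburger
next
  case (const c)
  show ?case using fourier_null_cmult[OF const, of c] by (simp add: mult.commute)
next
  case (add f g)
  show ?case using fourier_null_add[OF add.IH(1)[OF add.prems] add.IH(2)[OF add.prems]] by (simp add: ring_distribs)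
next
  case (mult f g)
  show ?case using mult.IH(2)[OF mult.IH(1)[OF mult.prems]] by (simp add: mult.assoc)
qed

text \<open>\<open>Arg\<close> jumps on the negative real axis; there Arg (-w) + pi is a continuous
  choice of the angle, and periodicity makes both choices give the same g.\<close>

lemma periodic_factors_through_circle:
  assumes cont: "continuous_on UNIV d" and per: "\<And>x. d (x + 1) = (d x :: complex)"
  obtains g where "continuous_on (sphere 0 1) g" "\<And>x. g (fexp 1 x) = d x"
proof -
  have per_nat: "d (x + of_nat n) = d x" for x n
    by (induction n) (simp_all add: per flip: add.assoc, metis per add.assoc add.commute)
  have per_int: "d (x + of_int k) = d x" for x k
    by (cases k) (use per_nat[of "x - real (nat (- k))" "nat (- k)"] in \<open>auto simp: per_nat\<close>,
        metis per_nat diff_add_cancel add.commute uminus_add_conv_diff minus_diff_eq of_nat_Suc diff_conv_add_uminus)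
  have eq: "d u = d v" if "fexp 1 u = fexp 1 v" for u v
    using that per_int unfolding fexp_eq_iff by auto
  define g where "g w = d (Arg w / (2 * pi))" for w
  have fexp_div: "fexp 1 (t / (2 * pi)) = exp (\<i> * of_real t)" for t
    by (simp add: fexp_def)
  have fexp_Arg: "fexp 1 (Arg w / (2 * pi)) = w / norm w" if "w \<noteq> 0" for w
    using Arg_eq[OF that] that unfolding fexp_div by (simp add: field_simps)
  have g1: "g w = d ((Arg (- w) + pi) / (2 * pi))" if "w \<noteq> 0" for w
    unfolding g_def
  proof (rule eq)
    have "fexp 1 ((Arg (- w) + pi) / (2 * pi)) = - fexp 1 (Arg (- w) / (2 * pi))"
      unfolding fexp_div by (simp add: ring_distribs exp_add)
    also have "\<dots> = w / norm w" using fexp_Arg[of "- w"] that by simp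
    finally show "fexp 1 (Arg w / (2 * pi)) = fexp 1 ((Arg (- w) + pi) / (2 * pi))"
      by (simp add: fexp_Arg[OF that])
  qed
  have contd: "isCont d x" for x using cont by (simp add: continuous_on_eq_continuous_at)
  have contg: "isCont g w" if w: "w \<noteq> 0" for w
  proof (cases "w \<in> \<real>\<^sub>\<le>\<^sub>0")
    case False
    show ?thesis unfolding g_def[abs_def]
      by (rule isCont_o2[OF _ contd]) (intro continuous_intros continuous_at_Arg False, simp)
  next
    case True
    then have "- w \<notin> \<real>\<^sub>\<le>\<^sub>0" using w by (auto simp: complex_nonpos_Reals_iff complex_eq_iff)
    then have "isCont (\<lambda>w. Arg (- w)) w"
      by (intro isCont_o2[OF _ continuous_at_Arg] continuous_intros)
    then have "isCont (\<lambda>w. d ((Arg (- w) + pi) / (2 * pi))) w"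
      by (intro isCont_o2[OF _ contd] continuous_intros) auto
    moreover have "\<forall>\<^sub>F v in nhds w. g v = d ((Arg (- v) + pi) / (2 * pi))"
      using t1_space_nhds[OF w] by eventually_elim (rule g1)
    ultimately show ?thesis by (simp add: isCont_cong)
  qed
  have "continuous_on (sphere 0 1) g"
  proof (rule continuous_at_imp_continuous_on, rule ballI)
    show "isCont g w" if "w \<in> sphere 0 1" for w
      by (rule contg) (use that in auto)
  qed
  moreover have "g (fexp 1 x) = d x" for x
    unfolding g_def by (rule eq) (subst fexp_Arg, auto simp: fexp_def)
  ultimately show ?thesis by (rule that)
qed

text \<open>By Stone-Weierstrass the conjugate of d is within e of a polynomial p on the circle. As
  d p has integral 0, the integral of \<open>|d|\<^sup>2\<close> is at most M e for every e >
  0.\<close>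

lemma fourier_null_imp_zero:
  assumes cont: "continuous_on UNIV d" and per: "\<And>x. d (x + 1) = (d x :: complex)" and null: "fourier_null d"
    and x: "x \<in> {0..1}"
  shows "d x = 0"
proof -
  obtain g where g: "continuous_on (sphere 0 1) g" "\<And>x. g (fexp 1 x) = d x"
    using periodic_factors_through_circle[OF cont per] by blast
  define I where "I = integral {0..1} (\<lambda>x. (norm (d x))\<^sup>2)"
  have contd: "continuous_on {0..1} d" using cont continuous_on_subset by blast
  have I: "((\<lambda>x. (norm (d x))\<^sup>2) has_integral I) {0..1}"
    unfolding I_def by (intro integrable_integral integrable_continuous_real continuous_intros contd)
  have "compact (d ` {0..1})" by (intro compact_continuous_image contd) simp
  then obtain M where M: "\<And>x. x \<in> {0..1} \<Longrightarrow> norm (d x) \<le> M"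
    using bounded_iff compact_imp_bounded by (metis imageI)
  have M0: "M \<ge> 0" using M[of 0] norm_ge_zero[of "d 0"] by (simp add: order_trans[OF norm_ge_zero])
  have "norm (of_real I :: complex) \<le> M * e" if e: "e > 0" for e
  proof -
    have "continuous_on (sphere 0 1) (\<lambda>w. cnj (g w))" by (intro continuous_intros g)
    then obtain p where p: "polynomial_function p" "\<And>w. w \<in> sphere 0 1 \<Longrightarrow> norm (cnj (g w) - p w) < e"
      using Stone_Weierstrass_polynomial_function[OF compact_sphere _ e, of 0 1 "\<lambda>w. cnj (g w)"] by blast
    have "real_polynomial_function (Re \<circ> p)" "real_polynomial_function (Im \<circ> p)"
      using p(1) bounded_linear_Re bounded_linear_Im unfolding polynomial_function_def by blast+
    then have "fourier_null (\<lambda>x. d x * of_real ((Re \<circ> p) (fexp 1 x)) + \<i> * (d x * of_real ((Im \<circ> p) (fexp 1 x))))"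
      by (intro fourier_null_add fourier_null_cmult fourier_null_polynomial null)
    moreover have "(\<lambda>x. d x * of_real ((Re \<circ> p) (fexp 1 x)) + \<i> * (d x * of_real ((Im \<circ> p) (fexp 1 x)))) = (\<lambda>x. d x * p (fexp 1 x))"
      by (rule ext) (simp add: complex_eq_iff)
    ultimately have "((\<lambda>x. d x * p (fexp 1 x) * fexp 0 x) has_integral 0) {0..1}"
      unfolding fourier_null_def by metis
    then have "((\<lambda>x. of_real ((norm (d x))\<^sup>2) - d x * p (fexp 1 x)) has_integral (of_real I - 0)) {0..1}"
      using has_integral_of_real[OF I, where 'b = complex] by (intro has_integral_diff) simp_all
    moreover have "norm (of_real ((norm (d x))\<^sup>2) - d x * p (fexp 1 x)) \<le> M * e" if x: "x \<in> {0..1}" for x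
    proof -
      have "of_real ((norm (d x))\<^sup>2) - d x * p (fexp 1 x) = d x * (cnj (g (fexp 1 x)) - p (fexp 1 x))"
        unfolding g(2) complex_norm_square by (simp add: right_diff_distrib)
      moreover have "norm (cnj (g (fexp 1 x)) - p (fexp 1 x)) \<le> e"
        by (intro less_imp_le p(2)) simp
      ultimately show ?thesis using M[OF x] M0 by (simp add: norm_mult mult_mono)
    qed
    ultimately have "norm (of_real I - 0 :: complex) \<le> (M * e) * measure lborel (cbox 0 (1::real))"
      using M0 e by (intro has_integral_bound) auto
    then show ?thesis by simp
  qed
  then have le: "\<bar>I\<bar> \<le> M * e" if "e > 0" for e using that by simp
  have "\<bar>I\<bar> \<le> 0"
  proof (rule field_le_epsilon)
    fix e :: real assume e: "e > 0"
    have "\<bar>I\<bar> \<le> M * (e / (M + 1))" using M0 e by (intro le) simp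
    also have "\<dots> \<le> 0 + e" using M0 e by (simp add: field_simps)
    finally show "\<bar>I\<bar> \<le> 0 + e" .
  qed
  then have "I = 0" by simp
  then have "\<forall>x\<in>{0..1}. (norm (d x))\<^sup>2 = 0"
    unfolding I_def by (subst (asm) integral_eq_0_iff) (auto intro!: continuous_intros contd)
  then show ?thesis using x by simp
qed

text \<open>The series converges uniformly to some H with the same coefficients as h, so h - H is
  continuous with all coefficients zero. Evaluation at 0 suffices because h may be
  translated.\<close>

lemma fourier_inversion:
  fixes a :: "int \<Rightarrow> complex"
  assumes cont: "continuous_on UNIV h" and per: "\<And>x. h (x + 1) = h x"
    and coeff: "\<And>n. ((\<lambda>x. h x * fexp (- n) x) has_integral a n) {0..1}"
    and summable: "(\<lambda>n. norm (a n)) summable_on UNIV"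
  shows "(a has_sum h 0) UNIV"
proof -
  define H where "H x = (\<Sum>\<^sub>\<infinity>n. a n * fexp n x)" for x
  have lim: "uniform_limit S (\<lambda>N x. \<Sum>n\<in>N. a n * fexp n x) H (finite_subsets_at_top UNIV)" for S
    unfolding H_def[abs_def] by (rule Weierstrass_m_test_general[OF _ summable]) (simp add: norm_mult)
  have ev: "\<forall>\<^sub>F N in finite_subsets_at_top UNIV. finite (N :: int set)"
    by (simp add: eventually_finite_subsets_at_top_weakI)
  have contH: "continuous_on UNIV H"
    by (rule uniform_limit_theorem[OF _ lim]) (auto intro!: always_eventually continuous_intros)
  have coeffH: "((\<lambda>x. H x * fexp (- m) x) has_integral a m) {0..1}" for m
  proof -
    have u: "uniform_limit {0..1} (\<lambda>N x. (\<Sum>n\<in>N. a n * fexp n x) * fexp (- m) x) (\<lambda>x. H x * fexp (- m) x) (finite_subsets_at_top UNIV)"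
      by (intro uniform_lim_mult lim uniform_limit_const compact_imp_bounded compact_continuous_image continuous_on_subset[OF contH] continuous_intros) auto
    have c: "continuous_on {0..1} (\<lambda>x. (\<Sum>n\<in>N. a n * fexp n x) * fexp (- m) x)" for N
      by (intro continuous_intros)
    obtain I J where IJ: "\<And>N. ((\<lambda>x. (\<Sum>n\<in>N. a n * fexp n x) * fexp (- m) x) has_integral I N) {0..1}"
      "((\<lambda>x. H x * fexp (- m) x) has_integral J) {0..1}" "(I \<longlongrightarrow> J) (finite_subsets_at_top UNIV)"
      using uniform_limit_integral[OF u c finite_subsets_at_top_neq_bot] by blast
    have "I N = (if m \<in> N then a m else 0)" if N: "finite N" for N
    proof (rule has_integral_unique[OF IJ(1)])
      have "((\<lambda>x. \<Sum>n\<in>N. a n * fexp (n - m) x) has_integral (\<Sum>n\<in>N. a n * (if n - m = 0 then 1 else 0))) {0..1}"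
        by (intro has_integral_sum N has_integral_mult_right integral_fexp)
      moreover have "(\<Sum>n\<in>N. a n * (if n - m = 0 then 1 else 0)) = (if m \<in> N then a m else 0)"
        using N by (simp add: sum.delta if_distrib cong: if_cong)
      moreover have "(\<lambda>x. \<Sum>n\<in>N. a n * fexp (n - m) x) = (\<lambda>x. (\<Sum>n\<in>N. a n * fexp n x) * fexp (- m) x)"
        by (simp add: sum_distrib_right mult.assoc fexp_mult)
      ultimately show "((\<lambda>x. (\<Sum>n\<in>N. a n * fexp n x) * fexp (- m) x) has_integral (if m \<in> N then a m else 0)) {0..1}"
        by simp
    qed
    then have "\<forall>\<^sub>F N in finite_subsets_at_top UNIV. a m = I N"
      unfolding eventually_finite_subsets_at_top by (intro exI[of _ "{m}"]) auto
    then have "(I \<longlongrightarrow> a m) (finite_subsets_at_top UNIV)"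
      by (rule Lim_transform_eventually[OF tendsto_const])
    then have "J = a m" by (rule tendsto_unique[OF finite_subsets_at_top_neq_bot IJ(3)])
    with IJ(2) show ?thesis by simp
  qed
  have "h 0 - H 0 = 0"
  proof (rule fourier_null_imp_zero)
    show "continuous_on UNIV (\<lambda>x. h x - H x)" by (intro continuous_intros cont contH)
    have "fexp n (x + 1) = fexp n x" for n x
      using fexp_of_int[of n 1] by (simp add: fexp_def ring_distribs exp_add)
    then show "h (x + 1) - H (x + 1) = h x - H x" for x by (simp add: per H_def)
    have "((\<lambda>x. (h x - H x) * fexp n x) has_integral 0) {0..1}" for n
      using has_integral_diff[OF coeff[of "- n"] coeffH[of "- n"]] by (simp add: left_diff_distrib)
    then show "fourier_null (\<lambda>x. h x - H x)"
      unfolding fourier_null_def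
      by (intro conjI allI continuous_intros continuous_on_subset[OF cont] continuous_on_subset[OF contH]) auto
  qed simp
  moreover have "H 0 = infsum a UNIV"
    using fexp_of_int[of _ 0] by (simp add: H_def)
  moreover have "a summable_on UNIV"
    using summable by (rule abs_summable_summable)
  ultimately show ?thesis by (simp add: has_sum_iff)
qed

section \<open>Characterisation of the theta function\<close>

lemma summable_on_exp_abs: "(\<lambda>n::int. exp (- (2 * pi * \<bar>real_of_int n\<bar>))) summable_on UNIV"
proof -
  have "summable (\<lambda>n. exp (- (2 * pi)) ^ n)" by (rule summable_geometric) simp
  then have "(\<lambda>n. exp (- (2 * pi)) ^ n) summable_on UNIV" by (intro norm_summable_imp_summable_on) simp
  then have nat: "(\<lambda>n::nat. exp (- (2 * pi * real n))) summable_on UNIV"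
    by (simp add: mult_ac flip: exp_of_nat_mult)
  have "(\<lambda>n::int. exp (- (2 * pi * \<bar>real_of_int n\<bar>))) summable_on range int"
    by (subst summable_on_reindex) (use nat in \<open>auto simp: o_def\<close>)
  moreover have "(\<lambda>n::int. exp (- (2 * pi * \<bar>real_of_int n\<bar>))) summable_on (\<lambda>n. - int n) ` {0<..}"
    by (subst summable_on_reindex) (use summable_on_subset_banach[OF nat] in \<open>auto simp: o_def inj_on_def\<close>)
  ultimately have "(\<lambda>n::int. exp (- (2 * pi * \<bar>real_of_int n\<bar>))) summable_on (range int \<union> (\<lambda>n. - int n) ` {0<..})"
    by (rule summable_on_Un_disjoint) auto
  moreover have "range int \<union> (\<lambda>n. - int n) ` {0<..} = UNIV"
  proof -
    have "n \<in> range int \<union> (\<lambda>n. - int n) ` {0<..}" for n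
    proof (cases "n \<ge> 0")
      case True then show ?thesis by (auto intro: range_eqI[of _ _ "nat n"])
    next
      case False then show ?thesis by (intro UnI2 image_eqI[of _ _ "nat (- n)"]) auto
    qed
    then show ?thesis by blast
  qed
  ultimately show ?thesis by simp
qed

text \<open>The multiplier at \<tau> becomes a two-term recursion for the Fourier coefficients,
  leaving one free constant. Oddness makes C1 a sign, excludes C1 = 1 and fixes C2, after which the
  recursion is that of the coefficients of \<open>vartheta\<close>.\<close>

lemma theta_characterization:
  assumes hol: "f holomorphic_on UNIV" and odd: "\<And>z. f (- z) = - f z" and nonzero: "f z0 \<noteq> 0"
    and p1: "\<And>z. f (z + 1) = C1 * f z" and p2: "\<And>z. f (z + \<tau>) = C2 * exp (- (2 * of_real pi * \<i> * z)) * f z"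
  obtains K where "K \<noteq> 0" "\<And>z. vartheta z \<tau> = K * f z"
proof -
  have "f z0 = C1\<^sup>2 * f z0"
  proof -
    have "- f z0 = C1 * f (- z0 - 1)" using p1[of "- z0 - 1"] by (simp add: odd)
    also have "f (- z0 - 1) = - (C1 * f z0)" using odd[of "z0 + 1"] by (simp add: p1)
    finally show ?thesis by (simp add: power2_eq_square)
  qed
  then have "C1\<^sup>2 = 1\<^sup>2" using nonzero by simp
  then have C1: "C1 = 1 \<or> C1 = - 1" unfolding power2_eq_iff .
  \<comment> \<open>The exponents of the expansion are n + m/2: integers for C1 = 1, half-integers
    for C1 = -1.\<close>
  obtain m :: int where m: "(m = 0 \<and> C1 = 1) \<or> (m = 1 \<and> C1 = - 1)" using C1 by auto
  have C2: "C2 \<noteq> 0" using p2[of "z0 - \<tau>"] nonzero by auto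
  define e where "e n z = exp (- (of_real pi * \<i> * of_int (2 * n + m) * z))" for n :: int and z
  define k where "k n z = f z * e n z" for n z
  have e_1: "C1 * e n 1 = 1" for n
  proof -
    have 2: "exp (- (of_real pi * \<i> * of_int (2 * n))) = (1 :: complex)"
      unfolding exp_eq_1 by (auto intro!: exI[of _ "- n"])
    from m show ?thesis
    proof
      assume "m = 0 \<and> C1 = 1"
      then show ?thesis using 2 by (simp add: e_def)
    next
      assume m: "m = 1 \<and> C1 = - 1"
      have "e n 1 = exp (- (of_real pi * \<i> * of_int (2 * n))) * exp (- (of_real pi * \<i>))"
        unfolding e_def using m by (simp add: algebra_simps flip: exp_add)
      also have "\<dots> = - 1" unfolding 2 by (simp add: exp_minus mult.commute[of "of_real pi"])
      finally show ?thesis using m by simp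
    qed
  qed
  have k_per: "k n (z + 1) = k n z" for n z
  proof -
    have "e n (z + 1) = e n z * e n 1"
      unfolding e_def exp_add[symmetric] by (simp add: algebra_simps)
    then have "k n (z + 1) = f z * e n z * (C1 * e n 1)"
      unfolding k_def p1 by (simp only: mult_ac)
    then show ?thesis unfolding e_1 k_def by simp
  qed
  have hol_k: "k n holomorphic_on UNIV" for n
    unfolding k_def[abs_def] e_def[abs_def] by (intro holomorphic_intros hol)
  have cont_k: "continuous_on S (\<lambda>x. k n (z + of_real x))" for S n z
    by (intro continuous_on_compose2[OF holomorphic_on_imp_continuous_on[OF hol_k]] continuous_intros) auto
  define c where "c n = integral {0..1} (\<lambda>x. k n (of_real x))" for n
  have int_prim: "((\<lambda>x. k n (z + of_real x)) has_integral (P (z + 1) - P z)) {0..1}"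
    if P: "\<And>z. (P has_field_derivative k n z) (at z)" for P n z
  proof -
    have "((\<lambda>x. k n (z + of_real x)) has_integral (P (z + of_real 1) - P (z + of_real 0))) {0..1}"
    proof (rule fundamental_theorem_of_calculus)
      fix x :: real
      have "((\<lambda>w. P (z + w)) has_field_derivative k n (z + of_real x) * 1) (at (of_real x))"
        by (rule DERIV_chain2[OF P]) (auto intro!: derivative_eq_intros)
      from has_vector_derivative_real_field[OF this]
      show "((\<lambda>x. P (z + of_real x)) has_vector_derivative k n (z + of_real x)) (at x within {0..1})"
        by (simp add: has_vector_derivative_at_within)
    qed simp
    then show ?thesis by simp
  qed
  \<comment> \<open>The integral of k n over a horizontal segment of length 1 does not depend on its
    position; this is the shift of contour in terms of a primitive.\<close>
  have prim: "P (z + 1) - P z = c n" if P: "\<And>z. (P has_field_derivative k n z) (at z)" for P n z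
  proof -
    have "((\<lambda>w. P (w + 1) - P w) has_field_derivative k n (w + 1) * 1 - k n w) (at w)" for w
      by (intro DERIV_diff P DERIV_chain2[OF P]) (auto intro!: derivative_eq_intros)
    then have D: "((\<lambda>w. P (w + 1) - P w) has_field_derivative 0) (at w)" for w
      by (simp add: k_per)
    obtain C where C: "\<And>w. P (w + 1) - P w = C"
      using has_field_derivative_zero_constant[OF convex_UNIV D] by blast
    have "c n = P (0 + 1) - P 0" unfolding c_def using integral_unique[OF int_prim[OF P, of 0]] by simp
    then show ?thesis unfolding C by (rule sym)
  qed
  obtain P where P: "\<And>n z. (P n has_field_derivative k n z) (at z)"
  proof -
    have "\<exists>P. \<forall>z. (P has_field_derivative k n z) (at z)" for n
    proof (rule holomorphic_convex_primitive'[OF convex_UNIV open_UNIV hol_k[of n]])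
      fix P assume "\<And>z. z \<in> UNIV \<Longrightarrow> (P has_field_derivative k n z) (at z)"
      then show ?thesis by blast
    qed
    then show thesis using that by metis
  qed
  have c: "((\<lambda>x. k n (z + of_real x)) has_integral c n) {0..1}" for n z
    using int_prim[OF P] unfolding prim[OF P] .
  have rec: "c n = C2 * e n \<tau> * c (n + 1)" for n
  proof (rule has_integral_unique[OF c[of n \<tau>]])
    have "k n (\<tau> + z) = C2 * e n \<tau> * k (n + 1) z" for z
    proof -
      have "e n (\<tau> + z) * exp (- (2 * of_real pi * \<i> * z)) = e n \<tau> * e (n + 1) z"
        by (simp add: e_def algebra_simps flip: exp_add)
      then show ?thesis
        using p2[of z] unfolding k_def add.commute[of \<tau>] by (simp add: mult_ac)
    qed
    then show "((\<lambda>x. k n (\<tau> + of_real x)) has_integral C2 * e n \<tau> * c (n + 1)) {0..1}"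
      using has_integral_mult_right[OF c[of "n + 1" 0]] by simp
  qed
  have c_refl: "c (- n - m) = - c n" for n
  proof -
    have k_refl: "- k n (- z) = k (- n - m) z" for z
      by (simp add: k_def odd e_def algebra_simps)
    have "((\<lambda>z. P n (- z)) has_field_derivative k n (- z) * - 1) (at z)" for z
      by (rule DERIV_chain2[OF P]) (auto intro!: derivative_eq_intros)
    then have "((\<lambda>z. P n (- z)) has_field_derivative k (- n - m) z) (at z)" for z
      by (simp add: k_refl)
    from prim[OF this, of 0] prim[OF P, of n "- 1"] show ?thesis by simp (metis minus_diff_eq)
  qed
  \<comment> \<open>The coefficient is computed on the line Im z = y, where f is bounded. Using a
    line below and one above the given point yields exponential decay for n in both
    directions.\<close>
  have bound: "\<exists>M\<ge>0. \<forall>n. norm (c n) \<le> M * exp (2 * pi * of_int n * y)" for y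
  proof -
    have "compact ((\<lambda>x. f (\<i> * of_real y + of_real x)) ` {0..1})"
      by (intro compact_continuous_image continuous_on_compose2[OF holomorphic_on_imp_continuous_on[OF hol]] continuous_intros) auto
    then obtain M where M: "\<And>x. x \<in> {0..1} \<Longrightarrow> norm (f (\<i> * of_real y + of_real x)) \<le> M"
      using bounded_iff compact_imp_bounded by (metis imageI)
    have M0: "M \<ge> 0" using order_trans[OF norm_ge_zero M[of 0]] by simp
    have "norm (c n) \<le> M * exp (pi * of_int m * y) * exp (2 * pi * of_int n * y)" for n
    proof -
      have "norm (c n) \<le> (M * exp (pi * of_int m * y) * exp (2 * pi * of_int n * y)) * measure lborel (cbox 0 (1::real))"
      proof (rule has_integral_bound)
        show "((\<lambda>x. k n (\<i> * of_real y + of_real x)) has_integral c n) (cbox 0 1)" using c by simp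
        fix x :: real assume "x \<in> cbox 0 1"
        then have "norm (f (\<i> * of_real y + of_real x)) * norm (e n (\<i> * of_real y + of_real x))
          \<le> M * exp (pi * of_int (2 * n + m) * y)"
          by (intro mult_mono M0 M) (auto simp: e_def norm_exp_eq_Re)
        then show "norm (k n (\<i> * of_real y + of_real x)) \<le> M * exp (pi * of_int m * y) * exp (2 * pi * of_int n * y)"
          by (simp add: k_def norm_mult algebra_simps flip: exp_add)
      qed (use M0 in simp)
      then show ?thesis by simp
    qed
    then show ?thesis using M0 by (intro exI[of _ "M * exp (pi * of_int m * y)"]) auto
  qed
  have series: "((\<lambda>n. c n * exp (2 * of_real pi * \<i> * of_int n * z)) has_sum k 0 z) UNIV" for z
  proof -
    have "((\<lambda>n. c n * exp (2 * of_real pi * \<i> * of_int n * z)) has_sum k 0 (z + of_real 0)) UNIV"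
    proof (rule fourier_inversion)
      show "continuous_on UNIV (\<lambda>x. k 0 (z + of_real x))" by (rule cont_k)
      show "k 0 (z + of_real (x + 1)) = k 0 (z + of_real x)" for x
        using k_per[of 0 "z + of_real x"] by (simp add: add.assoc)
      show "((\<lambda>x. k 0 (z + of_real x) * fexp (- n) x) has_integral c n * exp (2 * of_real pi * \<i> * of_int n * z)) {0..1}" for n
      proof -
        have "k 0 (z + of_real x) * fexp (- n) x = k n (z + of_real x) * exp (2 * of_real pi * \<i> * of_int n * z)" for x
          by (simp add: k_def e_def fexp_def algebra_simps flip: exp_add)
        then show ?thesis using has_integral_mult_left[OF c] by simp
      qed
      obtain M1 M2 where M: "M1 \<ge> 0" "M2 \<ge> 0" "\<And>n. norm (c n) \<le> M1 * exp (2 * pi * of_int n * (Im z - 1))"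
        "\<And>n. norm (c n) \<le> M2 * exp (2 * pi * of_int n * (Im z + 1))"
        using bound[of "Im z - 1"] bound[of "Im z + 1"] by blast
      show "(\<lambda>n. norm (c n * exp (2 * of_real pi * \<i> * of_int n * z))) summable_on UNIV"
      proof (rule summable_on_comparison_test)
        show "(\<lambda>n::int. (M1 + M2) * exp (- (2 * pi * \<bar>real_of_int n\<bar>))) summable_on UNIV"
          by (intro summable_on_cmult_right summable_on_exp_abs)
        fix n :: int
        have E: "norm (exp (2 * of_real pi * \<i> * of_int n * z)) = exp (- (2 * pi * of_int n * Im z))"
          by (simp add: norm_exp_eq_Re)
        show "norm (c n * exp (2 * of_real pi * \<i> * of_int n * z)) \<le> (M1 + M2) * exp (- (2 * pi * \<bar>real_of_int n\<bar>))"
        proof (cases "n \<ge> 0")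
          case True
          have "norm (c n) * exp (- (2 * pi * of_int n * Im z)) \<le> M1 * exp (2 * pi * of_int n * (Im z - 1)) * exp (- (2 * pi * of_int n * Im z))"
            by (intro mult_right_mono M) auto
          also have "\<dots> = M1 * exp (- (2 * pi * \<bar>real_of_int n\<bar>))"
            using True by (simp add: mult.assoc algebra_simps flip: exp_add)
          also have "\<dots> \<le> (M1 + M2) * exp (- (2 * pi * \<bar>real_of_int n\<bar>))"
            using M by (intro mult_right_mono) auto
          finally show ?thesis unfolding norm_mult E .
        next
          case False
          have "norm (c n) * exp (- (2 * pi * of_int n * Im z)) \<le> M2 * exp (2 * pi * of_int n * (Im z + 1)) * exp (- (2 * pi * of_int n * Im z))"
            by (intro mult_right_mono M) auto
          also have "\<dots> = M2 * exp (- (2 * pi * \<bar>real_of_int n\<bar>))"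
            using False by (simp add: mult.assoc algebra_simps flip: exp_add)
          also have "\<dots> \<le> (M1 + M2) * exp (- (2 * pi * \<bar>real_of_int n\<bar>))"
            using M by (intro mult_right_mono) auto
          finally show ?thesis unfolding norm_mult E .
        qed
      qed simp
    qed
    then show ?thesis by simp
  qed
  have e_nz: "e n z \<noteq> 0" for n z by (simp add: e_def)
  have c_iff: "c (n + 1) = 0 \<longleftrightarrow> c n = 0" for n using rec[of n] C2 e_nz by simp
  have c_nz: "c 0 \<noteq> 0"
  proof
    assume c0: "c 0 = 0"
    have "c n = 0" for n
    proof (induction n rule: int_induct[where k = 0])
      case (step1 i) then show ?case using c_iff[of i] by simp
    next
      case (step2 i) then show ?case using c_iff[of "i - 1"] by simp
    qed (rule c0)
    then have "((\<lambda>_::int. 0) has_sum k 0 z0) UNIV" using series[of z0] by simp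
    then have "k 0 z0 = 0" by (rule has_sum_unique) (rule has_sum_0, rule refl)
    then show False using nonzero e_nz[of 0 z0] by (simp add: k_def)
  qed
  \<comment> \<open>For m = 0 the reflection fixes n = 0, so c 0 = - c 0.\<close>
  have "m \<noteq> 0" using c_refl[of 0] c_nz by auto
  then have m1: "m = 1" using m by auto
  \<comment> \<open>For m = 1 the reflection exchanges 0 and -1, and the recursion at -1 then
    determines C2.\<close>
  have C2_eq: "C2 * exp (of_real pi * \<i> * \<tau>) = - 1"
  proof -
    have "C2 * exp (of_real pi * \<i> * \<tau>) * c 0 = - 1 * c 0"
      using rec[of "- 1"] c_refl[of 0] by (simp add: m1 e_def)
    then show ?thesis unfolding mult_cancel_right using c_nz by blast
  qed
  define t where "t n = exp (of_real pi * \<i> * \<tau> * (of_int n + 1 / 2)\<^sup>2 + of_real pi * \<i> * (of_int n + 1 / 2))" for n :: int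
  have t_rec: "t n = C2 * e n \<tau> * t (n + 1)" for n
  proof -
    have 1: "t (n + 1) = t n * exp (of_real pi * \<i> * \<tau>) * exp (of_real pi * \<i> * of_int (2 * n + 1) * \<tau>) * exp (of_real pi * \<i>)"
      unfolding t_def exp_add[symmetric] by (rule arg_cong[where f = exp]) (simp add: power2_eq_square algebra_simps)
    have 2: "e n \<tau> * exp (of_real pi * \<i> * of_int (2 * n + 1) * \<tau>) = 1"
      unfolding e_def m1 exp_add[symmetric] by simp
    have "C2 * e n \<tau> * t (n + 1) = t n * (C2 * exp (of_real pi * \<i> * \<tau>)) * (e n \<tau> * exp (of_real pi * \<i> * of_int (2 * n + 1) * \<tau>)) * exp (of_real pi * \<i>)"
      unfolding 1 by (simp only: mult_ac)
    then show ?thesis unfolding 2 C2_eq by (simp add: mult.commute[of "of_real pi"])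
  qed
  have tc: "c n * t 0 = c 0 * t n" for n
  proof (induction n rule: int_induct[where k = 0])
    case (step1 i)
    then have "C2 * e i \<tau> * (c (i + 1) * t 0) = C2 * e i \<tau> * (c 0 * t (i + 1))"
      using rec[of i] t_rec[of i] by (simp add: mult_ac)
    then show ?case using C2 e_nz by simp
  next
    case (step2 i)
    then have "C2 * e (i - 1) \<tau> * (c i * t 0) = C2 * e (i - 1) \<tau> * (c 0 * t i)" by simp
    then show ?case using rec[of "i - 1"] t_rec[of "i - 1"] by (simp add: mult_ac)
  qed simp
  have t0: "t 0 \<noteq> 0" by (simp add: t_def)
  show thesis
  proof (rule that)
    show "t 0 / c 0 \<noteq> 0" using t0 c_nz by simp
    fix z
    have "((\<lambda>n. (t 0 / c 0 * exp (of_real pi * \<i> * z)) * (c n * exp (2 * of_real pi * \<i> * of_int n * z))) has_sum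
       (t 0 / c 0 * exp (of_real pi * \<i> * z)) * k 0 z) UNIV"
      by (rule has_sum_cmult_right[OF series])
    moreover have "(t 0 / c 0 * exp (of_real pi * \<i> * z)) * (c n * exp (2 * of_real pi * \<i> * of_int n * z)) =
      exp (of_real pi * \<i> * \<tau> * (of_int n + 1 / 2)\<^sup>2 + 2 * of_real pi * \<i> * (of_int n + 1 / 2) * (z + 1 / 2))" for n
    proof -
      have "t 0 / c 0 * c n = t n" using tc[of n] c_nz by (simp add: field_simps)
      then have "(t 0 / c 0 * exp (of_real pi * \<i> * z)) * (c n * exp (2 * of_real pi * \<i> * of_int n * z)) =
        t n * exp (of_real pi * \<i> * z) * exp (2 * of_real pi * \<i> * of_int n * z)"
        by (metis mult.assoc mult.commute)
      also have "\<dots> = exp (of_real pi * \<i> * \<tau> * (of_int n + 1 / 2)\<^sup>2 + 2 * of_real pi * \<i> * (of_int n + 1 / 2) * (z + 1 / 2))"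
        unfolding t_def exp_add[symmetric] by (rule arg_cong[where f = exp]) (simp add: algebra_simps)
      finally show ?thesis .
    qed
    moreover have "(t 0 / c 0 * exp (of_real pi * \<i> * z)) * k 0 z = t 0 / c 0 * f z"
    proof -
      have "exp (of_real pi * \<i> * z) * e 0 z = 1"
        unfolding e_def m1 exp_add[symmetric] by simp
      then show ?thesis unfolding k_def by (metis mult.assoc mult.commute mult_1)
    qed
    ultimately show "vartheta z \<tau> = t 0 / c 0 * f z"
      unfolding vartheta_def by (simp add: has_sum_iff)
  qed
qed

section \<open>The theta expression of a function with given quasi-periods\<close>

context sigma_function
begin

lemma nonzero_value: "\<exists>u. \<sigma> u \<noteq> 0"
proof (rule ccontr)
  assume "\<nexists>u. \<sigma> u \<noteq> 0"
  then have "\<sigma> = (\<lambda>_. 0)" by auto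
  then show False using deriv_0 by simp
qed

text \<open>The Gaussian factor in f makes the multiplier at l1 constant. By the Legendre relation
  the multiplier at l2 becomes a constant times exp (-2 pi i z), exactly that of a theta
  function.\<close>

lemma theta_expression:
  assumes q1: "quasi_period l1 e1" and q2: "quasi_period l2 e2"
    and legendre: "e1 * l2 - e2 * l1 = 2 * of_real pi * \<i>"
  obtains K where "K \<noteq> 0" "\<And>u. exp (1 / 2 * u\<^sup>2 * e1 / l1) * vartheta (u / l1) (l2 / l1) = K * \<sigma> u"
proof -
  obtain u0 where u0: "\<sigma> u0 \<noteq> 0" using nonzero_value by blast
  have l1: "l1 \<noteq> 0"
  proof
    assume "l1 = 0"
    then have "e1 = 0" using quasi_period_invariant(3)[OF q1 u0] by simp
    then show False using legendre \<open>l1 = 0\<close> by simp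
  qed
  obtain c1 where c1: "\<And>u. \<sigma> (u + l1) = c1 * exp (e1 * u) * \<sigma> u"
    using q1 unfolding quasi_period_def by blast
  obtain c2 where c2: "\<And>u. \<sigma> (u + l2) = c2 * exp (e2 * u) * \<sigma> u"
    using q2 unfolding quasi_period_def by blast
  define f where "f z = exp (- (e1 * l1 * z\<^sup>2 / 2)) * \<sigma> (l1 * z)" for z
  obtain K where K: "K \<noteq> 0" "\<And>z. vartheta z (l2 / l1) = K * f z"
  proof (rule theta_characterization)
    note K = that
    show "f holomorphic_on UNIV" unfolding f_def[abs_def]
      by (intro holomorphic_intros holomorphic_on_compose_gen[OF _ entire, unfolded o_def]) auto
    show "f (- z) = - f z" for z by (simp add: f_def odd)
    show "f (u0 / l1) \<noteq> 0" using u0 l1 by (simp add: f_def)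
    show "f (z + 1) = (c1 * exp (- (e1 * l1 / 2))) * f z" for z
    proof -
      have "exp (- (e1 * l1 * (z + 1)\<^sup>2 / 2)) * exp (e1 * (l1 * z)) = exp (- (e1 * l1 / 2)) * exp (- (e1 * l1 * z\<^sup>2 / 2))"
        unfolding exp_add[symmetric] by (rule arg_cong[where f = exp]) (simp add: power2_eq_square field_simps)
      then show ?thesis
        unfolding f_def using c1[of "l1 * z"] by (simp add: distrib_left mult_ac)
    qed
    show "f (z + l2 / l1) = (c2 * exp (- (e1 * l2\<^sup>2 / (2 * l1)))) * exp (- (2 * of_real pi * \<i> * z)) * f z" for z
    proof -
      have "exp (- (e1 * l1 * (z + l2 / l1)\<^sup>2 / 2)) * exp (e2 * (l1 * z)) =
        exp (- (e1 * l2\<^sup>2 / (2 * l1))) * exp (- (2 * of_real pi * \<i> * z)) * exp (- (e1 * l1 * z\<^sup>2 / 2))"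
        unfolding exp_add[symmetric] legendre[symmetric] using l1
        by (intro arg_cong[where f = exp]) (simp add: power2_eq_square field_simps)
      moreover have "l1 * (z + l2 / l1) = l1 * z + l2" using l1 by (simp add: distrib_left)
      ultimately show ?thesis
        unfolding f_def using c2[of "l1 * z"] by (simp add: mult_ac)
    qed
    show thesis if "K \<noteq> 0" "\<And>z. vartheta z (l2 / l1) = K * f z" for K
      using that by (rule K)
  qed
  show ?thesis
  proof (rule that[OF K(1)])
    fix u
    have "exp (1 / 2 * u\<^sup>2 * e1 / l1) * exp (- (e1 * l1 * (u / l1)\<^sup>2 / 2)) = 1"
      unfolding exp_add[symmetric] using l1 by (simp add: power2_eq_square field_simps)
    then show "exp (1 / 2 * u\<^sup>2 * e1 / l1) * vartheta (u / l1) (l2 / l1) = K * \<sigma> u"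
      unfolding K(2) f_def using l1 by simp
  qed
qed

end

section \<open>The sigma function of a curve\<close>

context sigma_flow_complex
begin

abbreviation "\<sigma> \<equiv> eval_fps S"

lemma sigma_has_fps_expansion: "\<sigma> has_fps_expansion S"
  by (simp add: has_fps_expansion_def fps_conv_radius_S)

lemma sigma_function: "sigma_function \<sigma> b2 b4 b6"
proof
  have expansion: "fps_expansion \<sigma> 0 = S"
    by (rule fps_expansion_eqI[OF sigma_has_fps_expansion])
  show "\<sigma> holomorphic_on UNIV"
    by (rule holomorphic_on_eval_fps) (simp add: fps_conv_radius_S)
  show "\<sigma> (- u) = - \<sigma> u" for u
  proof -
    have "\<sigma> (- u) = eval_fps (fps_scale (- 1) S) u"
      unfolding eval_fps_def fps_scale_nth power_minus[of u] by (simp only: mult_ac)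
    then show ?thesis by (simp add: S_odd eval_fps_minus fps_conv_radius_S)
  qed
  show "deriv \<sigma> 0 = 1"
    using fps_expansion_nth_1[of \<sigma> 0] S_nth by (simp add: expansion)
  have W: "W_fps S = W" by (simp add: W_fps_def W_def hirota_S)
  show "sigma_eq1 b2 b4 b6 (fps_expansion \<sigma> 0)" "sigma_eq2 b2 b4 (fps_expansion \<sigma> 0)"
    unfolding expansion sigma_eq1_def sigma_eq2_def W hirota_S by (rule W_sq deriv_W)+
qed

lemma curve_cover:
  assumes "nonsingular_curve m"
  shows "curve_cover \<sigma> b2 b4 b6 (m 1) (m 3) m"
proof (intro curve_cover.intro sigma_cover.intro sigma_curve.intro sigma_function)
  show "sigma_curve_axioms b2 b4 b6"
  proof
    show "6 * a\<^sup>2 + b2 * a + b4 \<noteq> 0" if a: "4 * a ^ 3 + b2 * a\<^sup>2 + 2 * b4 * a + b6 = 0" for a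
    proof
      \<comment> \<open>Over a multiple root a of the cubic, (a, b) is the point with 2 y + m 1 x +
        m 3 = 0; it is shown to be singular.\<close>
      define b where "b = - (m 1 * a + m 3) / 2"
      assume a': "6 * a\<^sup>2 + b2 * a + b4 = 0"
      have b: "2 * b = - (m 1 * a + m 3)" by (simp add: b_def)
      have "4 * (b\<^sup>2 + (m 1 * a + m 3) * b - (a ^ 3 + m 2 * a\<^sup>2 + m 4 * a + m 6))
          = (2 * b + (m 1 * a + m 3))\<^sup>2 - (4 * a ^ 3 + b2 * a\<^sup>2 + 2 * b4 * a + b6)"
        unfolding b2_def b4_def b6_def by algebra
      also have "\<dots> = 0" by (simp add: a b)
      finally have "b\<^sup>2 + (m 1 * a + m 3) * b - (a ^ 3 + m 2 * a\<^sup>2 + m 4 * a + m 6) = 0"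
        unfolding mult_eq_0_iff by simp
      then have on_curve: "(a, b) \<in> affine_curve m"
        by (simp add: affine_curve_def)
      have "2 * (m 1 * b - (3 * a\<^sup>2 + 2 * m 2 * a + m 4)) = m 1 * (2 * b + (m 1 * a + m 3)) - (6 * a\<^sup>2 + b2 * a + b4)"
        unfolding b2_def b4_def by algebra
      also have "\<dots> = 0" by (simp add: a' b)
      finally have "m 1 * b - (3 * a\<^sup>2 + 2 * m 2 * a + m 4) = 0"
        unfolding mult_eq_0_iff by simp
      then have "m 1 * b = 3 * a\<^sup>2 + 2 * m 2 * a + m 4" by (simp only: right_minus_eq)
      moreover have "2 * b + m 1 * a + m 3 = 0" using b by (simp add: add.assoc)
      ultimately show False
        using assms on_curve unfolding nonsingular_curve_def by blast
    qed
  qed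
  show "curve_cover_axioms b2 b4 b6 (m 1) (m 3) m"
    by unfold_locales (simp_all add: b2_def b4_def b6_def)
qed

end

section \<open>Normalisation at the origin and identification of \<open>sigma\<close>\<close>

context sigma_function
begin

lemma quotient_tendsto: "((\<lambda>u. \<sigma> u / u) \<longlongrightarrow> 1) (at 0)"
  using has_derivs(1)[of 0] unfolding DERIV_def by (simp add: sigma_0 deriv_0)

lemma normalisation: "(\<lambda>u. \<sigma> u - u) \<in> O[at 0](\<lambda>u. u\<^sup>2)"
proof -
  define g where "g u = (if u = 0 then 0 else (\<sigma> u - u) / u)" for u
  have d: "((\<lambda>u. \<sigma> u - u) has_field_derivative 0) (at 0)"
    using DERIV_diff[OF has_derivs(1)[of 0] DERIV_ident] by (simp add: deriv_0)
  have "g holomorphic_on UNIV"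
    by (rule pole_theorem_open_0[of "\<lambda>u. \<sigma> u - u" UNIV 0])
      (use DERIV_imp_deriv[OF d] in \<open>auto simp: g_def sigma_0 intro!: holomorphic_intros entire\<close>)
  then have "(g has_field_derivative deriv g 0) (at 0)"
    by (rule holomorphic_derivI) auto
  then have "((\<lambda>u. g u / u) \<longlongrightarrow> deriv g 0) (at 0)"
    unfolding DERIV_def by (simp add: g_def)
  moreover have "\<forall>\<^sub>F u in at 0. g u / u = (\<sigma> u - u) / u\<^sup>2"
    unfolding eventually_at_filter by (intro always_eventually) (simp add: g_def power2_eq_square)
  ultimately have "((\<lambda>u. (\<sigma> u - u) / u\<^sup>2) \<longlongrightarrow> deriv g 0) (at 0)"
    by (rule Lim_transform_eventually)
  then show ?thesis
    by (rule bigoI_tendsto) (simp add: eventually_at_filter)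
qed

text \<open>This makes the definite description in \<open>sigma\<close> meaningful: after division
  by u the limit at 0 is c - 1, and it must vanish.\<close>

lemma normalisation_unique:
  assumes "(\<lambda>u. c * \<sigma> u - u) \<in> O[at 0](\<lambda>u. u\<^sup>2)" shows "c = 1"
proof -
  have "(\<lambda>u::complex. u\<^sup>2) \<in> o[at 0](\<lambda>u. u)"
  proof (rule smalloI_tendsto)
    have "((\<lambda>u::complex. u) \<longlongrightarrow> 0) (at 0)" by (rule tendsto_ident_at)
    then show "((\<lambda>u::complex. u\<^sup>2 / u) \<longlongrightarrow> 0) (at 0)" by (simp add: power2_eq_square)
  qed (simp add: eventually_at_filter)
  with assms have "(\<lambda>u. c * \<sigma> u - u) \<in> o[at 0](\<lambda>u. u)" by (rule landau_o.big_small_trans)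
  then have "((\<lambda>u. (c * \<sigma> u - u) / u) \<longlongrightarrow> 0) (at 0)" by (rule smalloD_tendsto)
  moreover have "\<forall>\<^sub>F u in at 0. (c * \<sigma> u - u) / u = c * (\<sigma> u / u) - 1"
    unfolding eventually_at_filter by (intro always_eventually) (simp add: diff_divide_distrib)
  ultimately have "((\<lambda>u. c * (\<sigma> u / u) - 1) \<longlongrightarrow> 0) (at 0)"
    by (rule Lim_transform_eventually)
  moreover have "((\<lambda>u. c * (\<sigma> u / u) - 1) \<longlongrightarrow> c * 1 - 1) (at 0)"
    by (intro tendsto_intros quotient_tendsto)
  ultimately have "c * 1 - 1 = 0" by (metis tendsto_unique trivial_limit_at)
  then show ?thesis by simp
qed

end

context curve_cover
begin

text \<open>The intersection number is counted on smooth loops a and b homotopic to \<alpha> and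
  \<beta>. Their lifts have the same periods l1 and l2, so the count yields the Legendre relation
  for the integrals over \<alpha> and \<beta>. The theta expression is then K times the entire
  function, and normalisation selects 1/K.\<close>

lemma sigma_eq:
  assumes "symplectic_generators \<mu> \<alpha> \<beta>"
  shows "sigma \<mu> \<alpha> \<beta> = \<sigma>"
proof -
  have \<alpha>: "valid_path \<alpha>" "path_image \<alpha> \<subseteq> affine_curve \<mu>" "pathfinish \<alpha> = pathstart \<alpha>"
    and \<beta>: "valid_path \<beta>" "path_image \<beta> \<subseteq> affine_curve \<mu>" "pathfinish \<beta> = pathstart \<beta>"
    and num: "has_intersection_number \<mu> \<alpha> \<beta> 1"
    using assms by (auto simp: symplectic_generators_def)
  define l1 l2 e1 e2 where "l1 = form_integral (omega1 \<mu>) \<alpha>" and "l2 = form_integral (omega1 \<mu>) \<beta>"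
    and "e1 = form_integral (eta1 \<mu>) \<alpha>" and "e2 = form_integral (eta1 \<mu>) \<beta>"
  have q1: "quasi_period l1 e1" and q2: "quasi_period l2 e2"
    unfolding l1_def l2_def e1_def e2_def by (rule period_of_loop[OF \<alpha>] period_of_loop[OF \<beta>])+
  obtain a b where a: "C1_loop \<mu> a" and b: "C1_loop \<mu> b"
    and ha: "homotopic_loops (proj_curve \<mu>) (affine_pt \<circ> \<alpha>) (affine_pt \<circ> a)"
    and hb: "homotopic_loops (proj_curve \<mu>) (affine_pt \<circ> \<beta>) (affine_pt \<circ> b)"
    and tr: "transversal \<mu> a b" and sum: "(\<Sum>st \<in> crossings a b. crossing_sign \<mu> a b st) = of_int 1"
    using num unfolding has_intersection_number_def by blast
  define A' B' where "A' s = omega1 \<mu> (a s) (vector_derivative a (at s))"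
    and "B' t = omega1 \<mu> (b t) (vector_derivative b (at t))" for s t
  obtain A l where LA: "\<And>s. \<Phi> (A s) = affine_embedding (fst (a s)) (snd (a s))"
    "\<And>s. (A has_vector_derivative A' s) (at s)" "\<And>s. A (s + 1) = A s + l"
    by (rule lift_C1_loop[OF a, folded A'_def]) (rule that)
  obtain B l' where LB: "\<And>s. \<Phi> (B s) = affine_embedding (fst (b s)) (snd (b s))"
    "\<And>s. (B has_vector_derivative B' s) (at s)" "continuous_on UNIV B'" "\<And>s. B (s + 1) = B s + l'"
    by (rule lift_C1_loop[OF b, folded B'_def]) (rule that)
  interpret two_lifts \<sigma> b2 b4 b6 A B A' B'
    by unfold_locales (rule LA(2) LB(2,3))+
  have l: "l = l1" "l' = l2"
    unfolding l1_def l2_def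
    by (rule homotopic_loops_same_period[OF \<alpha>(1,2) contA LA(1,3) ha] homotopic_loops_same_period[OF \<beta>(1,2) contB LB(1,4) hb])+
  have cr: "crossing s t \<longleftrightarrow> a s = b t" for s t
    unfolding crossing_def Phi_eq_iff[symmetric] LA(1) LB(1) affine_embedding_inj by (rule prod_eq_iff[symmetric])
  have C: "crossings a b = {(s, t). s \<in> {0..<1} \<and> t \<in> {0..<1} \<and> crossing s t}"
    unfolding crossings_def cr ..
  have sign: "crossing_sign \<mu> a b (s, t) = sg s t" for s t
    unfolding crossing_sign_def sg_def A'_def B'_def by simp
  have "e1 * l2 - e2 * l1 = 2 * pi * \<i> * (\<Sum>(s, t)\<in>crossings a b. sg s t)"
  proof (rule legendre_relation[OF _ _ q1 q2 C])
    show "A (s + 1) = A s + l1" for s using LA(3) l by simp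
    show "B (s + 1) = B s + l2" for s using LB(4) l by simp
    show "finite (crossings a b)" using tr by (simp add: transversal_def)
    show "Im (cnj (A' s) * B' t) \<noteq> 0" if "(s, t) \<in> crossings a b" for s t
      using tr that sign[of s t] unfolding transversal_def sg_def by (metis sgn_zero)
  qed
  also have "(\<Sum>(s, t)\<in>crossings a b. sg s t) = 1"
  proof -
    have "(\<Sum>(s, t)\<in>crossings a b. sg s t) = (\<Sum>st \<in> crossings a b. crossing_sign \<mu> a b st)"
      by (rule sum.cong) (auto simp: sign)
    then show ?thesis using sum by simp
  qed
  finally have "e1 * l2 - e2 * l1 = 2 * of_real pi * \<i>" by simp
  then obtain K where K: "K \<noteq> 0" "\<And>u. exp (1 / 2 * u\<^sup>2 * e1 / l1) * vartheta (u / l1) (l2 / l1) = K * \<sigma> u"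
    using theta_expression[OF q1 q2] by blast
  have "(THE c. c \<noteq> 0 \<and> (\<lambda>u. c * (K * \<sigma> u) - u) \<in> O[at 0](\<lambda>u. u\<^sup>2)) = 1 / K"
  proof (rule the_equality)
    show "1 / K \<noteq> 0 \<and> (\<lambda>u. 1 / K * (K * \<sigma> u) - u) \<in> O[at 0](\<lambda>u. u\<^sup>2)"
      using K(1) normalisation by simp
    fix c assume "c \<noteq> 0 \<and> (\<lambda>u. c * (K * \<sigma> u) - u) \<in> O[at 0](\<lambda>u. u\<^sup>2)"
    then have "c * K = 1"
      by (intro normalisation_unique) (simp add: mult.assoc)
    then show "c = 1 / K" using K(1) by (simp add: field_simps)
  qed
  then show ?thesis
    unfolding sigma_def Let_def l1_def[symmetric] l2_def[symmetric] e1_def[symmetric] e2_def[symmetric] K(2)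
    using K(1) by simp
qed

end

section \<open>The universal expansions and their integrality\<close>

theorem theorem2p10:
  shows "\<exists>S2 S :: qpoly fps.
    is_universal_expansion (\<lambda>\<mu> \<alpha> \<beta> u. (sigma \<mu> \<alpha> \<beta> u)\<^sup>2) S2 \<and>
    S2 \<in> hurwitz_integral (int_adjoin {Mu 1, Mu 2, Mu 3, Mu 4, Mu 6}) \<and>
    is_universal_expansion sigma S \<and>
    S \<in> hurwitz_integral (int_adjoin {half_Mu1, Mu 2, Mu 3, Mu 4, Mu 6}) \<and>
    hurwitz_coeff S 0 = 0 \<and>
    hurwitz_coeff S 1 = 1 \<and>
    hurwitz_coeff S 2 = 0 \<and>
    hurwitz_coeff S 3 = half_Mu1 ^ 2 + Mu 2 \<and>
    hurwitz_coeff S 4 = 0 \<and>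
    hurwitz_coeff S 5 = half_Mu1 ^ 4 + 2 * Mu 2 * half_Mu1 ^ 2 + Mu 3 * Mu 1 + Mu 2 ^ 2 + 2 * Mu 4 \<and>
    hurwitz_coeff S 6 = 0 \<and>
    hurwitz_coeff S 7 = half_Mu1 ^ 6 + 3 * Mu 2 * half_Mu1 ^ 4 + 6 * Mu 3 * half_Mu1 ^ 3
      + 3 * Mu 2 ^ 2 * half_Mu1 ^ 2 + 6 * Mu 4 * half_Mu1 ^ 2 + 6 * Mu 3 * Mu 2 * half_Mu1
      + Mu 2 ^ 3 + 6 * Mu 4 * Mu 2 + 6 * Mu 3 ^ 2 + 24 * Mu 6"
proof -
  obtain t v k e where flow: "sigma_flow Mu half_Mu1 t v k e" by (rule universal_sigma_flow)
  interpret sigma_flow Mu half_Mu1 t v k e by (rule flow)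
  interpret sigma_flow_idom Mu half_Mu1 t v k e ..
  have spec: "fps_spec \<mu> S = sigma_fps (fps_spec \<mu> t) (fps_spec \<mu> e)" for \<mu>
    by (simp add: sigma_fps_def fps_spec_mult)
  have sigma: "sigma \<mu> \<alpha> \<beta> has_fps_expansion fps_spec \<mu> S"
    if \<mu>: "nonsingular_curve \<mu>" and sym: "symplectic_generators \<mu> \<alpha> \<beta>" for \<mu> \<alpha> \<beta>
  proof -
    interpret \<mu>: sigma_flow \<mu> "\<mu> 1 / 2" "fps_spec \<mu> t" "fps_spec \<mu> v" "fps_spec \<mu> k" "fps_spec \<mu> e"
      by (rule sigma_flow_spec[OF flow])
    interpret \<mu>: sigma_flow_complex \<mu> "\<mu> 1 / 2" "fps_spec \<mu> t" "fps_spec \<mu> v" "fps_spec \<mu> k" "fps_spec \<mu> e" ..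
    interpret C: curve_cover \<mu>.\<sigma> \<mu>.b2 \<mu>.b4 \<mu>.b6 "\<mu> 1" "\<mu> 3" \<mu>
      by (rule \<mu>.curve_cover[OF \<mu>])
    show ?thesis
      unfolding C.sigma_eq[OF sym] spec by (rule \<mu>.sigma_has_fps_expansion)
  qed
  have "is_universal_expansion sigma S"
    unfolding is_universal_expansion_def fps_spec_def[symmetric] using sigma by blast
  moreover have "is_universal_expansion (\<lambda>\<mu> \<alpha> \<beta> u. (sigma \<mu> \<alpha> \<beta> u)\<^sup>2) (S\<^sup>2)"
    unfolding is_universal_expansion_def fps_spec_def[symmetric] fps_spec_power
    using sigma by (blast intro: has_fps_expansion_power)
  moreover have "S\<^sup>2 \<in> hurwitz_integral (int_adjoin {Mu 1, Mu 2, Mu 3, Mu 4, Mu 6})"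
    by (rule sigma_square_integral) (auto intro: int_adjoin.intros)
  moreover have "S \<in> hurwitz_integral (int_adjoin {half_Mu1, Mu 2, Mu 3, Mu 4, Mu 6})"
    by (rule sigma_integral) (auto intro: int_adjoin.intros)
  moreover have "hurwitz_coeff S 0 = 0" "hurwitz_coeff S 1 = 1" "hurwitz_coeff S 2 = 0" "hurwitz_coeff S 4 = 0" "hurwitz_coeff S 6 = 0"
    using S_nth S2_nth S_nth_low by (simp_all add: hurwitz_coeff_def)
  moreover have "hurwitz_coeff S 3 = 6 * S $ 3" "hurwitz_coeff S 5 = 120 * S $ 5" "hurwitz_coeff S 7 = 5040 * S $ 7"
    by (simp_all add: hurwitz_coeff_def fact_numeral)
  then have "hurwitz_coeff S 3 = half_Mu1 ^ 2 + Mu 2"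
    "hurwitz_coeff S 5 = half_Mu1 ^ 4 + 2 * Mu 2 * half_Mu1 ^ 2 + Mu 3 * Mu 1 + Mu 2 ^ 2 + 2 * Mu 4"
    "hurwitz_coeff S 7 = half_Mu1 ^ 6 + 3 * Mu 2 * half_Mu1 ^ 4 + 6 * Mu 3 * half_Mu1 ^ 3
      + 3 * Mu 2 ^ 2 * half_Mu1 ^ 2 + 6 * Mu 4 * half_Mu1 ^ 2 + 6 * Mu 3 * Mu 2 * half_Mu1
      + Mu 2 ^ 3 + 6 * Mu 4 * Mu 2 + 6 * Mu 3 ^ 2 + 24 * Mu 6"
    unfolding S_nth_low b4_def b6_def half_Mu1[symmetric] by (simp, algebra, algebra)
  ultimately show ?thesis by blast
qed

end
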